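(* Let $p\in(1,2]$, $s\in(1+1/p,2)$ and $f\in W^s_p(\mathbb{R})$. Then for every $\lambda\in\mathbb{R}$ with $|\lambda|\ge1$, the operator $\lambda-\mathbb{A}(f)$ is an isomorphism of $L_p(\mathbb{R})$, i.e. $\lambda-\mathbb{A}(f)\in\operatorname{Isom}(L_p(\mathbb{R}))$.
   Context: $W^s_p(\mathbb{R})$ is the Sobolev–Slobodeckij space. For $f\in W^s_p(\mathbb{R})$, $\mathbb{A}(f)\in\mathcal{L}(L_p(\mathbb{R}))$ is the (bounded extension of the) singular integral operator \[ \mathbb{A}(f)[\overline{\omega}](x):=\frac1\pi\operatorname{PV}\int_{\mathbb{R}}\frac{yf'(x)-(f(x)-f(x-y))}{y^2+(f(x)-f(x-y))^2}\overline{\omega}(x-y)\,dy . \] $\operatorname{Isom}(X)$ denotes bounded linear bijections of $X$ with bounded inverse. *)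

theory Defs
  imports "HOL-Analysis.Analysis"
begin

section \<open>L_p(R) for real-valued functions (elements = representatives, identified a.e.)\<close>

definition Lp :: "real \<Rightarrow> (real \<Rightarrow> real) set" where
  "Lp p = {u. u \<in> borel_measurable lborel \<and> integrable lborel (\<lambda>x. \<bar>u x\<bar> powr p)}"

definition Lp_norm :: "real \<Rightarrow> (real \<Rightarrow> real) \<Rightarrow> real" where
  "Lp_norm p u = (\<integral>x. \<bar>u x\<bar> powr p \<partial>lborel) powr (1 / p)"

definition ae_eq :: "(real \<Rightarrow> real) \<Rightarrow> (real \<Rightarrow> real) \<Rightarrow> bool" where
  "ae_eq u v \<longleftrightarrow> (AE x in lborel. u x = v x)"

definition test_fun :: "(real \<Rightarrow> real) \<Rightarrow> bool" where
  "test_fun \<phi> \<longleftrightarrow> (\<forall>n x. ((deriv ^^ n) \<phi>) differentiable (at x)) \<and> bounded {x. \<phi> x \<noteq> 0}"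

definition weak_deriv :: "(real \<Rightarrow> real) \<Rightarrow> (real \<Rightarrow> real) \<Rightarrow> bool" where
  "weak_deriv u g \<longleftrightarrow> g \<in> borel_measurable lborel \<and>
     (\<forall>\<phi>. test_fun \<phi> \<longrightarrow>
        integrable lborel (\<lambda>x. u x * deriv \<phi> x) \<and> integrable lborel (\<lambda>x. g x * \<phi> x) \<and>
        (\<integral>x. u x * deriv \<phi> x \<partial>lborel) = - (\<integral>x. g x * \<phi> x \<partial>lborel))"

text \<open>A fixed choice of weak derivative (unique up to null sets).\<close>
definition wderiv :: "(real \<Rightarrow> real) \<Rightarrow> (real \<Rightarrow> real)" where
  "wderiv u = (SOME g. weak_deriv u g)"

text \<open>W^s_p(R) for 1 < s < 2: u in W^1_p and the Slobodeckij seminorm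
  [u']_{s-1,p} is finite.\<close>
definition sobolev_slobodeckij :: "real \<Rightarrow> real \<Rightarrow> (real \<Rightarrow> real) set" where
  "sobolev_slobodeckij s p = {u. u \<in> Lp p \<and> (\<exists>g. weak_deriv u g \<and> g \<in> Lp p \<and>
      (\<integral>\<^sup>+ x. \<integral>\<^sup>+ y. ennreal (\<bar>g x - g y\<bar> powr p / \<bar>x - y\<bar> powr (1 + (s - 1) * p)) \<partial>lborel \<partial>lborel) < \<infinity>)}"

definition A_kernel :: "(real \<Rightarrow> real) \<Rightarrow> real \<Rightarrow> real \<Rightarrow> real" where
  "A_kernel f x y = (y * wderiv f x - (f x - f (x - y))) / (y\<^sup>2 + (f x - f (x - y))\<^sup>2)"

definition A_trunc :: "(real \<Rightarrow> real) \<Rightarrow> (real \<Rightarrow> real) \<Rightarrow> real \<Rightarrow> real \<Rightarrow> real" where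
  "A_trunc f \<omega> x \<epsilon> = (1 / pi) * (\<integral>y\<in>{y. \<epsilon> < \<bar>y\<bar> \<and> \<bar>y\<bar> < 1 / \<epsilon>}. A_kernel f x y * \<omega> (x - y) \<partial>lborel)"

definition bounded_op_Lp :: "real \<Rightarrow> ((real \<Rightarrow> real) \<Rightarrow> (real \<Rightarrow> real)) \<Rightarrow> bool" where
  "bounded_op_Lp p T \<longleftrightarrow>
     (\<forall>u\<in>Lp p. T u \<in> Lp p) \<and>
     (\<forall>u\<in>Lp p. \<forall>v\<in>Lp p. ae_eq u v \<longrightarrow> ae_eq (T u) (T v)) \<and>
     (\<forall>u\<in>Lp p. \<forall>v\<in>Lp p. \<forall>a b. ae_eq (T (\<lambda>x. a * u x + b * v x)) (\<lambda>x. a * T u x + b * T v x)) \<and>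
     (\<exists>C. \<forall>u\<in>Lp p. Lp_norm p (T u) \<le> C * Lp_norm p u)"

definition isom_Lp :: "real \<Rightarrow> ((real \<Rightarrow> real) \<Rightarrow> (real \<Rightarrow> real)) \<Rightarrow> bool" where
  "isom_Lp p S \<longleftrightarrow> bounded_op_Lp p S \<and>
     (\<forall>u\<in>Lp p. ae_eq (S u) (\<lambda>x. 0) \<longrightarrow> ae_eq u (\<lambda>x. 0)) \<and>
     (\<forall>v\<in>Lp p. \<exists>u\<in>Lp p. ae_eq (S u) v) \<and>
     (\<exists>c. \<forall>u\<in>Lp p. Lp_norm p u \<le> c * Lp_norm p (S u))"

text \<open>T is (the bounded extension of) A(f): a bounded operator on L_p agreeing a.e.
  with the principal value integral on the dense class of test functions.\<close>
definition is_A_op :: "real \<Rightarrow> (real \<Rightarrow> real) \<Rightarrow> ((real \<Rightarrow> real) \<Rightarrow> (real \<Rightarrow> real)) \<Rightarrow> bool" where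
  "is_A_op p f T \<longleftrightarrow> bounded_op_Lp p T \<and>
     (\<forall>\<omega>. test_fun \<omega> \<longrightarrow> (AE x in lborel. (A_trunc f \<omega> x \<longlongrightarrow> T \<omega> x) (at_right 0)))"

end

theory Submission
  imports Defs
begin

text \<open>The function \<open>f\<close> has a representative \<open>F\<close> of class \<open>C\<^sup>1\<close> that vanishes at infinity and whose
  derivative \<open>G\<close> is bounded, Hoelder continuous and in \<open>L\<^sub>p\<close>. Hence the kernel of \<open>A(f)\<close> is weakly singular on the
  diagonal, and away from it the kernel is at most \<open>|G x| / |y| + O(y\<^sup>-\<^sup>2)\<close>.

  On \<open>L\<^sub>2\<close> the argument is Rellich's. For a test function \<open>\<omega>\<close> the Cauchy integral of \<open>\<omega>\<close> over the graph
  of \<open>F\<close> is holomorphic off the graph, so its square integrates to zero along the vertically shifted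
  graphs, and therefore so do the squares of its two boundary values. Multiplied by \<open>1 + i G\<close> these are
  \<open>\<pi> (B \<omega> + i (A \<omega> \<mp> \<omega>))\<close>, and the real parts of the two identities combine to
  \<open>\<parallel>\<omega>\<parallel> \<le> c \<parallel>(\<lambda> - A) \<omega>\<parallel>\<close> uniformly in \<open>|\<lambda>| \<ge> 1\<close>. Since \<open>\<lambda> - A\<close> is invertible for large \<open>|\<lambda>|\<close>, the
  continuity method gives invertibility for all these \<open>\<lambda>\<close>.

  To pass to \<open>L\<^sub>p\<close>, split \<open>A = S + R\<close> where \<open>S\<close>, which collects the kernel near the diagonal and for large
  \<open>|x|\<close>, has norm at most \<open>1/\<pi>\<close> on both \<open>L\<^sub>p\<close> and \<open>L\<^sub>2\<close>, while \<open>R\<close> maps either space into \<open>L\<^sub>p \<inter> L\<^sub>2\<close>. With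
  \<open>(\<lambda> - S) v = g\<close> in \<open>L\<^sub>p\<close> and \<open>(\<lambda> - A) w = R v\<close> in \<open>L\<^sub>2\<close>, the equation \<open>(\<lambda> - S) w = R v + R w\<close> shows that
  \<open>w\<close> lies in \<open>L\<^sub>p\<close>, and \<open>v + w\<close> solves \<open>(\<lambda> - A) u = g\<close>. Injectivity follows in the same way.\<close>

section \<open>Complete spaces of functions\<close>

text \<open>The quadratic argument is tied to \<open>L_2\<close>, and for p < 2 the space
  \<open>L_p\<close> is not contained in \<open>L_2\<close>; this forces the transfer and requires
  one kernel to act on both spaces. The obstacle there is the term G x / y for large y: 1/|y| is not
  integrable, so Young's inequality does not apply to it. But G lies in \<open>L_q\<close>, while
  1/|y| away from 0 lies in the dual space, so this term is treated as a product kernel by Hoelder's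
  inequality. For such a kernel the exponent of the output depends only on the factor in x; once x
  is confined to a compact set it can be chosen freely, which is how R mixes the two spaces.

  The threshold |\<lambda>| \<ge> 1 comes from the Rellich step: with weights (1 + \<lambda>)/2 and
  (1 - \<lambda>)/2 the two identities add up to an expression in which \<omega> occurs only through
  (\<lambda>^2 - 1) \<omega>^2, of favourable sign. This bounds B \<omega> by (\<lambda> - A)
  \<omega>; the difference of the identities then bounds \<omega> by these two functions.\<close>

locale fspace =
  fixes X :: "(real \<Rightarrow> real) set" and N :: "(real \<Rightarrow> real) \<Rightarrow> real"
  assumes zero_mem: "(\<lambda>_. 0) \<in> X"
    and comb_mem: "\<And>u v a b. u \<in> X \<Longrightarrow> v \<in> X \<Longrightarrow> (\<lambda>x. a * u x + b * v x) \<in> X"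
    and N_ge0: "\<And>u. u \<in> X \<Longrightarrow> 0 \<le> N u"
    and N_scale: "\<And>u a. u \<in> X \<Longrightarrow> N (\<lambda>x. a * u x) = \<bar>a\<bar> * N u"
    and N_add: "\<And>u v. u \<in> X \<Longrightarrow> v \<in> X \<Longrightarrow> N (\<lambda>x. u x + v x) \<le> N u + N v"
    and N_complete: "\<And>u. (\<And>n. u n \<in> X) \<Longrightarrow> summable (\<lambda>n. N (u n)) \<Longrightarrow>
          \<exists>w\<in>X. (\<lambda>n. N (\<lambda>x. w x - (\<Sum>k<n. u k x))) \<longlonglongrightarrow> 0"
begin

lemma add_mem: "u \<in> X \<Longrightarrow> v \<in> X \<Longrightarrow> (\<lambda>x. u x + v x) \<in> X"
  using comb_mem[of u v 1 1] by simp

lemma diff_mem: "u \<in> X \<Longrightarrow> v \<in> X \<Longrightarrow> (\<lambda>x. u x - v x) \<in> X"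
  using comb_mem[of u v 1 "-1"] by simp

lemma scale_mem: "u \<in> X \<Longrightarrow> (\<lambda>x. a * u x) \<in> X"
  using comb_mem[of u u a 0] by simp

lemma sum_mem: "(\<And>k. k < (n::nat) \<Longrightarrow> u k \<in> X) \<Longrightarrow> (\<lambda>x. \<Sum>k<n. u k x) \<in> X"
proof (induction n)
  case (Suc n)
  have "(\<lambda>x. (\<Sum>k<n. u k x) + u n x) \<in> X" by (rule add_mem) (use Suc in auto)
  then show ?case by simp
qed (simp add: zero_mem)

lemma N_zero: "N (\<lambda>_. 0) = 0"
  using N_scale[OF zero_mem, of 0] by simp

lemma N_le:
  assumes "v \<in> X" "w \<in> X" "\<And>x. u x = v x + w x"
  shows "N u \<le> N v + N w"
proof -
  have "u = (\<lambda>x. v x + w x)" using assms(3) by auto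
  then show ?thesis using N_add[OF assms(1,2)] by simp
qed

lemma N_swap:
  assumes "v \<in> X" "w \<in> X"
  shows "N (\<lambda>x. v x - w x) = N (\<lambda>x. w x - v x)"
proof -
  have "(\<lambda>x. v x - w x) = (\<lambda>x. (-1) * (w x - v x))" by auto
  then show ?thesis using N_scale[OF diff_mem[OF assms(2,1)], of "-1"] by simp
qed

lemma N_sum_le: "(\<And>k. k < (n::nat) \<Longrightarrow> u k \<in> X) \<Longrightarrow> N (\<lambda>x. \<Sum>k<n. u k x) \<le> (\<Sum>k<n. N (u k))"
proof (induction n)
  case 0 then show ?case by (simp add: N_zero)
next
  case (Suc n)
  have "N (\<lambda>x. \<Sum>k<Suc n. u k x) \<le> N (\<lambda>x. \<Sum>k<n. u k x) + N (u n)"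
    by (rule N_le[OF sum_mem]) (use Suc.prems in auto)
  with Suc show ?case by force
qed

text \<open>Elements are functions rather than classes, so N is only a seminorm and operators are
  linear only up to an error of seminorm zero. The bound C is a parameter because the Neumann series
  and the starting point of the continuity method are quantitative in it.\<close>

definition lin_op :: "((real \<Rightarrow> real) \<Rightarrow> real \<Rightarrow> real) \<Rightarrow> real \<Rightarrow> bool" where
  "lin_op T C \<longleftrightarrow> 0 \<le> C \<and> (\<forall>u\<in>X. T u \<in> X \<and> N (T u) \<le> C * N u) \<and>
     (\<forall>u\<in>X. \<forall>v\<in>X. \<forall>a b. N (\<lambda>x. T (\<lambda>x. a * u x + b * v x) x - (a * T u x + b * T v x)) = 0)"

lemma lin_op_mem: "lin_op T C \<Longrightarrow> u \<in> X \<Longrightarrow> T u \<in> X"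
  and lin_op_le: "lin_op T C \<Longrightarrow> u \<in> X \<Longrightarrow> N (T u) \<le> C * N u"
  and lin_op_ge0: "lin_op T C \<Longrightarrow> 0 \<le> C"
  and lin_op_comb: "lin_op T C \<Longrightarrow> u \<in> X \<Longrightarrow> v \<in> X \<Longrightarrow>
        N (\<lambda>x. T (\<lambda>x. a * u x + b * v x) x - (a * T u x + b * T v x)) = 0"
  by (auto simp: lin_op_def)

section \<open>Operators linear modulo null elements, Neumann series and the continuity
  method\<close>

lemma lin_op_diff:
  assumes T: "lin_op T C" and u: "u \<in> X" "v \<in> X"
  shows "N (\<lambda>x. T u x - T v x) \<le> C * N (\<lambda>x. u x - v x)"
proof -
  note m = lin_op_mem[OF T]
  let ?d = "\<lambda>x. 1 * u x + (-1) * v x"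
  have d: "?d \<in> X" using comb_mem u by blast
  have 0: "N (\<lambda>x. T ?d x - (1 * T u x + (-1) * T v x)) = 0"
    by (rule lin_op_comb[OF T u])
  have mm: "(\<lambda>x. 1 * T u x + (-1) * T v x) \<in> X" by (intro comb_mem m u)
  have "N (\<lambda>x. T u x - T v x) \<le> N (\<lambda>x. (1 * T u x + (-1) * T v x) - T ?d x) + N (T ?d)"
    by (rule N_le[OF diff_mem[OF mm m[OF d]] m[OF d]]) simp
  also have "\<dots> = N (T ?d)" using 0 N_swap[OF mm m[OF d]] by simp
  also have "\<dots> \<le> C * N ?d" by (rule lin_op_le[OF T d])
  finally show ?thesis by simp
qed

lemma lin_op_scale: "lin_op T C \<Longrightarrow> lin_op (\<lambda>u x. s * T u x) (\<bar>s\<bar> * C)"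
  unfolding lin_op_def
proof (safe, goal_cases)
  case (1) then show ?case by simp
next
  case (2 u) then show ?case by (auto intro: scale_mem)
next
  case (3 u) then show ?case by (auto simp: N_scale mult.assoc intro: mult_left_mono)
next
  case (4 u v a b)
  have "(\<lambda>x. s * T (\<lambda>x. a * u x + b * v x) x - (a * (s * T u x) + b * (s * T v x))) =
     (\<lambda>x. s * (T (\<lambda>x. a * u x + b * v x) x - (a * T u x + b * T v x)))"
    by (auto simp: algebra_simps)
  then show ?case using 4 by (simp add: N_scale diff_mem comb_mem)
qed

text \<open>The powers of S applied to g have geometrically decreasing seminorm, so completeness in
  its series form yields a limit w of the partial sums; the geometric series also gives the bound on
  the solution.\<close>

lemma neumann:
  assumes S: "lin_op S r" and r: "r < 1" and g: "g \<in> X"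
  shows "\<exists>u\<in>X. N (\<lambda>x. u x - S u x - g x) = 0 \<and> N u \<le> N g / (1 - r)"
proof -
  define u where "u n = (S ^^ n) g" for n
  note m = lin_op_mem[OF S]
  have r0: "0 \<le> r" by (rule lin_op_ge0[OF S])
  have um: "u n \<in> X" for n by (induction n) (auto simp: u_def g m)
  have uN: "N (u n) \<le> r ^ n * N g" for n
  proof (induction n)
    case (Suc n)
    have "N (u (Suc n)) \<le> r * N (u n)" using lin_op_le[OF S um[of n]] by (simp add: u_def)
    also have "\<dots> \<le> r * (r ^ n * N g)" using Suc r0 by (intro mult_left_mono) auto
    finally show ?case by (simp add: mult.assoc)
  qed (simp add: u_def)
  have sg: "summable (\<lambda>n. r ^ n * N g)" using r r0 by (intro summable_mult2 summable_geometric) auto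
  have su: "summable (\<lambda>n. N (u n))"
    by (rule summable_comparison_test_ev[OF _ sg]) (use uN N_ge0[OF um] in auto)
  define s where "s n = (\<lambda>x. \<Sum>k<n. u k x)" for n
  have sm: "s n \<in> X" for n unfolding s_def by (intro sum_mem um)
  obtain w where w: "w \<in> X" and lim: "(\<lambda>n. N (\<lambda>x. w x - s n x)) \<longlonglongrightarrow> 0"
    using N_complete[OF um su] unfolding s_def by blast
  \<comment> \<open>With exact linearity this recursion would be an identity of functions. Here
    every step of the induction adds a linearity defect of seminorm zero.\<close>
  have Ss: "N (\<lambda>x. s (Suc n) x - S (s n) x - g x) = 0" for n
  proof (induction n)
    case 0
    have z: "N (\<lambda>x. S (\<lambda>x. 0) x) \<le> r * N (\<lambda>_. 0)" using lin_op_le[OF S zero_mem] by simp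
    have "S (\<lambda>x. 0) \<in> X" using m zero_mem by blast
    then have "N (\<lambda>x. (-1) * S (\<lambda>x. 0) x) = 0"
      using z N_ge0 by (subst N_scale) (auto simp: N_zero order_antisym)
    then show ?case by (simp add: s_def u_def)
  next
    case (Suc n)
    let ?e1 = "\<lambda>x. s (Suc n) x - S (s n) x - g x"
    let ?e2 = "\<lambda>x. S (\<lambda>x. 1 * s n x + 1 * u n x) x - (1 * S (s n) x + 1 * S (u n) x)"
    have e2: "N ?e2 = 0" by (rule lin_op_comb[OF S sm um])
    have e2m: "?e2 \<in> X" by (intro diff_mem comb_mem m sm um)
    have e2': "N (\<lambda>x. (-1) * ?e2 x) = 0" using e2 by (simp only: N_scale[OF e2m])
    have "N (\<lambda>x. s (Suc (Suc n)) x - S (s (Suc n)) x - g x) \<le> N ?e1 + N (\<lambda>x. (-1) * ?e2 x)"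
    proof (rule N_le)
      show "?e1 \<in> X" by (intro diff_mem m sm g)
      show "(\<lambda>x. (-1) * ?e2 x) \<in> X" by (intro scale_mem e2m)
      fix x
      have "s (Suc n) = (\<lambda>x. 1 * s n x + 1 * u n x)" by (auto simp: s_def)
      moreover have "s (Suc (Suc n)) x = s (Suc n) x + S (u n) x" by (simp add: s_def u_def)
      ultimately show "s (Suc (Suc n)) x - S (s (Suc n)) x - g x = ?e1 x + (-1) * ?e2 x" by simp
    qed
    also have "\<dots> = 0" using Suc e2' by simp
    finally have "N (\<lambda>x. s (Suc (Suc n)) x - S (s (Suc n)) x - g x) \<le> 0" .
    moreover have "0 \<le> N (\<lambda>x. s (Suc (Suc n)) x - S (s (Suc n)) x - g x)"
      by (intro N_ge0 diff_mem m sm g)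
    ultimately show ?case by simp
  qed
  have le: "N (\<lambda>x. w x - S w x - g x) \<le> N (\<lambda>x. w x - s (Suc n) x) + r * N (\<lambda>x. w x - s n x)" for n
  proof -
    have "N (\<lambda>x. w x - S w x - g x) \<le> N (\<lambda>x. (w x - s (Suc n) x) + (s (Suc n) x - S (s n) x - g x)) + N (\<lambda>x. S (s n) x - S w x)"
      by (rule N_le; (intro diff_mem add_mem m sm g w)?) simp
    also have "N (\<lambda>x. (w x - s (Suc n) x) + (s (Suc n) x - S (s n) x - g x)) \<le> N (\<lambda>x. w x - s (Suc n) x) + N (\<lambda>x. s (Suc n) x - S (s n) x - g x)"
      by (rule N_add) (auto intro!: diff_mem add_mem m sm g w)
    also have "N (\<lambda>x. S (s n) x - S w x) \<le> r * N (\<lambda>x. s n x - w x)"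
      by (rule lin_op_diff[OF S sm w])
    finally show ?thesis using Ss[of n] N_swap[OF w sm] by simp
  qed
  have "(\<lambda>n. N (\<lambda>x. w x - s (Suc n) x) + r * N (\<lambda>x. w x - s n x)) \<longlonglongrightarrow> 0 + r * 0"
    by (intro tendsto_intros lim LIMSEQ_Suc[OF lim])
  then have "N (\<lambda>x. w x - S w x - g x) \<le> 0"
    by (intro LIMSEQ_le_const[where X="\<lambda>n. N (\<lambda>x. w x - s (Suc n) x) + r * N (\<lambda>x. w x - s n x)"]) (use le in auto)
  then have 1: "N (\<lambda>x. w x - S w x - g x) = 0"
    by (intro order_antisym N_ge0 diff_mem m w g) auto
  have sN: "N (s n) \<le> N g / (1 - r)" for n
  proof -
    have "N (s n) \<le> (\<Sum>k<n. N (u k))" unfolding s_def by (intro N_sum_le um)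
    also have "\<dots> \<le> (\<Sum>k<n. r ^ k * N g)" by (intro sum_mono uN)
    also have "\<dots> \<le> (\<Sum>k. r ^ k * N g)" by (rule sum_le_suminf[OF sg]) (use r0 N_ge0[OF g] in auto)
    also have "\<dots> = N g / (1 - r)" using r r0 by (subst suminf_mult2[symmetric]) (auto simp: suminf_geometric)
    finally show ?thesis .
  qed
  have "N w \<le> N (\<lambda>x. w x - s n x) + N g / (1 - r)" for n
  proof -
    have "N w \<le> N (\<lambda>x. w x - s n x) + N (s n)" by (rule N_le) (auto intro!: diff_mem w sm)
    with sN[of n] show ?thesis by linarith
  qed
  moreover have "(\<lambda>n. N (\<lambda>x. w x - s n x) + N g / (1 - r)) \<longlonglongrightarrow> 0 + N g / (1 - r)"
    by (intro tendsto_intros lim)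
  ultimately have "N w \<le> 0 + N g / (1 - r)" by (intro LIMSEQ_le_const) auto
  with 1 w show ?thesis by auto
qed

lemma lin_op_resolvent_diff:
  assumes A: "lin_op A C" and u: "u \<in> X" "v \<in> X"
  shows "N (\<lambda>x. (l * (a * u x + b * v x) - A (\<lambda>x. a * u x + b * v x) x)
             - (a * (l * u x - A u x) + b * (l * v x - A v x))) = 0"
proof -
  have "(\<lambda>x. (l * (a * u x + b * v x) - A (\<lambda>x. a * u x + b * v x) x)
             - (a * (l * u x - A u x) + b * (l * v x - A v x))) =
     (\<lambda>x. (-1) * (A (\<lambda>x. a * u x + b * v x) x - (a * A u x + b * A v x)))"
    by (auto simp: algebra_simps)
  moreover have "N (\<lambda>x. A (\<lambda>x. a * u x + b * v x) x - (a * A u x + b * A v x)) = 0"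
    by (rule lin_op_comb[OF A u])
  moreover have "(\<lambda>x. A (\<lambda>x. a * u x + b * v x) x - (a * A u x + b * A v x)) \<in> X"
    by (intro diff_mem comb_mem lin_op_mem[OF A] u)
  ultimately show ?thesis by (simp only: N_scale)
qed

text \<open>A right inverse J of l - A is picked by choice. The lower bound makes J bounded by c,
  and (l' - A) J v equals v - (l - l') J v up to a null element, so the problem for l' becomes a
  Neumann series for (l - l') J.\<close>

lemma continuity_step:
  assumes A: "lin_op A C" and c: "0 \<le> c"
    and lower: "\<And>u. u \<in> X \<Longrightarrow> N u \<le> c * N (\<lambda>x. l * u x - A u x)"
    and surj: "\<And>g. g \<in> X \<Longrightarrow> \<exists>u\<in>X. N (\<lambda>x. l * u x - A u x - g x) = 0"
    and close: "\<bar>l - l'\<bar> * c < 1" and g: "g \<in> X"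
  shows "\<exists>u\<in>X. N (\<lambda>x. l' * u x - A u x - g x) = 0"
proof -
  define B where "B u x = l * u x - A u x" for u x
  note m = lin_op_mem[OF A]
  have Bm: "B u \<in> X" if "u \<in> X" for u unfolding B_def using that by (intro diff_mem scale_mem m)
  have Bcomb: "N (\<lambda>x. B (\<lambda>x. a * u x + b * v x) x - (a * B u x + b * B v x)) = 0" if "u \<in> X" "v \<in> X" for u v a b
    unfolding B_def by (rule lin_op_resolvent_diff[OF A that])
  obtain J where J: "\<And>g. g \<in> X \<Longrightarrow> J g \<in> X \<and> N (\<lambda>x. B (J g) x - g x) = 0"
    using surj unfolding B_def by metis
  have Jb: "N (J g) \<le> c * N g" if "g \<in> X" for g
  proof -
    have "N (B (J g)) \<le> N (\<lambda>x. B (J g) x - g x) + N g"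
      by (rule N_le) (use J that Bm in \<open>auto intro: diff_mem\<close>)
    then have "N (B (J g)) \<le> N g" using J[OF that] by simp
    moreover have "N (J g) \<le> c * N (B (J g))" unfolding B_def using lower J[OF that] by blast
    ultimately show ?thesis using c by (meson mult_left_mono order_trans)
  qed
  have Jop: "lin_op J c" unfolding lin_op_def
  proof (intro conjI ballI allI c)
    fix u assume "u \<in> X" then show "J u \<in> X" "N (J u) \<le> c * N u" using J Jb by auto
  next
    fix u v a b assume u: "u \<in> X" and v: "v \<in> X"
    let ?w = "\<lambda>x. a * u x + b * v x"
    let ?z = "\<lambda>x. a * J u x + b * J v x"
    have w: "?w \<in> X" by (intro comb_mem u v)
    have z: "?z \<in> X" using J u v by (intro comb_mem) auto
    note Jm = J[OF u] J[OF v] J[OF w]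
    let ?d = "\<lambda>x. 1 * J ?w x + (-1) * ?z x"
    have d: "?d \<in> X" using Jm z by (intro comb_mem) auto
    have "N (B ?d) \<le> N (\<lambda>x. B ?d x - (1 * B (J ?w) x + (-1) * B ?z x)) + N (\<lambda>x. 1 * B (J ?w) x + (-1) * B ?z x)"
      by (rule N_le) (use Jm z d Bm in \<open>auto intro!: diff_mem comb_mem\<close>)
    also have "N (\<lambda>x. B ?d x - (1 * B (J ?w) x + (-1) * B ?z x)) = 0"
      using Bcomb[of "J ?w" ?z 1 "-1"] Jm z by simp
    also have "N (\<lambda>x. 1 * B (J ?w) x + (-1) * B ?z x) \<le> N (\<lambda>x. B (J ?w) x - ?w x) + N (\<lambda>x. ?w x - B ?z x)"
      by (rule N_le) (use Jm z w Bm in \<open>auto intro!: diff_mem\<close>)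
    also have "N (\<lambda>x. B (J ?w) x - ?w x) = 0" using Jm by simp
    also have "N (\<lambda>x. ?w x - B ?z x) \<le> N (\<lambda>x. ?w x - (a * B (J u) x + b * B (J v) x)) + N (\<lambda>x. (a * B (J u) x + b * B (J v) x) - B ?z x)"
      by (rule N_le) (use Jm z w Bm in \<open>auto intro!: diff_mem comb_mem\<close>)
    also have "N (\<lambda>x. (a * B (J u) x + b * B (J v) x) - B ?z x) = N (\<lambda>x. B ?z x - (a * B (J u) x + b * B (J v) x))"
      by (rule N_swap) (use Jm z Bm in \<open>auto intro!: comb_mem\<close>)
    also have "\<dots> = 0" using Bcomb[of "J u" "J v" a b] Jm by simp
    also have "N (\<lambda>x. ?w x - (a * B (J u) x + b * B (J v) x)) \<le>
       N (\<lambda>x. (-a) * (B (J u) x - u x)) + N (\<lambda>x. (-b) * (B (J v) x - v x))"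
    proof (rule N_le)
      show "(\<lambda>x. (-a) * (B (J u) x - u x)) \<in> X" "(\<lambda>x. (-b) * (B (J v) x - v x)) \<in> X"
        using Jm u v Bm by (intro scale_mem diff_mem; simp)+
    qed (simp add: algebra_simps)
    also have "\<dots> = 0"
      using Jm N_scale[OF diff_mem[OF Bm[of "J u"] u], of "-a"] N_scale[OF diff_mem[OF Bm[of "J v"] v], of "-b"] by simp
    finally have Bd: "N (B ?d) \<le> 0" by simp
    \<comment> \<open>Choice gives no linearity of J. It follows from injectivity: l - A annihilates
      the linearity defect of J up to seminorm zero, and the lower bound passes this on to the
      defect itself.\<close>
    have "N ?d \<le> c * N (B ?d)" unfolding B_def by (rule lower[OF d])
    also have "\<dots> \<le> 0" using Bd c by (simp add: mult_nonneg_nonpos)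
    finally have "N ?d = 0" using N_ge0[OF d] by simp
    moreover have "?d = (\<lambda>x. J ?w x - ?z x)" by auto
    ultimately show "N (\<lambda>x. J ?w x - ?z x) = 0" by simp
  qed
  obtain v where v: "v \<in> X" and v0: "N (\<lambda>x. v x - (l - l') * J v x - g x) = 0"
    using neumann[OF lin_op_scale[OF Jop, of "l - l'"] close g] by blast
  note Jv = J[OF v]
  have "N (\<lambda>x. l' * J v x - A (J v) x - g x) \<le> N (\<lambda>x. B (J v) x - v x) + N (\<lambda>x. v x - (l - l') * J v x - g x)"
  proof (rule N_le)
    show "(\<lambda>x. B (J v) x - v x) \<in> X" using Jv Bm v by (intro diff_mem) auto
    show "(\<lambda>x. v x - (l - l') * J v x - g x) \<in> X" using Jv g v by (intro diff_mem scale_mem) auto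
  qed (simp add: algebra_simps B_def)
  then have "N (\<lambda>x. l' * J v x - A (J v) x - g x) \<le> 0" using Jv v0 by simp
  moreover have "0 \<le> N (\<lambda>x. l' * J v x - A (J v) x - g x)"
    by (intro N_ge0 diff_mem scale_mem m g) (use Jv in auto)
  ultimately show ?thesis using Jv by (intro bexI[of _ "J v"]) auto
qed

lemma solve_large:
  assumes A: "lin_op A C" and l: "C < l" and g: "g \<in> X"
  shows "\<exists>u\<in>X. N (\<lambda>x. l * u x - A u x - g x) = 0 \<and> N u \<le> N g / (l - C)"
proof -
  have l0: "l > 0" using lin_op_ge0[OF A] l by linarith
  note m = lin_op_mem[OF A]
  have g': "(\<lambda>x. (1 / l) * g x) \<in> X" by (intro scale_mem g)
  have "\<bar>1 / l\<bar> * C < 1" using l l0 by simp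
  from neumann[OF lin_op_scale[OF A, of "1 / l"] this g'] obtain u where u: "u \<in> X"
    "N (\<lambda>x. u x - 1 / l * A u x - 1 / l * g x) = 0" "N u \<le> N (\<lambda>x. 1 / l * g x) / (1 - \<bar>1 / l\<bar> * C)" by auto
  have mm: "(\<lambda>x. u x - 1 / l * A u x - 1 / l * g x) \<in> X" by (intro diff_mem scale_mem m g u)
  have "(\<lambda>x. l * u x - A u x - g x) = (\<lambda>x. l * (u x - 1 / l * A u x - 1 / l * g x))"
    using l0 by (auto simp: field_simps)
  then have "N (\<lambda>x. l * u x - A u x - g x) = 0" using u(2) by (simp only: N_scale[OF mm] mult_zero_right)
  moreover have "N (\<lambda>x. 1 / l * g x) / (1 - \<bar>1 / l\<bar> * C) = N g / (l - C)"
    using l0 l by (subst N_scale[OF g]) (auto simp: field_simps)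
  ultimately show ?thesis using u by auto
qed

text \<open>Above C the Neumann series solves the equation. From there l descends towards 1 in steps
  of fixed length, which is possible because the constant c of the lower bound is the same for all l
  \<ge> 1.\<close>

lemma continuity_method:
  assumes A: "lin_op A C" and c: "0 \<le> c"
    and lower: "\<And>u l. u \<in> X \<Longrightarrow> 1 \<le> l \<Longrightarrow> N u \<le> c * N (\<lambda>x. l * u x - A u x)"
    and l: "1 \<le> l" and g: "g \<in> X"
  shows "\<exists>u\<in>X. N (\<lambda>x. l * u x - A u x - g x) = 0"
proof -
  \<comment> \<open>The step length satisfies d * c < 1, the closeness required by
    \<open>continuity_step\<close>; the summand 1 covers c = 0.\<close>
  define d where "d = 1 / (c + 1)"
  have d: "0 < d" "d * c < 1" using c by (auto simp: d_def field_simps)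
  have C0: "0 \<le> C" by (rule lin_op_ge0[OF A])
  have main: "\<forall>g\<in>X. \<exists>u\<in>X. N (\<lambda>x. m * u x - A u x - g x) = 0"
    if "1 \<le> m" "C + 1 - real n * d \<le> m" for n m
    using that
  proof (induction n arbitrary: m)
    case 0 then show ?case using solve_large[OF A, of m] by force
  next
    case (Suc n)
    have IH: "\<forall>g\<in>X. \<exists>u\<in>X. N (\<lambda>x. (m + d) * u x - A u x - g x) = 0"
      by (rule Suc.IH) (use Suc.prems d in \<open>auto simp: algebra_simps\<close>)
    show ?case
    proof
      fix g assume "g \<in> X"
      show "\<exists>u\<in>X. N (\<lambda>x. m * u x - A u x - g x) = 0"
        by (rule continuity_step[OF A c _ _ _ \<open>g \<in> X\<close>, of "m + d"])
           (use Suc.prems d IH lower in auto)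
    qed
  qed
  obtain n where "(C + 1) / d < real n" using reals_Archimedean2 by blast
  then have "C + 1 - real n * d \<le> l" using d l by (simp add: field_simps)
  then show ?thesis using main l g by blast
qed

end

section \<open>The spaces L_p\<close>

text \<open>On the open half-line this is convexity of the power. If x or y is 0 the claim reduces
  to a powr p \<le> a for 0 \<le> a \<le> 1.\<close>

lemma powr_convex_ge0:
  fixes x y a b p :: real
  assumes "1 \<le> p" "0 \<le> x" "0 \<le> y" "0 \<le> a" "0 \<le> b" "a + b = 1"
  shows "(a * x + b * y) powr p \<le> a * x powr p + b * y powr p"
proof -
  have *: "(a * x) powr p \<le> a * x powr p" if "0 \<le> a" "a \<le> 1" "0 \<le> x" for a x :: real
  proof -
    have "a powr p \<le> a powr 1" if "a > 0" using \<open>1 \<le> p\<close> \<open>a \<le> 1\<close> that by (intro powr_mono') auto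
    then have "a powr p \<le> a" using \<open>0 \<le> a\<close> by (cases "a = 0") auto
    then show ?thesis using that by (simp add: powr_mult mult_right_mono)
  qed
  show ?thesis
  proof (cases "x = 0 \<or> y = 0")
    case True
    then show ?thesis using *[of a x] *[of b y] assms by auto
  next
    case False
    have a: "a = 1 - b" using assms by simp
    show ?thesis using convex_onD[OF powr_convex[OF assms(1)], of b x y] assms False unfolding a by simp
  qed
qed

lemma powr_tangent_ge0:
  fixes t m p :: real
  assumes p: "1 \<le> p" and t: "0 \<le> t" and m: "0 < m"
  shows "m powr p + p * m powr (p - 1) * (t - m) \<le> t powr p"
proof (cases "t = 0")
  case True
  have "m powr p = m * m powr (p - 1)" using m by (simp add: powr_mult_base)
  then have "m powr p + p * m powr (p - 1) * (t - m) = (1 - p) * (m * m powr (p - 1))"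
    unfolding True by (simp add: left_diff_distrib)
  also have "\<dots> \<le> 0" using p m by (intro mult_nonpos_nonneg) auto
  also have "0 = t powr p" using True by simp
  finally show ?thesis .
next
  case False
  have d: "((\<lambda>x. x powr p) has_real_derivative p * m powr (p - 1)) (at m within {0<..})"
    using m by (auto intro!: derivative_eq_intros)
  have "p * m powr (p - 1) * (t - m) \<le> t powr p - m powr p"
    using convex_on_imp_above_tangent[OF powr_convex[OF p] _ _ _ d, of t] False t m
    by (simp add: interior_open)
  then show ?thesis by simp
qed

section \<open>Norms, Minkowski's inequality and completeness\<close>

lemma Lp_measurable: "u \<in> Lp p \<Longrightarrow> u \<in> borel_measurable borel"
  and Lp_integrable: "u \<in> Lp p \<Longrightarrow> integrable lborel (\<lambda>x. \<bar>u x\<bar> powr p)"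
  by (auto simp: Lp_def)

lemma Lp_norm_ge0: "0 \<le> Lp_norm p u"
  by (simp add: Lp_norm_def)

lemma Lp_norm_powr:
  assumes "0 < p" shows "Lp_norm p u powr p = (\<integral>x. \<bar>u x\<bar> powr p \<partial>lborel)"
  using assms by (simp add: Lp_norm_def powr_powr)

lemma Lp_nn:
  assumes "0 < p" "u \<in> Lp p"
  shows "(\<integral>\<^sup>+x. ennreal (\<bar>u x\<bar> powr p) \<partial>lborel) = ennreal (Lp_norm p u powr p)"
  using Lp_integrable[OF assms(2)] assms(1) by (simp add: nn_integral_eq_integral Lp_norm_powr)

lemma LpI_nn:
  assumes p: "0 < p" and [measurable]: "u \<in> borel_measurable borel" and B: "0 \<le> B"
    and le: "(\<integral>\<^sup>+x. ennreal (\<bar>u x\<bar> powr p) \<partial>lborel) \<le> ennreal (B powr p)"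
  shows "u \<in> Lp p" "Lp_norm p u \<le> B"
proof -
  have "integrable lborel (\<lambda>x. \<bar>u x\<bar> powr p)"
    by (rule integrableI_bounded) (use le in \<open>auto simp: less_top[symmetric] top_unique intro: le_less_trans\<close>)
  then show m: "u \<in> Lp p" by (auto simp: Lp_def)
  have "ennreal (Lp_norm p u powr p) \<le> ennreal (B powr p)" using le Lp_nn[OF p m] by simp
  then have "Lp_norm p u powr p \<le> B powr p" by simp
  then show "Lp_norm p u \<le> B"
    using powr_less_mono2[OF p B, of "Lp_norm p u"] by linarith
qed

lemma Lp_mono:
  assumes p: "0 < p" and v: "v \<in> Lp p" and [measurable]: "u \<in> borel_measurable borel"
    and le: "AE x in lborel. \<bar>u x\<bar> \<le> \<bar>v x\<bar>"
  shows "u \<in> Lp p" "Lp_norm p u \<le> Lp_norm p v"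
proof -
  have "(\<integral>\<^sup>+x. ennreal (\<bar>u x\<bar> powr p) \<partial>lborel) \<le> (\<integral>\<^sup>+x. ennreal (\<bar>v x\<bar> powr p) \<partial>lborel)"
    by (rule nn_integral_mono_AE) (use le p in \<open>auto elim!: eventually_mono intro!: ennreal_leI powr_mono2\<close>)
  then have *: "(\<integral>\<^sup>+x. ennreal (\<bar>u x\<bar> powr p) \<partial>lborel) \<le> ennreal (Lp_norm p v powr p)"
    using Lp_nn[OF p v] by simp
  show "u \<in> Lp p" "Lp_norm p u \<le> Lp_norm p v" by (rule LpI_nn[OF p _ Lp_norm_ge0 *]; measurable)+
qed

lemma Lp_zero: "(\<lambda>_. 0) \<in> Lp p"
  by (simp add: Lp_def)

lemma Lp_scale:
  assumes p: "0 < p" and u: "u \<in> Lp p"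
  shows "(\<lambda>x. a * u x) \<in> Lp p" "Lp_norm p (\<lambda>x. a * u x) = \<bar>a\<bar> * Lp_norm p u"
proof -
  show "(\<lambda>x. a * u x) \<in> Lp p"
    using u by (auto simp: Lp_def abs_mult powr_mult)
  show "Lp_norm p (\<lambda>x. a * u x) = \<bar>a\<bar> * Lp_norm p u"
    using p by (simp add: Lp_norm_def abs_mult powr_mult powr_powr)
qed

text \<open>Minkowski by convexity: for a and b above the two norms, |u + v| is at most (a + b)
  times a convex combination of |u|/a and |v|/b. Taking a and b strictly larger avoids division by a
  vanishing norm; they are sent down to the norms at the end.\<close>

lemma Lp_add:
  assumes p: "1 \<le> p" and u: "u \<in> Lp p" and v: "v \<in> Lp p"
  shows "(\<lambda>x. u x + v x) \<in> Lp p" "Lp_norm p (\<lambda>x. u x + v x) \<le> Lp_norm p u + Lp_norm p v"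
proof -
  note [measurable] = Lp_measurable[OF u] Lp_measurable[OF v]
  note iu = Lp_integrable[OF u] and iv = Lp_integrable[OF v]
  have *: "(\<lambda>x. u x + v x) \<in> Lp p \<and> Lp_norm p (\<lambda>x. u x + v x) \<le> a + b"
    if ab: "Lp_norm p u < a" "Lp_norm p v < b" for a b
  proof -
    have pos: "a > 0" "b > 0" using ab Lp_norm_ge0[of p u] Lp_norm_ge0[of p v] by linarith+
    define s t where "s = a / (a + b)" and "t = b / (a + b)"
    have st: "0 \<le> s" "0 \<le> t" "s + t = 1" using pos by (auto simp: s_def t_def add_divide_distrib[symmetric])
    have ineq: "\<bar>u x + v x\<bar> powr p \<le> (a+b) powr p * (s * (\<bar>u x\<bar> powr p / a powr p) + t * (\<bar>v x\<bar> powr p / b powr p))" for x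
    proof -
      have "\<bar>u x + v x\<bar> \<le> (a + b) * (s * (\<bar>u x\<bar> / a) + t * (\<bar>v x\<bar> / b))"
        using pos by (simp add: s_def t_def distrib_left)
      then have "\<bar>u x + v x\<bar> powr p \<le> ((a + b) * (s * (\<bar>u x\<bar> / a) + t * (\<bar>v x\<bar> / b))) powr p"
        using p by (intro powr_mono2) auto
      also have "\<dots> = (a + b) powr p * (s * (\<bar>u x\<bar> / a) + t * (\<bar>v x\<bar> / b)) powr p"
        using pos st by (simp add: powr_mult)
      also have "\<dots> \<le> (a + b) powr p * (s * (\<bar>u x\<bar> / a) powr p + t * (\<bar>v x\<bar> / b) powr p)"
        using powr_convex_ge0[OF p, of "\<bar>u x\<bar> / a" "\<bar>v x\<bar> / b" s t] st pos by (intro mult_left_mono) auto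
      finally show ?thesis using pos by (simp add: powr_divide)
    qed
    have lu: "Lp_norm p u powr p \<le> a powr p" and lv: "Lp_norm p v powr p \<le> b powr p"
      using ab p Lp_norm_ge0 by (auto intro!: powr_mono2)
    have "(\<integral>\<^sup>+x. ennreal (\<bar>u x + v x\<bar> powr p) \<partial>lborel) \<le>
        (\<integral>\<^sup>+x. ennreal ((a+b) powr p * (s * (\<bar>u x\<bar> powr p / a powr p) + t * (\<bar>v x\<bar> powr p / b powr p))) \<partial>lborel)"
      by (intro nn_integral_mono ennreal_leI ineq)
    also have "\<dots> = ennreal (\<integral>x. (a+b) powr p * (s * (\<bar>u x\<bar> powr p / a powr p) + t * (\<bar>v x\<bar> powr p / b powr p)) \<partial>lborel)"
      using iu iv st pos by (intro nn_integral_eq_integral) auto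
    also have "(\<integral>x. (a+b) powr p * (s * (\<bar>u x\<bar> powr p / a powr p) + t * (\<bar>v x\<bar> powr p / b powr p)) \<partial>lborel)
       = (a+b) powr p * (s * (Lp_norm p u powr p / a powr p) + t * (Lp_norm p v powr p / b powr p))"
      using iu iv p by (simp add: Lp_norm_powr)
    also have "\<dots> \<le> (a+b) powr p * (s * 1 + t * 1)"
      using lu lv st pos by (intro mult_left_mono add_mono) auto
    also have "\<dots> = (a+b) powr p" using st by simp
    finally have le: "(\<integral>\<^sup>+x. ennreal (\<bar>u x + v x\<bar> powr p) \<partial>lborel) \<le> ennreal ((a+b) powr p)"
      by (simp add: ennreal_leI)
    have "0 < p" "0 \<le> a + b" using p pos by auto
    from LpI_nn[OF this(1) _ this(2) le] show ?thesis by simp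
  qed
  show "(\<lambda>x. u x + v x) \<in> Lp p" using *[of "Lp_norm p u + 1" "Lp_norm p v + 1"] by simp
  show "Lp_norm p (\<lambda>x. u x + v x) \<le> Lp_norm p u + Lp_norm p v"
  proof (rule field_le_epsilon)
    fix e :: real assume "0 < e"
    then show "Lp_norm p (\<lambda>x. u x + v x) \<le> Lp_norm p u + Lp_norm p v + e"
      using *[of "Lp_norm p u + e/2" "Lp_norm p v + e/2"] by simp
  qed
qed

lemma Lp_comb:
  assumes p: "1 \<le> p" and u: "u \<in> Lp p" and v: "v \<in> Lp p"
  shows "(\<lambda>x. a * u x + b * v x) \<in> Lp p"
  using assms by (intro Lp_add Lp_scale) auto

lemma Lp_diff:
  assumes p: "1 \<le> p" and u: "u \<in> Lp p" and v: "v \<in> Lp p"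
  shows "(\<lambda>x. u x - v x) \<in> Lp p"
  using Lp_comb[OF assms, of 1 "-1"] by simp

lemma Lp_norm_eq_0:
  assumes p: "0 < p" and u: "u \<in> Lp p"
  shows "Lp_norm p u = 0 \<longleftrightarrow> ae_eq u (\<lambda>x. 0)"
proof -
  have "Lp_norm p u = 0 \<longleftrightarrow> (\<integral>x. \<bar>u x\<bar> powr p \<partial>lborel) = 0"
    by (simp add: Lp_norm_def)
  also have "\<dots> \<longleftrightarrow> (AE x in lborel. \<bar>u x\<bar> powr p = 0)"
    by (rule integral_nonneg_eq_0_iff_AE[OF Lp_integrable[OF u]]) auto
  also have "\<dots> \<longleftrightarrow> ae_eq u (\<lambda>x. 0)" by (simp add: ae_eq_def)
  finally show ?thesis .
qed

lemma Lp_norm_cong_AE: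
  assumes [measurable]: "u \<in> borel_measurable borel" "v \<in> borel_measurable borel" and "ae_eq u v"
  shows "Lp_norm p u = Lp_norm p v"
proof -
  have "(\<integral>x. \<bar>u x\<bar> powr p \<partial>lborel) = (\<integral>x. \<bar>v x\<bar> powr p \<partial>lborel)"
    by (rule integral_cong_AE) (use assms(3) in \<open>auto simp: ae_eq_def\<close>)
  then show ?thesis by (simp add: Lp_norm_def)
qed

lemma Lp_cong_AE:
  assumes [measurable]: "v \<in> borel_measurable borel" and "u \<in> Lp p" "ae_eq u v" "0 < p"
  shows "v \<in> Lp p"
  by (rule Lp_mono[OF assms(4,2,1)]) (use assms(3) in \<open>auto simp: ae_eq_def elim: eventually_mono\<close>)

lemma Lp_fatou:
  assumes p: "0 < p" and s: "\<And>n. s n \<in> Lp p" and [measurable]: "w \<in> borel_measurable borel"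
    and lim: "AE x in lborel. (\<lambda>n. s n x) \<longlonglongrightarrow> w x"
    and B: "eventually (\<lambda>n. Lp_norm p (s n) \<le> B) sequentially" "0 \<le> B"
  shows "w \<in> Lp p" "Lp_norm p w \<le> B"
proof -
  have [measurable]: "s n \<in> borel_measurable borel" for n using s by (rule Lp_measurable)
  have "(\<integral>\<^sup>+x. ennreal (\<bar>w x\<bar> powr p) \<partial>lborel) \<le> (\<integral>\<^sup>+x. liminf (\<lambda>n. ennreal (\<bar>s n x\<bar> powr p)) \<partial>lborel)"
  proof (rule nn_integral_mono_AE)
    show "AE x in lborel. ennreal (\<bar>w x\<bar> powr p) \<le> liminf (\<lambda>n. ennreal (\<bar>s n x\<bar> powr p))"
      using lim
    proof eventually_elim
      case (elim x)
      have "(\<lambda>n. ennreal (\<bar>s n x\<bar> powr p)) \<longlonglongrightarrow> ennreal (\<bar>w x\<bar> powr p)"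
        using p by (intro tendsto_ennrealI tendsto_powr2 tendsto_rabs elim tendsto_const) auto
      then have "liminf (\<lambda>n. ennreal (\<bar>s n x\<bar> powr p)) = ennreal (\<bar>w x\<bar> powr p)"
        by (rule lim_imp_Liminf[rotated]) simp
      then show ?case by simp
    qed
  qed
  also have "\<dots> \<le> liminf (\<lambda>n. \<integral>\<^sup>+x. ennreal (\<bar>s n x\<bar> powr p) \<partial>lborel)"
    by (intro nn_integral_liminf) auto
  also have "\<dots> = liminf (\<lambda>n. ennreal (Lp_norm p (s n) powr p))"
    by (simp add: Lp_nn[OF p s])
  also have "\<dots> \<le> ennreal (B powr p)"
    by (rule order_trans[OF Liminf_mono[where g="\<lambda>_. ennreal (B powr p)"]])
       (use B p Lp_norm_ge0 in \<open>auto elim!: eventually_mono intro!: ennreal_leI powr_mono2 simp: Liminf_const\<close>)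
  finally have *: "(\<integral>\<^sup>+x. ennreal (\<bar>w x\<bar> powr p) \<partial>lborel) \<le> ennreal (B powr p)" .
  show "w \<in> Lp p" "Lp_norm p w \<le> B" by (rule LpI_nn[OF p _ B(2) *]; measurable)+
qed

lemma Lp_sum:
  assumes p: "1 \<le> p" and u: "\<And>n. n \<in> A \<Longrightarrow> u n \<in> Lp p" and fin: "finite A"
  shows "(\<lambda>x. \<Sum>k\<in>A. u k x) \<in> Lp p \<and> Lp_norm p (\<lambda>x. \<Sum>k\<in>A. u k x) \<le> (\<Sum>k\<in>A. Lp_norm p (u k))"
  using fin u
proof (induction A)
  case empty
  then show ?case by (auto simp: Lp_zero Lp_norm_def)
next
  case (insert a A)
  then show ?case using Lp_add[OF p, of "u a" "\<lambda>x. \<Sum>k\<in>A. u k x"] by auto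
qed

lemma Lp_abs: "u \<in> Lp p \<Longrightarrow> (\<lambda>x. \<bar>u x\<bar>) \<in> Lp p" "Lp_norm p (\<lambda>x. \<bar>u x\<bar>) = Lp_norm p u"
  by (auto simp: Lp_def Lp_norm_def)

text \<open>Riesz-Fischer. Monotone convergence makes the series of |u k x| finite almost
  everywhere, so w is an almost everywhere limit of the partial sums; Fatou's lemma bounds w minus a
  partial sum by the tail \<open>tl\<close> of the norm series.\<close>

lemma Lp_complete:
  assumes p: "1 \<le> p" and u: "\<And>n. u n \<in> Lp p" and su: "summable (\<lambda>n. Lp_norm p (u n))"
  defines "w \<equiv> \<lambda>x. lim (\<lambda>n. \<Sum>k<n. u k x)"
  shows "w \<in> Lp p" "(\<lambda>n. Lp_norm p (\<lambda>x. w x - (\<Sum>k<n. u k x))) \<longlonglongrightarrow> 0"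
proof -
  have p0: "0 < p" using p by simp
  have [measurable]: "u n \<in> borel_measurable borel" for n using u by (rule Lp_measurable)
  have [measurable]: "w \<in> borel_measurable borel" unfolding w_def by measurable
  define B where "B = (\<Sum>n. Lp_norm p (u n))"
  define V where "V n x = (\<Sum>k<n. \<bar>u k x\<bar>)" for n x
  have V: "V n \<in> Lp p" "Lp_norm p (V n) \<le> B" for n
  proof -
    have *: "V n \<in> Lp p \<and> Lp_norm p (V n) \<le> (\<Sum>k<n. Lp_norm p (\<lambda>x. \<bar>u k x\<bar>))"
      unfolding V_def by (rule Lp_sum[OF p]) (auto intro: Lp_abs u)
    then show "V n \<in> Lp p" by simp
    have "(\<Sum>k<n. Lp_norm p (\<lambda>x. \<bar>u k x\<bar>)) \<le> B" unfolding B_def Lp_abs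
      by (rule sum_le_suminf[OF su]) (auto simp: Lp_norm_ge0)
    with * show "Lp_norm p (V n) \<le> B" by simp
  qed
  have [measurable]: "V n \<in> borel_measurable borel" for n using V by (auto intro: Lp_measurable)
  have B0: "0 \<le> B" using V(2)[of 0] Lp_norm_ge0 order_trans by blast
  have Vmono: "V n x \<le> V m x" if "n \<le> m" for n m x
    unfolding V_def by (intro sum_mono2) (use that in auto)
  have V0: "0 \<le> V n x" for n x by (auto simp: V_def intro: sum_nonneg)
  have "(\<integral>\<^sup>+x. (SUP n. ennreal (\<bar>V n x\<bar> powr p)) \<partial>lborel) = (SUP n. \<integral>\<^sup>+x. ennreal (\<bar>V n x\<bar> powr p) \<partial>lborel)"
    by (rule nn_integral_monotone_convergence_SUP)
       (auto simp: incseq_def le_fun_def V0 intro!: ennreal_leI powr_mono2 Vmono order_less_imp_le[OF p0])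
  also have "\<dots> \<le> ennreal (B powr p)"
    by (rule SUP_least) (auto simp: Lp_nn[OF p0 V(1)] intro!: ennreal_leI powr_mono2 V Lp_norm_ge0 order_less_imp_le[OF p0])
  finally have "(\<integral>\<^sup>+x. (SUP n. ennreal (\<bar>V n x\<bar> powr p)) \<partial>lborel) \<noteq> \<infinity>"
    by (auto simp: top_unique)
  then have fin: "AE x in lborel. (SUP n. ennreal (\<bar>V n x\<bar> powr p)) \<noteq> \<infinity>"
    by (intro nn_integral_noteq_infinite) auto
  have summ: "AE x in lborel. summable (\<lambda>k. \<bar>u k x\<bar>)"
    using fin
  proof eventually_elim
    case (elim x)
    then obtain K where K: "K \<ge> 0" "(SUP n. ennreal (\<bar>V n x\<bar> powr p)) = ennreal K"
      by (metis ennreal_cases infinity_ennreal_def)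
    have "V n x \<le> K powr (1/p)" for n
    proof -
      have "ennreal (\<bar>V n x\<bar> powr p) \<le> ennreal K" using K(2) by (metis SUP_upper UNIV_I)
      then have "\<bar>V n x\<bar> powr p \<le> K" using K by simp
      then have "(\<bar>V n x\<bar> powr p) powr (1/p) \<le> K powr (1/p)" using p0 by (intro powr_mono2) auto
      then show ?thesis using p0 V0 by (simp add: powr_powr)
    qed
    then have "(\<Sum>k\<le>n. \<bar>u k x\<bar>) \<le> K powr (1/p)" for n
      unfolding V_def lessThan_Suc_atMost[symmetric] by blast
    then show ?case by (intro bounded_imp_summable[where B="K powr (1/p)"]) auto
  qed
  have conv: "AE x in lborel. (\<lambda>n. \<Sum>k<n. u k x) \<longlonglongrightarrow> w x"
    using summ
  proof eventually_elim
    case (elim x)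
    then have "summable (\<lambda>k. u k x)" by (rule summable_rabs_cancel)
    then show ?case unfolding w_def by (metis convergent_LIMSEQ_iff summable_iff_convergent)
  qed
  define tl where "tl n = B - (\<Sum>k<n. Lp_norm p (u k))" for n
  have tl0: "0 \<le> tl n" for n
    using sum_le_suminf[OF su, of "{..<n}"] by (simp add: tl_def B_def Lp_norm_ge0)
  have key: "(\<lambda>x. w x - (\<Sum>k<n. u k x)) \<in> Lp p" "Lp_norm p (\<lambda>x. w x - (\<Sum>k<n. u k x)) \<le> tl n" for n
  proof -
    \<comment> \<open>The block of terms from n to m - 1, empty for m \<le> n; its limit in m is the
      remainder after n terms.\<close>
    define s where "s m = (\<lambda>x. \<Sum>k\<in>{..<m} - {..<n}. u k x)" for m
    have s: "s m \<in> Lp p \<and> Lp_norm p (s m) \<le> (\<Sum>k\<in>{..<m}-{..<n}. Lp_norm p (u k))" for m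
      unfolding s_def by (rule Lp_sum[OF p u]) auto
    have sb: "eventually (\<lambda>m. Lp_norm p (s m) \<le> tl n) sequentially"
      using eventually_ge_at_top[of n]
    proof eventually_elim
      case (elim m)
      have "(\<Sum>k\<in>{..<m}-{..<n}. Lp_norm p (u k)) = (\<Sum>k<m. Lp_norm p (u k)) - (\<Sum>k<n. Lp_norm p (u k))"
        using elim by (intro sum_diff) auto
      also have "(\<Sum>k<m. Lp_norm p (u k)) \<le> B" unfolding B_def
        by (rule sum_le_suminf[OF su]) (auto simp: Lp_norm_ge0)
      finally show ?case using s[of m] by (simp add: tl_def)
    qed
    have "AE x in lborel. (\<lambda>m. s m x) \<longlonglongrightarrow> w x - (\<Sum>k<n. u k x)"
      using conv
    proof eventually_elim
      case (elim x)
      have ev: "eventually (\<lambda>m. (\<Sum>k<m. u k x) - (\<Sum>k<n. u k x) = s m x) sequentially"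
        using eventually_ge_at_top[of n]
        by eventually_elim (unfold s_def, subst sum_diff, auto)
      have "(\<lambda>m. (\<Sum>k<m. u k x) - (\<Sum>k<n. u k x)) \<longlonglongrightarrow> w x - (\<Sum>k<n. u k x)"
        by (intro tendsto_intros elim)
      then show ?case using ev by (rule Lim_transform_eventually)
    qed
    from Lp_fatou[OF p0 _ _ this sb tl0] s
    show "(\<lambda>x. w x - (\<Sum>k<n. u k x)) \<in> Lp p" "Lp_norm p (\<lambda>x. w x - (\<Sum>k<n. u k x)) \<le> tl n" by auto
  qed
  show "w \<in> Lp p" using key(1)[of 0] by simp
  have "tl \<longlonglongrightarrow> B - B" unfolding tl_def B_def by (intro tendsto_intros summable_LIMSEQ su)
  then have "tl \<longlonglongrightarrow> 0" by simp
  then show "(\<lambda>n. Lp_norm p (\<lambda>x. w x - (\<Sum>k<n. u k x))) \<longlonglongrightarrow> 0"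
    by (rule tendsto_sandwich[rotated 2, OF tendsto_const]) (auto simp: key Lp_norm_ge0)
qed

lemma fspace_Lp: "1 \<le> p \<Longrightarrow> fspace (Lp p) (Lp_norm p)"
proof (unfold_locales, goal_cases)
  case (6 u)
  then show ?case using Lp_complete[OF 6(1) 6(2) 6(3)] by auto
qed (auto simp: Lp_zero Lp_scale Lp_norm_ge0 Lp_comb intro: Lp_add)

text \<open>The limit in \<open>Lp_complete\<close> is a pointwise one, hence the same function for both exponents.\<close>
lemma fspace_Lp_Int:
  assumes p: "1 \<le> p" and q: "1 \<le> q"
  shows "fspace (Lp p \<inter> Lp q) (\<lambda>u. Lp_norm p u + Lp_norm q u)"
proof (unfold_locales, goal_cases)
  case (3 u) then show ?case by (simp add: Lp_norm_ge0)
next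
  case (4 u a) then show ?case using p q by (simp add: Lp_scale algebra_simps)
next
  case (5 u v)
  then show ?case using Lp_add(2)[OF p, of u v] Lp_add(2)[OF q, of u v] by auto
next
  case (6 u)
  have 1: "summable (\<lambda>n. Lp_norm p (u n))" and 2: "summable (\<lambda>n. Lp_norm q (u n))"
    by (rule summable_comparison_test_ev[OF _ 6(2)]; simp add: Lp_norm_ge0)+
  let ?w = "\<lambda>x. lim (\<lambda>n. \<Sum>k<n. u k x)"
  have "(\<lambda>n. Lp_norm p (\<lambda>x. ?w x - (\<Sum>k<n. u k x)) + Lp_norm q (\<lambda>x. ?w x - (\<Sum>k<n. u k x))) \<longlonglongrightarrow> 0 + 0"
    using Lp_complete(2)[OF p _ 1] Lp_complete(2)[OF q _ 2] 6(1) by (intro tendsto_add) auto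
  then show ?case using Lp_complete(1)[OF p _ 1] Lp_complete(1)[OF q _ 2] 6(1) by (intro bexI[of _ ?w]) auto
qed (use p q in \<open>auto simp: Lp_zero Lp_comb\<close>)

section \<open>Convolution and kernel operators\<close>

text \<open>Jensen's inequality for a weight of arbitrary mass K: integrate the tangent line of the
  power at the mean m = I / K against \<kappa>. The factor K powr (p - 1) is what remains of
  normalising the weight.\<close>

lemma weighted_jensen:
  fixes \<kappa> u :: "'a \<Rightarrow> real"
  assumes p: "1 \<le> p" and k: "integrable M \<kappa>" and k0: "\<And>x. 0 \<le> \<kappa> x"
    and u0: "\<And>x. 0 \<le> u x" and [measurable]: "u \<in> borel_measurable M"
    and i: "integrable M (\<lambda>x. \<kappa> x * u x powr p)"
  shows "integrable M (\<lambda>x. \<kappa> x * u x)"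
    "(\<integral>x. \<kappa> x * u x \<partial>M) powr p \<le> (\<integral>x. \<kappa> x \<partial>M) powr (p - 1) * (\<integral>x. \<kappa> x * u x powr p \<partial>M)"
proof -
  have [measurable]: "\<kappa> \<in> borel_measurable M" using k by auto
  have le1: "u x \<le> 1 + u x powr p" for x
  proof (cases "u x \<le> 1")
    case False
    then have "u x powr 1 \<le> u x powr p" using p by (intro powr_mono) auto
    then show ?thesis using False by simp
  qed (simp add: add_increasing2)
  show iu: "integrable M (\<lambda>x. \<kappa> x * u x)"
  proof (rule Bochner_Integration.integrable_bound)
    show "integrable M (\<lambda>x. \<kappa> x + \<kappa> x * u x powr p)" using k i by simp
    show "AE x in M. norm (\<kappa> x * u x) \<le> norm (\<kappa> x + \<kappa> x * u x powr p)"
    proof (intro AE_I2)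
      fix x
      have "\<kappa> x * u x \<le> \<kappa> x * (1 + u x powr p)" using k0 le1 by (intro mult_left_mono) auto
      then show "norm (\<kappa> x * u x) \<le> norm (\<kappa> x + \<kappa> x * u x powr p)"
        using k0[of x] u0[of x] by (simp add: distrib_left)
    qed
  qed simp
  define K where "K = (\<integral>x. \<kappa> x \<partial>M)"
  define I where "I = (\<integral>x. \<kappa> x * u x \<partial>M)"
  define J where "J = (\<integral>x. \<kappa> x * u x powr p \<partial>M)"
  have nn: "0 \<le> K" "0 \<le> I" "0 \<le> J" unfolding K_def I_def J_def using k0 u0 by simp_all
  have "I powr p \<le> K powr (p - 1) * J"
  proof (cases "I = 0")
    case True
    then show ?thesis using nn by simp
  next
    case False
    then have Ip: "0 < I" using nn by simp
    \<comment> \<open>If the weight had mass zero it would vanish almost everywhere, and so would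
      I.\<close>
    have "K \<noteq> 0"
    proof
      assume "K = 0"
      then have "AE x in M. \<kappa> x = 0" using k k0 by (simp add: K_def integral_nonneg_eq_0_iff_AE)
      then have "I = (\<integral>x. 0 \<partial>M)" unfolding I_def by (intro integral_cong_AE) (auto elim: eventually_mono)
      then show False using False by simp
    qed
    then have Kp: "0 < K" using nn by simp
    define m where "m = I / K"
    have m: "0 < m" using Ip Kp by (simp add: m_def)
    define b where "b = p * m powr (p - 1)"
    have "(\<integral>x. \<kappa> x * (m powr p + b * (u x - m)) \<partial>M) \<le> J"
      unfolding J_def
    proof (rule integral_mono[OF _ i])
      show "integrable M (\<lambda>x. \<kappa> x * (m powr p + b * (u x - m)))"
        using k iu by (simp add: algebra_simps)
      fix x show "\<kappa> x * (m powr p + b * (u x - m)) \<le> \<kappa> x * u x powr p"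
        unfolding b_def using powr_tangent_ge0[OF p u0[of x] m] k0[of x] by (intro mult_left_mono) auto
    qed
    moreover have "(\<integral>x. \<kappa> x * (m powr p + b * (u x - m)) \<partial>M) =
        (\<integral>x. (m powr p - b * m) * \<kappa> x + b * (\<kappa> x * u x) \<partial>M)"
      by (rule Bochner_Integration.integral_cong) (auto simp: algebra_simps)
    moreover have "\<dots> = (m powr p - b * m) * K + b * I"
      using k iu by (simp add: K_def I_def)
    moreover have "b * I = b * m * K" using Kp by (simp add: m_def)
    ultimately have "m powr p * K \<le> J" by (simp add: left_diff_distrib)
    moreover have "m powr p * K = I powr p / K powr (p - 1)"
    proof -
      have "K powr p = K * K powr (p - 1)" using Kp by (simp add: powr_mult_base)
      then show ?thesis using Kp Ip by (simp add: m_def powr_divide)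
    qed
    ultimately have "I powr p / K powr (p - 1) \<le> J" by simp
    then show ?thesis using Kp by (subst (asm) pos_divide_le_eq) (simp_all add: mult.commute)
  qed
  then show "(\<integral>x. \<kappa> x * u x \<partial>M) powr p \<le> (\<integral>x. \<kappa> x \<partial>M) powr (p - 1) * (\<integral>x. \<kappa> x * u x powr p \<partial>M)"
    by (simp add: K_def I_def J_def)
qed

section \<open>Translation invariance and convolution with an integrable weight\<close>

lemma nn_integral_shift:
  fixes f :: "real \<Rightarrow> ennreal"
  assumes "f \<in> borel_measurable borel"
  shows "(\<integral>\<^sup>+x. f (x - y) \<partial>lborel) = (\<integral>\<^sup>+x. f x \<partial>lborel)"
    and "(\<integral>\<^sup>+x. f (y - x) \<partial>lborel) = (\<integral>\<^sup>+x. f x \<partial>lborel)"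
  using nn_integral_real_affine[OF assms, of 1 "-y"] nn_integral_real_affine[OF assms, of "-1" y] by simp_all

lemma integral_shift:
  fixes f :: "real \<Rightarrow> 'a :: {banach, second_countable_topology}"
  shows "(\<integral>x. f (x - y) \<partial>lborel) = (\<integral>x. f x \<partial>lborel)"
    and "(\<integral>x. f (y - x) \<partial>lborel) = (\<integral>x. f x \<partial>lborel)"
  using lborel_integral_real_affine[of 1 f "-y"] lborel_integral_real_affine[of "-1" f y] by simp_all

lemma integrable_shift_iff:
  fixes f :: "real \<Rightarrow> 'a :: {banach, second_countable_topology}"
  shows "integrable lborel (\<lambda>x. f (x - y)) \<longleftrightarrow> integrable lborel f"
    and "integrable lborel (\<lambda>x. f (y - x)) \<longleftrightarrow> integrable lborel f"
  using lborel_integrable_real_affine_iff[of 1 f "-y"] lborel_integrable_real_affine_iff[of "-1" f y] by simp_all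

lemma Lp_shift:
  assumes "u \<in> Lp p"
  shows "(\<lambda>y. u (x - y)) \<in> Lp p" "Lp_norm p (\<lambda>y. u (x - y)) = Lp_norm p u"
proof -
  have [measurable]: "u \<in> borel_measurable borel" using assms by (rule Lp_measurable)
  show "(\<lambda>y. u (x - y)) \<in> Lp p"
    using Lp_integrable[OF assms] integrable_shift_iff(2)[of "\<lambda>y. \<bar>u y\<bar> powr p" x] by (simp add: Lp_def)
  show "Lp_norm p (\<lambda>y. u (x - y)) = Lp_norm p u"
    unfolding Lp_norm_def by (simp add: integral_shift(2)[of "\<lambda>y. \<bar>u y\<bar> powr p"])
qed

text \<open>For fixed x, Jensen with weight \<kappa> bounds U x powr q by K powr (q - 1) times the
  convolution of \<kappa> with |u| powr q. By Tonelli and translation invariance the latter has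
  integral K times the q-th power of the norm of u. That this is finite also gives convergence of
  the integral for almost every x.\<close>

lemma young_convolution:
  fixes \<kappa> u :: "real \<Rightarrow> real"
  assumes q: "1 \<le> q" and k: "integrable lborel \<kappa>" and k0: "\<And>x. 0 \<le> \<kappa> x" and u: "u \<in> Lp q"
  defines "U \<equiv> \<lambda>x. \<integral>y. \<kappa> y * \<bar>u (x - y)\<bar> \<partial>lborel"
  shows "AE x in lborel. integrable lborel (\<lambda>y. \<kappa> y * \<bar>u (x - y)\<bar>)"
    "U \<in> Lp q" "Lp_norm q U \<le> (\<integral>y. \<kappa> y \<partial>lborel) * Lp_norm q u"
proof -
  have q0: "0 < q" using q by simp
  have [measurable]: "\<kappa> \<in> borel_measurable borel" "u \<in> borel_measurable borel"
    using k u Lp_measurable by auto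
  define K where "K = (\<integral>y. \<kappa> y \<partial>lborel)"
  have K0: "0 \<le> K" unfolding K_def using k0 by simp
  have [measurable]: "U \<in> borel_measurable borel" unfolding U_def by measurable
  have "(\<integral>\<^sup>+x. \<integral>\<^sup>+y. ennreal (\<kappa> y * \<bar>u (x - y)\<bar> powr q) \<partial>lborel \<partial>lborel) =
        (\<integral>\<^sup>+y. \<integral>\<^sup>+x. ennreal (\<kappa> y * \<bar>u (x - y)\<bar> powr q) \<partial>lborel \<partial>lborel)"
    by (rule lborel_pair.Fubini'[symmetric]) measurable
  also have "\<dots> = (\<integral>\<^sup>+y. ennreal (\<kappa> y) * ennreal (Lp_norm q u powr q) \<partial>lborel)"
    by (intro nn_integral_cong)
       (simp add: ennreal_mult k0 nn_integral_cmult Lp_nn[OF q0 u] nn_integral_shift(1)[of "\<lambda>x. ennreal (\<bar>u x\<bar> powr q)"])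
  also have "\<dots> = ennreal K * ennreal (Lp_norm q u powr q)"
    by (simp add: nn_integral_multc nn_integral_eq_integral[OF k] k0 K_def)
  finally have dbl: "(\<integral>\<^sup>+x. \<integral>\<^sup>+y. ennreal (\<kappa> y * \<bar>u (x - y)\<bar> powr q) \<partial>lborel \<partial>lborel) = ennreal (K * Lp_norm q u powr q)"
    using K0 by (simp add: ennreal_mult)
  have "AE x in lborel. (\<integral>\<^sup>+y. ennreal (\<kappa> y * \<bar>u (x - y)\<bar> powr q) \<partial>lborel) \<noteq> \<infinity>"
    by (rule nn_integral_noteq_infinite) (simp_all add: dbl)
  then have ae: "AE x in lborel. integrable lborel (\<lambda>y. \<kappa> y * \<bar>u (x - y)\<bar> powr q)"
  proof eventually_elim
    case (elim x)
    then show ?case by (intro integrableI_nonneg) (auto simp: k0 less_top)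
  qed
  have jen: "integrable lborel (\<lambda>y. \<kappa> y * \<bar>u (x - y)\<bar>)"
    "U x powr q \<le> K powr (q - 1) * (\<integral>y. \<kappa> y * \<bar>u (x - y)\<bar> powr q \<partial>lborel)"
    if "integrable lborel (\<lambda>y. \<kappa> y * \<bar>u (x - y)\<bar> powr q)" for x
    unfolding U_def K_def by (rule weighted_jensen[OF q k k0 _ _ that]; simp)+
  show "AE x in lborel. integrable lborel (\<lambda>y. \<kappa> y * \<bar>u (x - y)\<bar>)"
    using ae by eventually_elim (rule jen)
  have U0: "0 \<le> U x" for x unfolding U_def using k0 by simp
  have "(\<integral>\<^sup>+x. ennreal (\<bar>U x\<bar> powr q) \<partial>lborel) \<le>
      (\<integral>\<^sup>+x. ennreal (K powr (q - 1)) * (\<integral>\<^sup>+y. ennreal (\<kappa> y * \<bar>u (x - y)\<bar> powr q) \<partial>lborel) \<partial>lborel)"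
  proof (rule nn_integral_mono_AE)
    show "AE x in lborel. ennreal (\<bar>U x\<bar> powr q) \<le> ennreal (K powr (q - 1)) * (\<integral>\<^sup>+y. ennreal (\<kappa> y * \<bar>u (x - y)\<bar> powr q) \<partial>lborel)"
      using ae
    proof eventually_elim
      case (elim x)
      have "(\<integral>\<^sup>+y. ennreal (\<kappa> y * \<bar>u (x - y)\<bar> powr q) \<partial>lborel) = ennreal (\<integral>y. \<kappa> y * \<bar>u (x - y)\<bar> powr q \<partial>lborel)"
        using elim k0 by (intro nn_integral_eq_integral) auto
      then show ?case using jen(2)[OF elim] U0[of x] k0
        by (simp add: ennreal_mult[symmetric] ennreal_leI)
    qed
  qed
  also have "\<dots> = ennreal (K powr (q - 1)) * ennreal (K * Lp_norm q u powr q)"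
    by (subst nn_integral_cmult) (simp_all add: dbl)
  also have "\<dots> = ennreal ((K * Lp_norm q u) powr q)"
    using K0 Lp_norm_ge0[of q u] powr_mult_base[of K "q - 1"]
    by (cases "K = 0") (simp_all add: ennreal_mult[symmetric] powr_mult mult.assoc[symmetric] mult.commute)
  finally have le: "(\<integral>\<^sup>+x. ennreal (\<bar>U x\<bar> powr q) \<partial>lborel) \<le> ennreal ((K * Lp_norm q u) powr q)" .
  have "0 \<le> K * Lp_norm q u" using K0 Lp_norm_ge0 by simp
  from LpI_nn[OF q0 _ this le] show "U \<in> Lp q" "Lp_norm q U \<le> (\<integral>y. \<kappa> y \<partial>lborel) * Lp_norm q u"
    by (simp_all add: K_def)
qed

text \<open>A crude substitute for the norm of l in the dual space, obtained from Young's inequality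
  for products after scaling u to norm one. The summand 1 bounds the contribution of u and makes the
  constant strictly positive, so that one may divide by it.\<close>

definition hconst :: "real \<Rightarrow> (real \<Rightarrow> real) \<Rightarrow> real" where
  "hconst q l = (\<integral>y. \<bar>l y\<bar> powr (q / (q - 1)) \<partial>lborel) + 1"

lemma hconst_pos: "0 < hconst q l"
  unfolding hconst_def by (rule add_nonneg_pos) auto

lemma holder_bound:
  assumes q: "1 < q" and l: "l \<in> Lp (q / (q - 1))" and u: "u \<in> Lp q"
  shows "integrable lborel (\<lambda>y. \<bar>l y * u y\<bar>)"
    "(\<integral>y. \<bar>l y * u y\<bar> \<partial>lborel) \<le> hconst q l * Lp_norm q u"
proof -
  define r where "r = q / (q - 1)"
  have r: "1 < r" "1 / q + 1 / r = 1" using q by (auto simp: r_def field_simps)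
  have [measurable]: "l \<in> borel_measurable borel" "u \<in> borel_measurable borel"
    using l u Lp_measurable by auto
  note il = Lp_integrable[OF l, folded r_def] and iu = Lp_integrable[OF u]
  have young: "\<bar>l y * v\<bar> \<le> \<bar>l y\<bar> powr r + \<bar>v\<bar> powr q" for y v
  proof -
    have "\<bar>l y * v\<bar> \<le> \<bar>l y\<bar> powr r / r + \<bar>v\<bar> powr q / q"
      unfolding abs_mult using r q by (intro Youngs_inequality) auto
    also have "\<bar>l y\<bar> powr r / r \<le> \<bar>l y\<bar> powr r / 1"
      using r by (intro divide_left_mono) auto
    also have "\<bar>v\<bar> powr q / q \<le> \<bar>v\<bar> powr q / 1"
      using q by (intro divide_left_mono) auto
    finally show ?thesis by simp
  qed
  show i: "integrable lborel (\<lambda>y. \<bar>l y * u y\<bar>)"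
    by (rule Bochner_Integration.integrable_bound[OF Bochner_Integration.integrable_add[OF il iu]]) (use young in auto)
  show "(\<integral>y. \<bar>l y * u y\<bar> \<partial>lborel) \<le> hconst q l * Lp_norm q u"
  proof (cases "Lp_norm q u = 0")
    case True
    then have "ae_eq u (\<lambda>x. 0)" using Lp_norm_eq_0[OF _ u] q by simp
    then have ae: "AE y in lborel. \<bar>l y * u y\<bar> = 0" unfolding ae_eq_def by eventually_elim simp
    have "(\<integral>y. \<bar>l y * u y\<bar> \<partial>lborel) = (\<integral>y. 0 \<partial>lborel)"
      using integral_cong_AE[OF _ _ ae] by simp
    then show ?thesis using True by simp
  next
    case False
    define n where "n = Lp_norm q u"
    have n: "0 < n" using False Lp_norm_ge0[of q u] by (simp add: n_def)
    have "(\<integral>y. \<bar>l y * u y\<bar> \<partial>lborel) \<le> (\<integral>y. n * (\<bar>l y\<bar> powr r + \<bar>u y\<bar> powr q / n powr q) \<partial>lborel)"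
    proof (rule integral_mono[OF i])
      show "integrable lborel (\<lambda>y. n * (\<bar>l y\<bar> powr r + \<bar>u y\<bar> powr q / n powr q))"
        using il iu by simp
      fix y
      have "n * \<bar>l y * (u y / n)\<bar> \<le> n * (\<bar>l y\<bar> powr r + \<bar>u y / n\<bar> powr q)"
        by (rule mult_left_mono[OF young]) (use n in simp)
      then show "\<bar>l y * u y\<bar> \<le> n * (\<bar>l y\<bar> powr r + \<bar>u y\<bar> powr q / n powr q)"
        using n by (simp add: abs_mult powr_divide)
    qed
    also have "\<dots> = n * ((\<integral>y. \<bar>l y\<bar> powr r \<partial>lborel) + n powr q / n powr q)"
      using il iu q Lp_norm_powr[of q u] by (simp add: n_def)
    also have "\<dots> = hconst q l * n" using n by (simp add: hconst_def r_def)
    finally show ?thesis by (simp add: n_def)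
  qed
qed

text \<open>The second argument of k is the displacement y and not a point: as a kernel in two
  points it reads k x (x - z). In this form the singularity sits at y = 0 for every x, and majorants
  depending on y alone are convolution weights.\<close>

definition kop :: "(real \<Rightarrow> real \<Rightarrow> real) \<Rightarrow> (real \<Rightarrow> real) \<Rightarrow> real \<Rightarrow> real" where
  "kop k u x = (\<integral>y. k x y * u (x - y) \<partial>lborel)"

lemma kop_measurable:
  assumes [measurable]: "(\<lambda>(x, y). k x y) \<in> borel_measurable (borel \<Otimes>\<^sub>M borel)" "u \<in> borel_measurable borel"
  shows "kop k u \<in> borel_measurable borel"
  unfolding kop_def by measurable

text \<open>Hoelder in y for each fixed x leaves a multiple of m x. The exponent q of the input and
  r of the output are therefore independent of each other.\<close>

lemma kop_rank_one_bound:
  assumes q: "1 < q" and r: "1 \<le> r" and k: "(\<lambda>(x, y). k x y) \<in> borel_measurable (borel \<Otimes>\<^sub>M borel)"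
    and le: "\<And>x y. \<bar>k x y\<bar> \<le> m x * l y" and m0: "\<And>x. 0 \<le> m x" and l0: "\<And>y. 0 \<le> l y"
    and m: "m \<in> Lp r" and l: "l \<in> Lp (q / (q - 1))" and u: "u \<in> Lp q"
  shows "\<And>x. integrable lborel (\<lambda>y. k x y * u (x - y))"
    "kop k u \<in> Lp r" "Lp_norm r (kop k u) \<le> hconst q l * Lp_norm r m * Lp_norm q u"
proof -
  have [measurable]: "u \<in> borel_measurable borel" "l \<in> borel_measurable borel" "m \<in> borel_measurable borel"
    using u l m Lp_measurable by auto
  note [measurable] = k
  have [measurable]: "k x \<in> borel_measurable borel" for x
    using measurable_compose[OF measurable_Pair1' k, of x] by simp
  note hb = holder_bound[OF q l Lp_shift(1)[OF u], unfolded Lp_shift(2)[OF u]]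
  have le': "\<bar>k x y * u (x - y)\<bar> \<le> m x * \<bar>l y * u (x - y)\<bar>" for x y
    using mult_right_mono[OF le, of "\<bar>u (x - y)\<bar>" x y] l0[of y] by (simp add: abs_mult mult.assoc)
  show ik: "integrable lborel (\<lambda>y. k x y * u (x - y))" for x
    by (rule Bochner_Integration.integrable_bound[OF integrable_mult_right[OF hb(1), of "m x" x]])
       (use le' m0 in \<open>auto simp: abs_mult\<close>)
  define c where "c = hconst q l * Lp_norm q u"
  have c0: "0 \<le> c" using hconst_pos[of q l] Lp_norm_ge0[of q u] by (simp add: c_def)
  have bd: "\<bar>kop k u x\<bar> \<le> c * m x" for x
  proof -
    have "\<bar>kop k u x\<bar> \<le> (\<integral>y. \<bar>k x y * u (x - y)\<bar> \<partial>lborel)"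
      unfolding kop_def by (rule integral_abs_bound)
    also have "\<dots> \<le> (\<integral>y. m x * \<bar>l y * u (x - y)\<bar> \<partial>lborel)"
      by (rule integral_mono) (use ik hb(1) le' in auto)
    also have "\<dots> \<le> m x * c" using hb(2) m0 by (simp add: c_def mult_left_mono)
    finally show ?thesis by (simp add: mult.commute)
  qed
  have cm: "(\<lambda>x. c * m x) \<in> Lp r" using r m by (intro Lp_scale) auto
  have "AE x in lborel. \<bar>kop k u x\<bar> \<le> \<bar>c * m x\<bar>"
    using bd by (intro AE_I2) (meson abs_ge_self order_trans)
  from Lp_mono[OF _ cm kop_measurable[OF k] this] r
  have *: "kop k u \<in> Lp r" "Lp_norm r (kop k u) \<le> Lp_norm r (\<lambda>x. c * m x)" by auto
  then show "kop k u \<in> Lp r" "Lp_norm r (kop k u) \<le> hconst q l * Lp_norm r m * Lp_norm q u"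
    using Lp_scale(2)[OF _ m, of c] r c0 by (auto simp: c_def mult_ac)
qed

text \<open>The majorant has a translation invariant part, handled by Young's inequality, and a
  product part, handled by Hoelder's. The second accommodates a decay in y that is too slow to be
  integrable.\<close>

lemma kop_bound:
  assumes q: "1 < q" and k: "(\<lambda>(x, y). k x y) \<in> borel_measurable (borel \<Otimes>\<^sub>M borel)"
    and le: "\<And>x y. \<bar>k x y\<bar> \<le> \<kappa> y + m x * l y" and m0: "\<And>x. 0 \<le> m x" and l0: "\<And>y. 0 \<le> l y"
    and kap: "integrable lborel \<kappa>" "\<And>y. 0 \<le> \<kappa> y"
    and m: "m \<in> Lp q" and l: "l \<in> Lp (q / (q - 1))" and u: "u \<in> Lp q"
  shows "AE x in lborel. integrable lborel (\<lambda>y. k x y * u (x - y))"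
    "kop k u \<in> Lp q" "Lp_norm q (kop k u) \<le> ((\<integral>y. \<kappa> y \<partial>lborel) + hconst q l * Lp_norm q m) * Lp_norm q u"
proof -
  have [measurable]: "u \<in> borel_measurable borel" "l \<in> borel_measurable borel" "m \<in> borel_measurable borel" "\<kappa> \<in> borel_measurable borel"
    using u l m Lp_measurable kap by auto
  note [measurable] = k
  have [measurable]: "k x \<in> borel_measurable borel" for x
    using measurable_compose[OF measurable_Pair1' k, of x] by simp
  have q1: "1 \<le> q" using q by simp
  note yc = young_convolution[OF q1 kap u]
  have ml: "(\<lambda>(x, y). m x * l y) \<in> borel_measurable (borel \<Otimes>\<^sub>M borel)" by measurable
  have ua: "(\<lambda>x. \<bar>u x\<bar>) \<in> Lp q" using u by (rule Lp_abs)
  have ro: "\<bar>m x * l y\<bar> \<le> m x * l y" for x y using m0[of x] l0[of y] by simp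
  note rb = kop_rank_one_bound[where k="\<lambda>x y. m x * l y", OF q q1 ml ro m0 l0 m l ua]
  have le': "\<bar>k x y * u (x - y)\<bar> \<le> \<kappa> y * \<bar>u (x - y)\<bar> + m x * l y * \<bar>u (x - y)\<bar>" for x y
    using mult_right_mono[OF le, of "\<bar>u (x - y)\<bar>" x y] by (simp add: abs_mult distrib_right)
  have ik: "integrable lborel (\<lambda>y. k x y * u (x - y))" if "integrable lborel (\<lambda>y. \<kappa> y * \<bar>u (x - y)\<bar>)" for x
    by (rule Bochner_Integration.integrable_bound[OF Bochner_Integration.integrable_add[OF that rb(1)[of x]]])
       (use le' in \<open>auto intro: order_trans[OF _ abs_ge_self]\<close>)
  show "AE x in lborel. integrable lborel (\<lambda>y. k x y * u (x - y))"
    using yc(1) by eventually_elim (rule ik)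
  let ?U = "\<lambda>x. \<integral>y. \<kappa> y * \<bar>u (x - y)\<bar> \<partial>lborel"
  let ?V = "kop (\<lambda>x y. m x * l y) (\<lambda>x. \<bar>u x\<bar>)"
  have "AE x in lborel. \<bar>kop k u x\<bar> \<le> \<bar>?U x + ?V x\<bar>"
    using yc(1)
  proof eventually_elim
    case (elim x)
    have "\<bar>kop k u x\<bar> \<le> (\<integral>y. \<bar>k x y * u (x - y)\<bar> \<partial>lborel)"
      unfolding kop_def by (rule integral_abs_bound)
    also have "\<dots> \<le> (\<integral>y. \<kappa> y * \<bar>u (x - y)\<bar> + m x * l y * \<bar>u (x - y)\<bar> \<partial>lborel)"
      by (rule integral_mono) (use ik[OF elim] elim rb(1)[of x] le' in auto)
    also have "\<dots> = ?U x + ?V x" using elim rb(1)[of x] by (simp add: kop_def)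
    finally show ?case by simp
  qed
  note mono = Lp_mono[OF _ Lp_add(1)[OF q1 yc(2) rb(2)] kop_measurable[OF k] this]
  then show "kop k u \<in> Lp q" using q by simp
  have "Lp_norm q (kop k u) \<le> Lp_norm q (\<lambda>x. ?U x + ?V x)" using mono q by simp
  also have "\<dots> \<le> Lp_norm q ?U + Lp_norm q ?V" by (rule Lp_add(2)[OF q1 yc(2) rb(2)])
  also have "\<dots> \<le> (\<integral>y. \<kappa> y \<partial>lborel) * Lp_norm q u + hconst q l * Lp_norm q m * Lp_norm q u"
    using yc(3) rb(3) by (intro add_mono) (simp_all add: Lp_abs)
  finally show "Lp_norm q (kop k u) \<le> ((\<integral>y. \<kappa> y \<partial>lborel) + hconst q l * Lp_norm q m) * Lp_norm q u"
    by (simp add: distrib_right)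
qed

section \<open>Integrability of powers near zero and near infinity\<close>

lemma integrable_even:
  fixes g :: "real \<Rightarrow> real"
  assumes [measurable]: "g \<in> borel_measurable borel" and i: "integrable lborel (\<lambda>y. indicator {0<..} y * g y)"
  shows "integrable lborel (\<lambda>y. g \<bar>y\<bar>)"
proof -
  have i2: "integrable lborel (\<lambda>y. indicator {0<..} (0 - y) * g (0 - y))"
    using integrable_shift_iff(2)[of "\<lambda>y. indicator {0<..} y * g y" 0] i by simp
  have ae: "AE y in lborel. y \<noteq> (0::real)" by (rule AE_lborel_singleton)
  have "integrable lborel (\<lambda>y. indicator {0<..} y * g y + indicator {0<..} (0 - y) * g (0 - y))"
    using i i2 by (rule Bochner_Integration.integrable_add)
  then show ?thesis
    by (rule integrable_cong_AE_imp) (use ae in \<open>auto simp: indicator_def elim!: eventually_mono\<close>)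
qed

lemma integrable_powr_near:
  assumes "0 < a"
  shows "integrable lborel (\<lambda>y::real. indicator {0..1} \<bar>y\<bar> * \<bar>y\<bar> powr (a - 1))"
proof (rule integrable_even)
  have "(\<lambda>x::real. x powr (a - 1)) absolutely_integrable_on {0..1}"
    using integrable_on_powr_from_0[of "a - 1" 1] assms
    by (intro nonnegative_absolutely_integrable_1) auto
  then have "integrable lborel (\<lambda>x. indicator {0..1} x * x powr (a - 1))"
    by (simp add: set_integrable_def integrable_completion)
  then show "integrable lborel (\<lambda>x::real. indicator {0<..} x * (indicator {0..1} x * x powr (a - 1)))"
    by (rule integrable_cong_AE_imp) (auto simp: indicator_def intro!: AE_I2)
qed measurable

lemma integrable_powr_far:
  assumes "1 < r" "0 < d"
  shows "integrable lborel (\<lambda>y::real. indicator {d<..} \<bar>y\<bar> * \<bar>y\<bar> powr (- r))"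
proof (rule integrable_even)
  let ?F = "\<lambda>x::real. - (x powr (1 - r)) / (r - 1)"
  have "(\<integral>\<^sup>+ x. ennreal (x powr (- r)) * indicator {d..} x \<partial>lborel) = ennreal (0 - ?F d)"
  proof (rule nn_integral_FTC_atLeast)
    fix x assume "d \<le> x"
    then have "DERIV ?F x :> - ((1 - r) * x powr (1 - r - 1)) / (r - 1)" using assms
      by (intro DERIV_cdivide DERIV_minus has_real_derivative_powr) auto
    moreover have "- ((1 - r) * x powr (1 - r - 1)) / (r - 1) = x powr (- r)"
      using assms by (simp add: field_simps)
    ultimately show "DERIV ?F x :> x powr (- r)" by simp
  next
    have "((\<lambda>x::real. x powr (1 - r)) \<longlongrightarrow> 0) at_top"
      by (rule tendsto_neg_powr) (use assms in \<open>auto simp: filterlim_ident\<close>)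
    from tendsto_divide[OF tendsto_minus[OF this] tendsto_const, of "r - 1"] assms
    show "(?F \<longlongrightarrow> 0) at_top" by simp
  qed auto
  then have "integrable lborel (\<lambda>x. x powr (- r) * indicator {d..} x)"
    by (intro integrableI_nonneg) (auto simp: ennreal_mult'' ennreal_indicator)
  then have "integrable lborel (\<lambda>x. indicator {d<..} x * (x powr (- r) * indicator {d..} x))"
    by (rule integrable_real_mult_indicator[rotated, unfolded mult.commute[of _ "indicator _ _"]]) auto
  then show "integrable lborel (\<lambda>x::real. indicator {0<..} x * (indicator {d<..} x * x powr (- r)))"
    by (rule integrable_cong_AE_imp) (use assms in \<open>auto simp: indicator_def intro!: AE_I2\<close>)
qed measurable

lemma far_Lp:
  assumes q: "1 < q" and d: "0 < d"
  shows "(\<lambda>y::real. indicator {d<..} \<bar>y\<bar> / \<bar>y\<bar>) \<in> Lp q"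
proof -
  have "integrable lborel (\<lambda>y::real. \<bar>indicator {d<..} \<bar>y\<bar> / \<bar>y\<bar>\<bar> powr q)"
    by (rule integrable_cong_AE_imp[OF integrable_powr_far[OF q d]])
       (use d q in \<open>auto simp: indicator_def powr_minus powr_divide divide_inverse inverse_powr intro!: AE_I2\<close>)
  then show ?thesis by (simp add: Lp_def)
qed

section \<open>Test functions\<close>

text \<open>This is t / n \<le> exp (t / n), raised to the power n, with t = c / s.\<close>

lemma exp_neg_inverse_le:
  fixes s c :: real
  assumes "0 < s" "0 < c" "0 < n"
  shows "exp (- c / s) \<le> (real n * s / c) ^ n"
proof -
  define t where "t = c / s"
  have t: "0 < t" using assms by (simp add: t_def)
  have "t / n \<le> exp (t / n)" using exp_ge_add_one_self[of "t / n"] by linarith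
  then have "(t / n) ^ n \<le> exp (t / n) ^ n" using t by (intro power_mono) auto
  also have "\<dots> = exp t" using assms by (simp flip: exp_of_nat_mult)
  finally have "inverse (exp t) \<le> inverse ((t / n) ^ n)" using t assms by (intro le_imp_inverse_le) auto
  then show ?thesis by (simp add: t_def exp_minus power_inverse[symmetric] mult.commute)
qed

context
  fixes a b c :: real
  assumes c: "0 < c"
begin

text \<open>The family p / R^k * exp (- c / R) with R = (x - a) (b - x), extended by zero, is closed
  under differentiation; smoothness of a bump function thus becomes an induction over the polynomial
  p and the exponent k.\<close>

definition bump_aux :: "real poly \<Rightarrow> nat \<Rightarrow> real \<Rightarrow> real" where
  "bump_aux p k x = (if 0 < (x - a) * (b - x) then poly p x / ((x - a) * (b - x)) ^ k * exp (- c / ((x - a) * (b - x))) else 0)"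

text \<open>The numerator of the derivative once everything is put over R^(k + 2): the last summand
  comes from the exponential, the first two from the quotient rule.\<close>

definition bump_step :: "real poly \<Rightarrow> nat \<Rightarrow> real poly" where
  "bump_step p k = (let R = [:-a, 1:] * [:b, -1:] in
     pderiv p * R ^ 2 - smult (of_nat k) (p * pderiv R * R) + smult c (p * pderiv R))"

lemma bump_aux_deriv:
  "(bump_aux p k has_real_derivative bump_aux (bump_step p k) (k + 2) x) (at x)"
proof -
  define R where "R = [:-a, 1:] * [:b, -1:]"
  have R: "poly R y = (y - a) * (b - y)" for y by (simp add: R_def algebra_simps)
  have bs: "bump_step p k = pderiv p * R ^ 2 - smult (of_nat k) (p * pderiv R * R) + smult c (p * pderiv R)"
    unfolding bump_step_def Let_def R_def ..
  have ba: "bump_aux p k y = (if 0 < poly R y then poly p y / poly R y ^ k * exp (- c / poly R y) else 0)" for p k y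
    by (simp add: bump_aux_def R)
  show ?thesis
  proof (cases "0 < poly R x")
    case True
    define r r' where "r = poly R x" and "r' = poly (pderiv R) x"
    have r: "0 < r" using True by (simp add: r_def)
    have op: "open {y. 0 < poly R y}" by (intro open_Collect_less continuous_intros)
    have "((\<lambda>y. poly p y / poly R y ^ k * exp (- c / poly R y)) has_real_derivative
      ((poly (pderiv p) x * r ^ k - poly p x * (of_nat k * (r' * r ^ (k - Suc 0)))) / (r ^ k * r ^ k)) * exp (- c / r)
       + exp (- c / r) * (c * r' / (r * r)) * (poly p x / r ^ k)) (at x)"
    proof (rule DERIV_cong[OF DERIV_mult])
      show "((\<lambda>y. poly p y / poly R y ^ k) has_real_derivative
        (poly (pderiv p) x * r ^ k - poly p x * (of_nat k * (r' * r ^ (k - Suc 0)))) / (r ^ k * r ^ k)) (at x)"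
        unfolding r_def r'_def using r
        by (intro DERIV_divide DERIV_power poly_DERIV) (simp add: r_def)
      show "((\<lambda>y. exp (- c / poly R y)) has_real_derivative exp (- c / r) * (c * r' / (r * r))) (at x)"
        using r by (auto intro!: derivative_eq_intros poly_DERIV simp: r_def r'_def)
    qed (simp add: r_def)
    also have "((poly (pderiv p) x * r ^ k - poly p x * (of_nat k * (r' * r ^ (k - Suc 0)))) / (r ^ k * r ^ k)) * exp (- c / r)
       + exp (- c / r) * (c * r' / (r * r)) * (poly p x / r ^ k) =
      (poly (pderiv p) x * r ^ 2 - of_nat k * (poly p x * r' * r) + c * (poly p x * r')) / r ^ (k + 2) * exp (- c / r)"
    proof -
      have 1: "(poly (pderiv p) x * r ^ k - poly p x * (of_nat k * (r' * r ^ (k - Suc 0)))) / (r ^ k * r ^ k)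
         = (poly (pderiv p) x * r ^ 2 - of_nat k * (poly p x * r' * r)) / r ^ (k + 2)"
        using r by (cases k) (simp_all add: field_simps power2_eq_square)
      have 2: "(c * r' / (r * r)) * (poly p x / r ^ k) = c * (poly p x * r') / r ^ (k + 2)"
        using r by (simp add: field_simps power2_eq_square)
      have "exp (- c / r) * (c * r' / (r * r)) * (poly p x / r ^ k) = (c * r' / (r * r)) * (poly p x / r ^ k) * exp (- c / r)"
        by simp
      then show ?thesis unfolding 1 2 by (simp add: add_divide_distrib distrib_right)
    qed
    also have "\<dots> = bump_aux (bump_step p k) (k + 2) x"
      using True by (simp add: ba bs r_def r'_def)
    finally show ?thesis
      by (rule has_field_derivative_transform_within_open[OF _ op]) (use True in \<open>auto simp: ba\<close>)
  next
    case False
    \<comment> \<open>With this exponent the exponential cancels the pole of order k and leaves s^2,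
      so the function is bounded by a multiple of (y - x)^2 near x and has derivative zero
      there.\<close>
    define n where "n = k + 2"
    define M where "M y = \<bar>poly p y\<bar> * (real n / c) ^ n * (b + a - x - y)\<^sup>2 * \<bar>y - x\<bar>" for y
    have bx: "bump_aux q j x = 0" for q j using False by (simp add: ba)
    have bd: "\<bar>bump_aux p k y\<bar> \<le> M y * \<bar>y - x\<bar>" for y
    proof (cases "0 < poly R y")
      case True
      define s where "s = poly R y"
      have s: "0 < s" using True by (simp add: s_def)
      \<comment> \<open>At a point x where R is not positive, R y is at most the increment R y - R
        x, which contains the factor y - x.\<close>
      have "s \<le> s - poly R x" using False by simp
      also have "s - poly R x = (y - x) * (b + a - x - y)" by (simp add: s_def R algebra_simps)
      finally have sb: "s \<le> \<bar>(y - x) * (b + a - x - y)\<bar>" by linarith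
      have "\<bar>bump_aux p k y\<bar> = \<bar>poly p y\<bar> / s ^ k * exp (- c / s)"
        using True by (simp add: ba s_def abs_mult)
      also have "\<dots> \<le> \<bar>poly p y\<bar> / s ^ k * (real n * s / c) ^ n"
        using s c by (intro mult_left_mono exp_neg_inverse_le) (auto simp: n_def)
      also have "\<dots> = \<bar>poly p y\<bar> * (real n / c) ^ n * s ^ 2"
      proof -
        have "(real n * s / c) ^ n = (real n / c) ^ n * (s ^ k * s ^ 2)"
          unfolding n_def power_add[symmetric] power_mult_distrib[symmetric] by simp
        then show ?thesis using s by simp
      qed
      also have "\<dots> \<le> \<bar>poly p y\<bar> * (real n / c) ^ n * \<bar>(y - x) * (b + a - x - y)\<bar> ^ 2"
        using s sb c by (intro mult_left_mono power_mono) auto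
      also have "\<dots> = M y * \<bar>y - x\<bar>"
        by (simp add: M_def power2_eq_square abs_mult_self_eq)
      finally show ?thesis .
    next
      case False
      then show ?thesis using c by (simp add: ba M_def)
    qed
    have "((\<lambda>y. (bump_aux p k y - bump_aux p k x) / (y - x)) \<longlongrightarrow> 0) (at x)"
    proof (rule Lim_null_comparison)
      show "eventually (\<lambda>y. norm ((bump_aux p k y - bump_aux p k x) / (y - x)) \<le> M y) (at x)"
        using eventually_neq_at_within[of x]
      proof eventually_elim
        case (elim y)
        then show ?case using bd[of y] bx by (simp add: pos_divide_le_eq)
      qed
      have "(M \<longlongrightarrow> \<bar>poly p x\<bar> * (real n / c) ^ n * (b + a - x - x)\<^sup>2 * \<bar>x - x\<bar>) (at x)"
        unfolding M_def by (intro tendsto_intros)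
      then show "(M \<longlongrightarrow> 0) (at x)" by simp
    qed
    then show ?thesis using bx by (simp add: has_field_derivative_iff)
  qed
qed

lemma bump_aux_test: "test_fun (bump_aux p k)"
  unfolding test_fun_def
proof (intro conjI allI)
  fix n x
  have "\<exists>q j. (deriv ^^ n) (bump_aux p k) = bump_aux q j" for n
  proof (induction n)
    case (Suc n)
    then obtain q j where "(deriv ^^ n) (bump_aux p k) = bump_aux q j" by blast
    moreover have "deriv (bump_aux q j) = bump_aux (bump_step q j) (j + 2)"
      using DERIV_imp_deriv[OF bump_aux_deriv] by blast
    ultimately show ?case by auto
  qed auto
  then obtain q j where "(deriv ^^ n) (bump_aux p k) = bump_aux q j" by blast
  then show "(deriv ^^ n) (bump_aux p k) differentiable (at x)"
    using bump_aux_deriv by (auto simp: real_differentiable_def)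
next
  have "{x. bump_aux p k x \<noteq> 0} \<subseteq> {min a b..max a b}"
    by (auto simp: bump_aux_def zero_less_mult_iff split: if_splits)
  then show "bounded {x. bump_aux p k x \<noteq> 0}"
    using bounded_subset bounded_closed_interval by blast
qed

end

section \<open>Bump functions approximating intervals, and elementary properties of test
  functions\<close>

definition bump :: "real \<Rightarrow> real \<Rightarrow> real \<Rightarrow> real \<Rightarrow> real" where
  "bump a b c x = (if a < x \<and> x < b then exp (- c / ((x - a) * (b - x))) else 0)"

lemma bump_test: assumes "0 < c" "a < b" shows "test_fun (bump a b c)"
proof -
  have "bump a b c = bump_aux a b c 1 0"
    using assms by (auto simp: fun_eq_iff bump_def bump_aux_def[OF assms(1)] zero_less_mult_iff)
  then show ?thesis using bump_aux_test[OF assms(1)] by simp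
qed

lemma bump_bounds: "0 < c \<Longrightarrow> 0 \<le> bump a b c x" "0 < c \<Longrightarrow> bump a b c x \<le> indicator {a<..<b} x"
  by (auto simp: bump_def indicator_def)

lemma bump_lim: "(\<lambda>n. bump a b (1 / Suc n) x) \<longlonglongrightarrow> indicator {a<..<b} x"
proof (cases "a < x \<and> x < b")
  case True
  have "(\<lambda>n. exp (- (1 / real (Suc n)) / ((x - a) * (b - x)))) \<longlonglongrightarrow> exp (- 0 / ((x - a) * (b - x)))"
    by (intro tendsto_intros LIMSEQ_Suc lim_1_over_n) (use True in auto)
  then show ?thesis using True by (simp add: bump_def)
qed (auto simp: bump_def)

text \<open>Widening the interval by 1 on each side keeps (x - a) (b - x) at least 1 on the original
  one. A uniform lower bound of this kind lets integrability against test functions imply local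
  integrability.\<close>

lemma bump_ge:
  assumes "a < x" "x < b" shows "exp (-1) \<le> bump (a - 1) (b + 1) 1 x"
proof -
  have "1 * 1 \<le> (x - (a - 1)) * (b + 1 - x)" using assms by (intro mult_mono) auto
  then show ?thesis using assms by (simp add: bump_def)
qed

lemma test_fun_continuous: "test_fun \<phi> \<Longrightarrow> continuous_on S \<phi>"
  unfolding test_fun_def
  by (metis differentiable_imp_continuous_within continuous_at_imp_continuous_on funpow_0)

lemma test_fun_measurable: "test_fun \<phi> \<Longrightarrow> \<phi> \<in> borel_measurable borel"
  by (intro borel_measurable_continuous_onI test_fun_continuous)

lemma test_fun_deriv: "test_fun \<phi> \<Longrightarrow> (\<phi> has_real_derivative deriv \<phi> x) (at x)"
  unfolding test_fun_def
  by (metis DERIV_deriv_iff_real_differentiable funpow_0)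

lemma test_fun_support:
  assumes "test_fun \<phi>"
  obtains N where "0 < N" "\<And>x. N < \<bar>x\<bar> \<Longrightarrow> \<phi> x = 0" "\<And>x. N < \<bar>x\<bar> \<Longrightarrow> deriv \<phi> x = 0"
proof -
  obtain N where N: "0 < N" "\<And>x. \<phi> x \<noteq> 0 \<Longrightarrow> \<bar>x\<bar> \<le> N"
    using assms unfolding test_fun_def bounded_pos by auto
  have z: "\<phi> x = 0" if "N < \<bar>x\<bar>" for x using N(2)[of x] that by fastforce
  have "deriv \<phi> x = 0" if "N < \<bar>x\<bar>" for x
  proof (rule DERIV_imp_deriv)
    have op: "open {y. N < \<bar>y\<bar>}" by (intro open_Collect_less continuous_intros)
    show "(\<phi> has_real_derivative 0) (at x)"
      by (rule has_field_derivative_transform_within_open[OF DERIV_const[of 0] op]) (use that z in auto)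
  qed
  with N z show ?thesis using that by blast
qed

lemma test_fun_deriv_cont:
  assumes "test_fun \<phi>" shows "continuous_on S (deriv \<phi>)"
proof -
  have "(deriv ^^ 1) \<phi> differentiable (at x)" for x using assms unfolding test_fun_def by blast
  then show ?thesis
    by (auto intro!: continuous_at_imp_continuous_on differentiable_imp_continuous_within)
qed

lemma continuous_compact_support_bounded:
  fixes g :: "real \<Rightarrow> real"
  assumes "continuous_on UNIV g" "\<And>x. N < \<bar>x\<bar> \<Longrightarrow> g x = 0"
  obtains K where "0 < K" "\<And>x. \<bar>g x\<bar> \<le> K"
proof -
  have "compact (g ` {-N..N})"
    by (intro compact_continuous_image continuous_on_subset[OF assms(1)]) auto
  then obtain K where K: "0 < K" "\<And>x. x \<in> {-N..N} \<Longrightarrow> \<bar>g x\<bar> \<le> K"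
    using compact_imp_bounded bounded_pos by (metis image_eqI real_norm_def)
  have "\<bar>g x\<bar> \<le> K" for x using K assms(2)[of x] by (cases "x \<in> {-N..N}") auto
  with K that show ?thesis by blast
qed

lemma bounded_support_Lp:
  fixes g :: "real \<Rightarrow> real"
  assumes [measurable]: "g \<in> borel_measurable borel" and K: "\<And>x. \<bar>g x\<bar> \<le> K" and N: "\<And>x. N < \<bar>x\<bar> \<Longrightarrow> g x = 0" and p: "0 < p"
  shows "g \<in> Lp p"
proof -
  have K0: "0 \<le> K" using K[of 0] by linarith
  have "integrable lborel (\<lambda>x. \<bar>g x\<bar> powr p)"
  proof (rule Bochner_Integration.integrable_bound)
    show "integrable lborel (\<lambda>x. K powr p * indicator {-N..N} x)"
      by (intro integrable_mult_right integrable_real_indicator) (auto simp: emeasure_lborel_Icc_eq)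
    show "AE x in lborel. norm (\<bar>g x\<bar> powr p) \<le> norm (K powr p * indicator {-N..N} x)"
    proof (intro AE_I2)
      fix x show "norm (\<bar>g x\<bar> powr p) \<le> norm (K powr p * indicator {-N..N} x)"
        using K[of x] N[of x] p by (cases "x \<in> {-N..N}") (auto intro!: powr_mono2)
    qed
  qed simp
  then show ?thesis by (simp add: Lp_def)
qed

lemma test_fun_bounded:
  assumes "test_fun \<phi>" obtains K where "0 < K" "\<And>x. \<bar>\<phi> x\<bar> \<le> K"
  using test_fun_support[OF assms] continuous_compact_support_bounded[OF test_fun_continuous[OF assms]] by metis

lemma test_fun_Lp: assumes "test_fun \<phi>" "0 < p" shows "\<phi> \<in> Lp p"
  using test_fun_support[OF assms(1)] test_fun_bounded[OF assms(1)] bounded_support_Lp[OF test_fun_measurable[OF assms(1)]] assms(2)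
  by metis

lemma test_fun_comb:
  assumes f: "test_fun f" and g: "test_fun g"
  shows "test_fun (\<lambda>x. a * f x + b * g x)"
proof -
  have df: "((deriv ^^ n) f has_real_derivative (deriv ^^ Suc n) f x) (at x)" if "test_fun f" for f n x
    using that unfolding test_fun_def by (simp add: DERIV_deriv_iff_real_differentiable)
  have eq: "(deriv ^^ n) (\<lambda>x. a * f x + b * g x) = (\<lambda>x. a * (deriv ^^ n) f x + b * (deriv ^^ n) g x)" for n
  proof (induction n)
    case (Suc n)
    have "deriv (\<lambda>x. a * (deriv ^^ n) f x + b * (deriv ^^ n) g x) x = a * (deriv ^^ Suc n) f x + b * (deriv ^^ Suc n) g x" for x
      by (rule DERIV_imp_deriv) (intro DERIV_add DERIV_cmult df f g)
    then show ?case using Suc by auto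
  qed simp
  have "bounded {x. a * f x + b * g x \<noteq> 0}"
    by (rule bounded_subset[of "{x. f x \<noteq> 0} \<union> {x. g x \<noteq> 0}"]) (use f g in \<open>auto simp: test_fun_def\<close>)
  moreover have "(\<lambda>x. a * (deriv ^^ n) f x + b * (deriv ^^ n) g x) differentiable (at x)" for n x
    using f g by (intro derivative_intros) (auto simp: test_fun_def)
  ultimately show ?thesis unfolding test_fun_def eq by blast
qed

section \<open>Density of test functions\<close>

lemma Lp_dominated:
  assumes p: "1 \<le> p" and g: "g \<in> Lp p" and [measurable]: "\<And>n. s n \<in> borel_measurable borel" "u \<in> borel_measurable borel"
    and le: "\<And>n. AE x in lborel. \<bar>s n x\<bar> \<le> g x" and lim: "AE x in lborel. (\<lambda>n. s n x) \<longlonglongrightarrow> u x"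
  shows "\<And>n. s n \<in> Lp p" "u \<in> Lp p" "(\<lambda>n. Lp_norm p (\<lambda>x. s n x - u x)) \<longlonglongrightarrow> 0"
proof -
  have p0: "0 < p" using p by simp
  have [measurable]: "g \<in> borel_measurable borel" using g by (rule Lp_measurable)
  have le': "AE x in lborel. \<forall>n. \<bar>s n x\<bar> \<le> g x" using le by (simp add: AE_all_countable)
  have leu: "AE x in lborel. \<bar>u x\<bar> \<le> g x" using le' lim
  proof eventually_elim
    case (elim x)
    then show ?case by (intro LIMSEQ_le_const2[OF tendsto_rabs[of "\<lambda>n. s n x"]]) auto
  qed
  show "s n \<in> Lp p" for n
    by (rule Lp_mono(1)[OF p0 g]) (use le[of n] in \<open>auto elim!: eventually_mono\<close>)
  show "u \<in> Lp p"
    by (rule Lp_mono(1)[OF p0 g]) (use leu in \<open>auto elim!: eventually_mono\<close>)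
  have "(\<lambda>n. \<integral>x. \<bar>s n x - u x\<bar> powr p \<partial>lborel) \<longlonglongrightarrow> (\<integral>x. 0 \<partial>(lborel :: real measure))"
  proof (rule integral_dominated_convergence)
    show "integrable lborel (\<lambda>x. \<bar>2 * g x\<bar> powr p)"
      using Lp_integrable[OF Lp_scale(1)[OF p0 g, of 2]] .
    show "AE x in lborel. (\<lambda>n. \<bar>s n x - u x\<bar> powr p) \<longlonglongrightarrow> 0"
      using lim
    proof eventually_elim
      case (elim x)
      have "(\<lambda>n. \<bar>s n x - u x\<bar> powr p) \<longlonglongrightarrow> \<bar>u x - u x\<bar> powr p"
        using p0 by (intro tendsto_powr2 tendsto_intros elim) auto
      then show ?case by simp
    qed
    fix n show "AE x in lborel. norm (\<bar>s n x - u x\<bar> powr p) \<le> \<bar>2 * g x\<bar> powr p"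
      using leu le[of n] by eventually_elim (use p0 in \<open>auto intro!: powr_mono2\<close>)
  qed auto
  then have "(\<lambda>n. (\<integral>x. \<bar>s n x - u x\<bar> powr p \<partial>lborel) powr (1 / p)) \<longlonglongrightarrow> 0 powr (1 / p)"
    using p0 by (intro tendsto_powr2 tendsto_const) auto
  then show "(\<lambda>n. Lp_norm p (\<lambda>x. s n x - u x)) \<longlonglongrightarrow> 0"
    by (simp add: Lp_norm_def)
qed

text \<open>Density is shown by enlarging this set: it is closed under linear combinations and
  dominated limits, hence contains the indicators of intervals, of Borel sets in a bounded window,
  simple functions with bounded support, and finally all of \<open>L_p\<close>.\<close>

definition test_closure :: "real \<Rightarrow> (real \<Rightarrow> real) set" where
  "test_closure p = {u \<in> Lp p. \<forall>e>0. \<exists>\<phi>. test_fun \<phi> \<and> Lp_norm p (\<lambda>x. u x - \<phi> x) < e}"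

context
  fixes p :: real
  assumes p: "1 \<le> p"
begin

interpretation fspace "Lp p" "Lp_norm p" by (rule fspace_Lp[OF p])

lemma test_closure_test: "test_fun \<phi> \<Longrightarrow> \<phi> \<in> test_closure p"
  using p by (auto simp: test_closure_def test_fun_Lp N_zero intro!: exI[of _ \<phi>])

lemma test_closure_comb:
  assumes u: "u \<in> test_closure p" and v: "v \<in> test_closure p"
  shows "(\<lambda>x. a * u x + b * v x) \<in> test_closure p"
  unfolding test_closure_def
proof (intro CollectI conjI allI impI)
  have um: "u \<in> Lp p" and vm: "v \<in> Lp p" using u v by (auto simp: test_closure_def)
  show "(\<lambda>x. a * u x + b * v x) \<in> Lp p" using um vm by (rule comb_mem)
  fix e :: real assume e: "0 < e"
  define d where "d = e / (\<bar>a\<bar> + \<bar>b\<bar> + 1)"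
  have d: "0 < d" using e by (simp add: d_def)
  obtain \<phi> \<psi> where t: "test_fun \<phi>" "test_fun \<psi>" and n: "Lp_norm p (\<lambda>x. u x - \<phi> x) < d" "Lp_norm p (\<lambda>x. v x - \<psi> x) < d"
    using u v d unfolding test_closure_def by blast
  have tm: "\<phi> \<in> Lp p" "\<psi> \<in> Lp p" using t p by (auto intro: test_fun_Lp)
  have "Lp_norm p (\<lambda>x. (a * u x + b * v x) - (a * \<phi> x + b * \<psi> x)) \<le> Lp_norm p (\<lambda>x. a * (u x - \<phi> x)) + Lp_norm p (\<lambda>x. b * (v x - \<psi> x))"
  proof (rule N_le)
    show "(\<lambda>x. a * (u x - \<phi> x)) \<in> Lp p" "(\<lambda>x. b * (v x - \<psi> x)) \<in> Lp p"
      by (intro scale_mem diff_mem um vm tm)+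
  qed (simp add: algebra_simps)
  also have "\<dots> = \<bar>a\<bar> * Lp_norm p (\<lambda>x. u x - \<phi> x) + \<bar>b\<bar> * Lp_norm p (\<lambda>x. v x - \<psi> x)"
    by (simp add: N_scale diff_mem um vm tm)
  also have "\<dots> \<le> \<bar>a\<bar> * d + \<bar>b\<bar> * d" using n by (intro add_mono mult_left_mono) auto
  also have "\<dots> < (\<bar>a\<bar> + \<bar>b\<bar> + 1) * d" using d by (simp add: algebra_simps)
  also have "\<dots> = e" by (simp add: d_def)
  finally show "\<exists>\<phi>. test_fun \<phi> \<and> Lp_norm p (\<lambda>x. a * u x + b * v x - \<phi> x) < e"
    using test_fun_comb[OF t] by blast
qed

lemma test_closure_dominated:
  assumes g: "g \<in> Lp p" and s: "\<And>n. s n \<in> test_closure p" and [measurable]: "u \<in> borel_measurable borel"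
    and le: "\<And>n. AE x in lborel. \<bar>s n x\<bar> \<le> g x" and lim: "AE x in lborel. (\<lambda>n. s n x) \<longlonglongrightarrow> u x"
  shows "u \<in> test_closure p"
  unfolding test_closure_def
proof (intro CollectI conjI allI impI)
  have sm: "s n \<in> Lp p" for n using s by (auto simp: test_closure_def)
  then have sme: "s n \<in> borel_measurable borel" for n by (rule Lp_measurable)
  note dom = Lp_dominated[OF p g sme assms(3) le lim]
  show um: "u \<in> Lp p" by (rule dom)
  fix e :: real assume e: "0 < e"
  have "eventually (\<lambda>n. Lp_norm p (\<lambda>x. s n x - u x) < e / 2) sequentially"
    by (rule order_tendstoD(2)[OF dom(3)]) (use e in simp)
  then obtain n where n: "Lp_norm p (\<lambda>x. s n x - u x) < e / 2" by (auto simp: eventually_sequentially)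
  obtain \<phi> where t: "test_fun \<phi>" and f: "Lp_norm p (\<lambda>x. s n x - \<phi> x) < e / 2"
    using s[of n] e unfolding test_closure_def by (auto dest!: spec[of _ "e / 2"])
  have tm: "\<phi> \<in> Lp p" using t p by (auto intro: test_fun_Lp)
  have "Lp_norm p (\<lambda>x. u x - \<phi> x) \<le> Lp_norm p (\<lambda>x. u x - s n x) + Lp_norm p (\<lambda>x. s n x - \<phi> x)"
    by (rule N_le[OF diff_mem[OF um sm] diff_mem[OF sm tm]]) simp
  also have "\<dots> < e" using n f N_swap[OF um sm[of n]] by simp
  finally show "\<exists>\<phi>. test_fun \<phi> \<and> Lp_norm p (\<lambda>x. u x - \<phi> x) < e" using t by blast
qed

lemma indicator_interval_Lp: "(\<lambda>x. indicator {a..b} x :: real) \<in> Lp p" for a b :: real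
  by (rule bounded_support_Lp[of _ 1 "max \<bar>a\<bar> \<bar>b\<bar>"]) (use p in \<open>auto simp: indicator_def\<close>)

lemma test_closure_zero: "(\<lambda>x. 0) \<in> test_closure p"
  using test_closure_comb[OF test_closure_test[OF bump_test[of 1 0 1]] test_closure_test[OF bump_test[of 1 0 1]], of 0 0] by simp

lemma test_closure_interval: "(\<lambda>x. indicator {a..b} x :: real) \<in> test_closure p" for a b :: real
proof (cases "a < b")
  case True
  show ?thesis
  proof (rule test_closure_dominated[OF indicator_interval_Lp[of a b]])
    show "bump a b (1 / Suc n) \<in> test_closure p" for n
      by (intro test_closure_test bump_test) (use True in auto)
    show "AE x in lborel. \<bar>bump a b (1 / Suc n) x\<bar> \<le> indicator {a..b} x" for n
      by (intro AE_I2) (auto simp: indicator_def bump_def)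
    have "AE x in lborel. x \<noteq> a" "AE x in lborel. x \<noteq> b" by (rule AE_lborel_singleton)+
    then show "AE x in lborel. (\<lambda>n. bump a b (1 / Suc n) x) \<longlonglongrightarrow> indicator {a..b} x"
    proof eventually_elim
      case (elim x)
      then have "indicator {a..b} x = (indicator {a<..<b} x :: real)" by (auto simp: indicator_def)
      then show ?case using bump_lim by simp
    qed
  qed auto
next
  case False
  show ?thesis
  proof (rule test_closure_dominated[OF indicator_interval_Lp[of a b] test_closure_zero])
    have "AE x in lborel. x \<noteq> a" by (rule AE_lborel_singleton)
    then show "AE x in lborel. (\<lambda>n. 0) \<longlonglongrightarrow> (indicator {a..b} x :: real)"
      by eventually_elim (use False in \<open>auto simp: indicator_def\<close>)
  qed auto
qed

text \<open>The window {-N..N} makes every set in the induction of finite measure, including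
  complements, whose indicator is that of the window minus that of A.\<close>

lemma test_closure_indicator:
  assumes "A \<in> sets borel"
  shows "(\<lambda>x. indicator (A \<inter> {-N..N}) x :: real) \<in> test_closure p"
  using assms
proof (induction rule: borel_set_induct)
  case empty
  then show ?case using test_closure_zero by simp
next
  case (interval a b)
  have "{a..b} \<inter> {-N..N} = {max a (-N)..min b N}" by auto
  then show ?case using test_closure_interval by simp
next
  case (compl A)
  have "(\<lambda>x. 1 * indicator {-N..N} x + (-1) * indicator (A \<inter> {-N..N}) x :: real) \<in> test_closure p"
    by (rule test_closure_comb[OF test_closure_interval compl.IH])
  moreover have "(\<lambda>x. 1 * indicator {-N..N} x + (-1) * indicator (A \<inter> {-N..N}) x :: real) = indicator (- A \<inter> {-N..N})"
    by (auto simp: indicator_def fun_eq_iff)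
  ultimately show ?case by simp
next
  case (union f)
  show ?case
  proof (rule test_closure_dominated[OF indicator_interval_Lp[of "-N" N]])
    have eq: "(\<lambda>x. indicator ((\<Union>i<n. f i) \<inter> {-N..N}) x) = (\<lambda>x. \<Sum>i<n. indicator (f i \<inter> {-N..N}) x :: real)" for n
    proof -
      have "(\<Union>i<n. f i) \<inter> {-N..N} = (\<Union>i<n. f i \<inter> {-N..N})" by auto
      moreover have "disjoint_family_on (\<lambda>i. f i \<inter> {-N..N}) {..<n}"
        using union.hyps(1) by (auto simp: disjoint_family_on_def)
      ultimately show ?thesis by (simp only: indicator_UN_disjoint finite_lessThan)
    qed
    show "(\<lambda>x. indicator ((\<Union>i<n. f i) \<inter> {-N..N}) x :: real) \<in> test_closure p" for n
      unfolding eq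
    proof (induction n)
      case 0
      then show ?case using test_closure_comb[OF union.IH union.IH, of 0 0 0 0] by simp
    next
      case (Suc n)
      then show ?case using test_closure_comb[OF Suc union.IH[of n], of 1 1] by simp
    qed
    show "(\<lambda>x. indicator (\<Union> (range f) \<inter> {- N..N}) x :: real) \<in> borel_measurable borel"
      using union.hyps by measurable
    show "AE x in lborel. (\<lambda>n. indicator ((\<Union>i<n. f i) \<inter> {-N..N}) x) \<longlonglongrightarrow> (indicator (\<Union> (range f) \<inter> {- N..N}) x :: real)"
    proof (intro AE_I2)
      fix x
      show "(\<lambda>n. indicator ((\<Union>i<n. f i) \<inter> {-N..N}) x) \<longlonglongrightarrow> (indicator (\<Union> (range f) \<inter> {- N..N}) x :: real)"
      proof (cases "x \<in> \<Union> (range f)")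
        case True
        then obtain i where i: "x \<in> f i" by auto
        show ?thesis
          by (rule tendsto_eventually) (rule eventually_mono[OF eventually_gt_at_top[of i]], use i in \<open>auto simp: indicator_def\<close>)
      qed (auto simp: indicator_def)
    qed
  qed (auto simp: indicator_def)
qed

lemma test_closure_Lp: assumes u: "u \<in> Lp p" shows "u \<in> test_closure p"
proof -
  have [measurable]: "u \<in> borel_measurable borel" using u by (rule Lp_measurable)
  \<comment> \<open>The bound by 2 * |u| makes one multiple of |u| dominate all approximants, and
    also their cut-offs to bounded windows.\<close>
  obtain F where F: "\<And>i. simple_function borel (F i)" "\<And>x. (\<lambda>i. F i x) \<longlonglongrightarrow> u x" "\<And>i x. \<bar>F i x\<bar> \<le> 2 * \<bar>u x\<bar>"
    using borel_measurable_implies_sequence_metric[of u borel 0] by (auto simp: dist_norm)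
  have [measurable]: "F i \<in> borel_measurable borel" for i using F(1) by (rule borel_measurable_simple_function)
  have ug: "(\<lambda>x. 2 * \<bar>u x\<bar>) \<in> Lp p" by (intro scale_mem Lp_abs u)
  have FN: "(\<lambda>x. F i x * indicator {-N..N} x) \<in> test_closure p" for i N
  proof -
    have fin: "finite (range (F i))" using F(1)[of i] by (simp add: simple_function_def)
    have "(\<lambda>x. \<Sum>y\<in>Y. y * indicator ((F i -` {y}) \<inter> {-N..N}) x) \<in> test_closure p" if "finite Y" for Y
      using that
    proof (induction Y)
      case empty
      show ?case using test_closure_comb[OF test_closure_indicator[of "{}"] test_closure_indicator[of "{}"], of 0 0 0 0] by simp
    next
      case (insert y Y)
      have "F i -` {y} \<in> sets borel" using measurable_sets[of "F i" borel borel "{y}"] by simp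
      from test_closure_comb[OF test_closure_indicator[OF this, of N] insert.IH, of y 1]
      show ?case using insert.hyps by (simp only: sum.insert mult_1 not_False_eq_True)
    qed
    from this[OF fin] have "(\<lambda>x. \<Sum>y\<in>range (F i). y * indicator ((F i -` {y}) \<inter> {-N..N}) x) \<in> test_closure p" .
    moreover have "(\<Sum>y\<in>range (F i). y * indicator ((F i -` {y}) \<inter> {-N..N}) x) = F i x * indicator {-N..N} x" for x
    proof -
      have "(\<Sum>y\<in>range (F i). y * indicator ((F i -` {y}) \<inter> {-N..N}) x) = (\<Sum>y\<in>range (F i). if y = F i x then F i x * indicator {-N..N} x else 0)"
        by (intro sum.cong) (auto simp: indicator_def)
      then show ?thesis using fin by simp
    qed
    ultimately show ?thesis by simp
  qed
  have Fc: "F i \<in> test_closure p" for i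
  proof (rule test_closure_dominated[OF ug FN[of i "real _"]])
    show "AE x in lborel. \<bar>F i x * indicator {- real n..real n} x\<bar> \<le> 2 * \<bar>u x\<bar>" for n
      using F(3)[of i] by (auto simp: indicator_def)
    show "AE x in lborel. (\<lambda>n. F i x * indicator {- real n..real n} x) \<longlonglongrightarrow> F i x"
    proof (intro AE_I2 tendsto_eventually)
      fix x :: real
      obtain m where m: "\<bar>x\<bar> \<le> real m" using real_arch_simple by blast
      show "\<forall>\<^sub>F n in sequentially. F i x * indicator {- real n..real n} x = F i x"
        using eventually_ge_at_top[of m] by eventually_elim (use m in \<open>auto simp: indicator_def\<close>)
    qed
  qed auto
  show ?thesis
    by (rule test_closure_dominated[OF ug, of F]) (use F Fc in auto)
qed

end

lemma test_fun_dense: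
  assumes "1 \<le> p" "u \<in> Lp p" "0 < e"
  obtains \<phi> where "test_fun \<phi>" "Lp_norm p (\<lambda>x. u x - \<phi> x) < e"
  using test_closure_Lp[OF assms(1,2)] assms(3) unfolding test_closure_def by blast

text \<open>The fundamental lemma of the calculus of variations for locally integrable h. Bump
  functions increase to the indicator of an open interval, so h has integral zero over intervals,
  then over Borel sets inside a window.\<close>

lemma test_fun_orthogonal_zero:
  fixes h :: "real \<Rightarrow> real"
  assumes [measurable]: "h \<in> borel_measurable borel"
    and i: "\<And>\<phi>. test_fun \<phi> \<Longrightarrow> integrable lborel (\<lambda>x. h x * \<phi> x)"
    and z: "\<And>\<phi>. test_fun \<phi> \<Longrightarrow> (\<integral>x. h x * \<phi> x \<partial>lborel) = 0"
  shows "AE x in lborel. h x = 0"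
proof -
  have hi: "integrable lborel (\<lambda>x. h x * indicator {a..b} x)" for a b
  proof (rule Bochner_Integration.integrable_bound)
    \<comment> \<open>\<open>bump_ge\<close> requires strict inequalities, so the closed interval is
      first enlarged by 1 to an open one and then by 1 once more.\<close>
    let ?b = "bump (a - 1 - 1) (b + 1 + 1) 1"
    show "integrable lborel (\<lambda>x. exp 1 * (h x * (if a \<le> b then ?b x else 0)))"
    proof (cases "a \<le> b")
      case True
      then show ?thesis using i[OF bump_test[of 1 "a - 1 - 1" "b + 1 + 1"]] by simp
    qed simp
    show "AE x in lborel. norm (h x * indicator {a..b} x) \<le> norm (exp 1 * (h x * (if a \<le> b then ?b x else 0)))"
    proof (intro AE_I2)
      fix x
      have "\<bar>h x\<bar> * 1 \<le> exp 1 * (\<bar>h x\<bar> * ?b x)" if "a \<le> x" "x \<le> b"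
      proof -
        have "exp 1 * exp (-1) \<le> exp 1 * ?b x" using bump_ge[of "a - 1" x "b + 1"] that by (intro mult_left_mono) auto
        then have "1 \<le> exp 1 * ?b x" by (simp flip: exp_add)
        then have "\<bar>h x\<bar> * 1 \<le> \<bar>h x\<bar> * (exp 1 * ?b x)" by (intro mult_left_mono) auto
        then show ?thesis by (simp add: mult_ac)
      qed
      then show "norm (h x * indicator {a..b} x) \<le> norm (exp 1 * (h x * (if a \<le> b then ?b x else 0)))"
        using bump_bounds(1)[of 1 "a - 1 - 1" "b + 1 + 1" x] by (auto simp: indicator_def abs_mult)
    qed
  qed simp
  have int0: "(\<integral>x. h x * indicator {a..b} x \<partial>lborel) = 0" for a b
  proof (cases "a < b")
    case True
    have "(\<lambda>n. \<integral>x. h x * bump a b (1 / Suc n) x \<partial>lborel) \<longlonglongrightarrow> (\<integral>x. h x * indicator {a..b} x \<partial>lborel)"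
    proof (rule integral_dominated_convergence)
      show "integrable lborel (\<lambda>x. \<bar>h x * indicator {a..b} x\<bar>)" using hi by simp
      show "(\<lambda>x. h x * bump a b (1 / Suc n) x) \<in> borel_measurable lborel" for n
        using test_fun_measurable[OF bump_test[of "1 / Suc n" a b]] True by simp
      show "AE x in lborel. norm (h x * bump a b (1 / Suc n) x) \<le> \<bar>h x * indicator {a..b} x\<bar>" for n
        by (intro AE_I2) (auto simp: indicator_def bump_def abs_mult intro!: mult_left_le)
      have "AE x in lborel. x \<noteq> a" "AE x in lborel. x \<noteq> b" by (rule AE_lborel_singleton)+
      then show "AE x in lborel. (\<lambda>n. h x * bump a b (1 / Suc n) x) \<longlonglongrightarrow> h x * indicator {a..b} x"
      proof eventually_elim
        case (elim x)
        then have "indicator {a..b} x = (indicator {a<..<b} x :: real)" by (auto simp: indicator_def)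
        then show ?case using bump_lim by (intro tendsto_mult_left) simp
      qed
    qed simp
    moreover have "(\<integral>x. h x * bump a b (1 / Suc n) x \<partial>lborel) = 0" for n
      by (intro z bump_test) (use True in auto)
    ultimately show ?thesis using LIMSEQ_unique[OF _ tendsto_const] by force
  next
    case False
    have ae: "AE x in lborel. h x * indicator {a..b} x = 0"
      using AE_lborel_singleton[of a] by eventually_elim (use False in \<open>auto simp: indicator_def\<close>)
    show ?thesis using integral_cong_AE[OF _ _ ae] by simp
  qed
  have "AE x in lborel. h x * indicator {-N..N} x = 0" for N
  \<comment> \<open>The rule compares globally integrable densities, whereas h is only locally
    integrable; hence the restriction to windows, removed at the end by countable
    intersection.\<close>
  proof (rule density_unique_real)
    show "integrable lborel (\<lambda>x. h x * indicator {-N..N} x)" by (rule hi)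
    show "integrable lborel (\<lambda>x::real. 0::real)" by simp
    fix A :: "real set" assume "A \<in> sets lborel"
    then have "A \<in> sets borel" by simp
    then have "(\<integral>x. h x * indicator (A \<inter> {-N..N}) x \<partial>lborel) = 0"
    proof (induction rule: borel_set_induct)
      case (interval a b)
      have eq: "{a..b} \<inter> {-N..N} = {max a (-N)..min b N}" by auto
      show ?case unfolding eq by (rule int0)
    next
      case (compl A)
      have iA: "integrable lborel (\<lambda>x. h x * indicator (A \<inter> {-N..N}) x)"
        using integrable_mult_indicator[OF _ hi, of A "-N" N] compl.hyps by (simp add: indicator_inter_arith mult_ac)
      have "(\<integral>x. h x * indicator (- A \<inter> {-N..N}) x \<partial>lborel) = (\<integral>x. h x * indicator {-N..N} x - h x * indicator (A \<inter> {-N..N}) x \<partial>lborel)"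
        by (rule Bochner_Integration.integral_cong) (auto simp: indicator_def)
      also have "\<dots> = 0" using compl.IH int0 hi iA by simp
      finally show ?case .
    next
      case (union f)
      have [measurable]: "f i \<in> sets borel" for i by (rule union.hyps)
      have iA: "integrable lborel (\<lambda>x. h x * indicator (A \<inter> {-N..N}) x)" if "A \<in> sets borel" for A
        using integrable_mult_indicator[OF _ hi, of A "-N" N] that by (simp add: indicator_inter_arith mult_ac)
      have "(\<lambda>n. \<integral>x. (\<Sum>i<n. h x * indicator (f i \<inter> {-N..N}) x) \<partial>lborel) \<longlonglongrightarrow> (\<integral>x. h x * indicator (\<Union>(range f) \<inter> {-N..N}) x \<partial>lborel)"
      proof (rule integral_dominated_convergence)
        show "integrable lborel (\<lambda>x. \<bar>h x * indicator {-N..N} x\<bar>)" using hi by simp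
        have eq: "(\<Sum>i<n. h x * indicator (f i \<inter> {-N..N}) x) = h x * indicator ((\<Union>i<n. f i) \<inter> {-N..N}) x" for n x
        proof -
          have "(\<Union>i<n. f i) \<inter> {-N..N} = (\<Union>i<n. f i \<inter> {-N..N})" by auto
          moreover have "indicator (\<Union>i<n. f i \<inter> {-N..N}) x = (\<Sum>i<n. indicator (f i \<inter> {-N..N}) x :: real)"
            using union.hyps(1) by (intro indicator_UN_disjoint) (auto simp: disjoint_family_on_def)
          ultimately show ?thesis by (simp add: sum_distrib_left)
        qed
        show "AE x in lborel. norm (\<Sum>i<n. h x * indicator (f i \<inter> {-N..N}) x) \<le> \<bar>h x * indicator {-N..N} x\<bar>" for n
          unfolding eq by (auto simp: indicator_def)
        show "AE x in lborel. (\<lambda>n. \<Sum>i<n. h x * indicator (f i \<inter> {-N..N}) x) \<longlonglongrightarrow> h x * indicator (\<Union>(range f) \<inter> {-N..N}) x"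
        proof (intro AE_I2)
          fix x
          have "(\<lambda>i. indicator (f i) x :: real) sums indicator (\<Union>(range f)) x"
            by (rule indicator_sums) (use union.hyps(1) in \<open>auto simp: disjoint_family_on_def\<close>)
          from sums_mult[OF this, of "h x * indicator {-N..N} x"]
          show "(\<lambda>n. \<Sum>i<n. h x * indicator (f i \<inter> {-N..N}) x) \<longlonglongrightarrow> h x * indicator (\<Union>(range f) \<inter> {-N..N}) x"
            by (simp add: sums_def indicator_inter_arith mult_ac)
        qed
      qed simp_all
      moreover have "(\<integral>x. (\<Sum>i<n. h x * indicator (f i \<inter> {-N..N}) x) \<partial>lborel) = 0" for n
        by (subst Bochner_Integration.integral_sum) (auto simp: iA union.IH)
      ultimately show ?case using LIMSEQ_unique[OF _ tendsto_const] by force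
    qed simp
    then show "(\<integral>x\<in>A. h x * indicator {-N..N} x \<partial>lborel) = (\<integral>x\<in>A. 0 \<partial>lborel)"
      by (simp add: set_lebesgue_integral_def indicator_inter_arith mult_ac)
  qed
  then have "AE x in lborel. \<forall>n::nat. h x * indicator {-real n..real n} x = 0"
    unfolding AE_all_countable by blast
  then show ?thesis
  proof eventually_elim
    case (elim x)
    obtain m where "\<bar>x\<bar> \<le> real m" using real_arch_simple by blast
    then show ?case using elim[rule_format, of m] by (auto simp: indicator_def split: if_splits)
  qed
qed

section \<open>Regularity of W^s_p\<close>

definition avg :: "(real \<Rightarrow> real) \<Rightarrow> real \<Rightarrow> real \<Rightarrow> real" where
  "avg g a b = (\<integral>t. indicator {a..b} t * g t \<partial>lborel) / (b - a)"

lemma Lp_integrable_interval: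
  assumes p: "1 \<le> p" and g: "g \<in> Lp p"
  shows "integrable lborel (\<lambda>t. indicator {a..b} t * g t)"
proof -
  have [measurable]: "g \<in> borel_measurable borel" using g by (rule Lp_measurable)
  have i: "integrable lborel (indicator {a..b} :: real \<Rightarrow> real)"
    by (intro integrable_real_indicator) (auto simp: emeasure_lborel_Icc_eq)
  have i2: "integrable lborel (\<lambda>t. indicator {a..b} t * \<bar>g t\<bar> powr p)"
    using integrable_mult_indicator[OF _ Lp_integrable[OF g], of "{a..b}"] by simp
  have "integrable lborel (\<lambda>t. indicator {a..b} t * \<bar>g t\<bar>)"
    by (rule weighted_jensen(1)[OF p i _ _ _ i2]) auto
  then show ?thesis by (rule Bochner_Integration.integrable_bound) (auto simp: indicator_def)
qed

text \<open>Jensen with the indicator of the interval as weight. The form with nonnegative integrals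
  allows c to be replaced by g x and the inequality to be integrated once more in x without any
  integrability check.\<close>

lemma avg_diff_le:
  assumes p: "1 \<le> p" and g: "g \<in> Lp p" and ab: "a < b"
  shows "ennreal ((b - a) * \<bar>avg g a b - c\<bar> powr p) \<le> (\<integral>\<^sup>+t. ennreal (indicator {a..b} t * \<bar>g t - c\<bar> powr p) \<partial>lborel)"
proof -
  have p0: "0 < p" using p by simp
  have gm[measurable]: "g \<in> borel_measurable borel" using g by (rule Lp_measurable)
  have i: "integrable lborel (indicator {a..b} :: real \<Rightarrow> real)"
    by (intro integrable_real_indicator) (auto simp: emeasure_lborel_Icc_eq)
  have I: "(\<integral>t. indicator {a..b} t \<partial>lborel) = b - a" using ab by simp
  define h where "h t = indicator {a..b} t * (g t - c)" for t
  have h: "h \<in> Lp p"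
  proof -
    have "(\<lambda>t. indicator {a..b} t * g t) \<in> Lp p"
      by (rule Lp_mono(1)[OF p0 g]) (auto simp: indicator_def)
    moreover have "(\<lambda>t. c * indicator {a..b} t) \<in> Lp p"
      by (rule bounded_support_Lp[of _ "\<bar>c\<bar>" "max \<bar>a\<bar> \<bar>b\<bar>"]) (use p in \<open>auto simp: indicator_def\<close>)
    ultimately have "(\<lambda>t. indicator {a..b} t * g t - c * indicator {a..b} t) \<in> Lp p" by (rule Lp_diff[OF p])
    then show ?thesis by (simp add: h_def[abs_def] algebra_simps)
  qed
  have ih: "integrable lborel (\<lambda>t. indicator {a..b} t * \<bar>g t - c\<bar> powr p)"
    by (rule integrable_cong_AE_imp[OF Lp_integrable[OF h]]) (use p in \<open>auto simp: h_def indicator_def\<close>)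
  have ih1: "integrable lborel (\<lambda>t. indicator {a..b} t * \<bar>g t - c\<bar>)"
    by (rule weighted_jensen(1)[OF p i _ _ _ ih]) auto
  have j: "(\<integral>t. indicator {a..b} t * \<bar>g t - c\<bar> \<partial>lborel) powr p \<le> (b - a) powr (p - 1) * (\<integral>t. indicator {a..b} t * \<bar>g t - c\<bar> powr p \<partial>lborel)"
    using weighted_jensen(2)[OF p i _ _ _ ih] I by simp
  have "avg g a b - c = (\<integral>t. indicator {a..b} t * g t - c * indicator {a..b} t \<partial>lborel) / (b - a)"
    using ab Lp_integrable_interval[OF p g, of a b] i by (simp add: avg_def field_simps)
  also have "(\<integral>t. indicator {a..b} t * g t - c * indicator {a..b} t \<partial>lborel) = (\<integral>t. indicator {a..b} t * (g t - c) \<partial>lborel)"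
    by (rule Bochner_Integration.integral_cong) (auto simp: algebra_simps)
  finally have "\<bar>avg g a b - c\<bar> = \<bar>\<integral>t. indicator {a..b} t * (g t - c) \<partial>lborel\<bar> / (b - a)"
    using ab by simp
  also have "\<dots> \<le> (\<integral>t. indicator {a..b} t * \<bar>g t - c\<bar> \<partial>lborel) / (b - a)"
    using ab integral_abs_bound[of lborel "\<lambda>t. indicator {a..b} t * (g t - c)"]
    by (intro divide_right_mono) (simp_all add: abs_mult)
  finally have "\<bar>avg g a b - c\<bar> powr p \<le> ((\<integral>t. indicator {a..b} t * \<bar>g t - c\<bar> \<partial>lborel) / (b - a)) powr p"
    using p by (intro powr_mono2) auto
  also have "\<dots> = (\<integral>t. indicator {a..b} t * \<bar>g t - c\<bar> \<partial>lborel) powr p / (b - a) powr p"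
    using ab by (simp add: powr_divide)
  also have "\<dots> \<le> ((b - a) powr (p - 1) * (\<integral>t. indicator {a..b} t * \<bar>g t - c\<bar> powr p \<partial>lborel)) / (b - a) powr p"
    using j by (intro divide_right_mono) auto
  also have "(b - a) powr p = (b - a) * (b - a) powr (p - 1)"
    using ab by (simp add: powr_mult_base)
  also have "((b - a) powr (p - 1) * (\<integral>t. indicator {a..b} t * \<bar>g t - c\<bar> powr p \<partial>lborel)) / ((b - a) * (b - a) powr (p - 1))
     = (\<integral>t. indicator {a..b} t * \<bar>g t - c\<bar> powr p \<partial>lborel) / (b - a)"
    using ab by simp
  finally have "(b - a) * \<bar>avg g a b - c\<bar> powr p \<le> (\<integral>t. indicator {a..b} t * \<bar>g t - c\<bar> powr p \<partial>lborel)"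
    using ab by (simp add: pos_le_divide_eq mult.commute)
  then have "ennreal ((b - a) * \<bar>avg g a b - c\<bar> powr p) \<le> ennreal (\<integral>t. indicator {a..b} t * \<bar>g t - c\<bar> powr p \<partial>lborel)"
    by (rule ennreal_leI)
  also have "\<dots> = (\<integral>\<^sup>+t. ennreal (indicator {a..b} t * \<bar>g t - c\<bar> powr p) \<partial>lborel)"
    by (rule nn_integral_eq_integral[OF ih, symmetric]) auto
  finally show ?thesis .
qed

lemma geometric_cauchy:
  fixes a :: "nat \<Rightarrow> real"
  assumes r: "0 \<le> r" "r < 1" and a: "\<And>k. \<bar>a k - a (Suc k)\<bar> \<le> C * r ^ k"
  shows "a \<longlonglongrightarrow> lim a" "\<bar>lim a - a k\<bar> \<le> C * r ^ k / (1 - r)"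
proof -
  have sg: "summable (\<lambda>k. C * r ^ k)" using r by (intro summable_mult summable_geometric) auto
  have sd: "summable (\<lambda>k. a k - a (Suc k))"
    by (rule summable_comparison_test[OF _ sg]) (use a in auto)
  have "(\<lambda>n. a 0 - (\<Sum>k<n. a k - a (Suc k))) \<longlonglongrightarrow> a 0 - (\<Sum>k. a k - a (Suc k))"
    by (intro tendsto_intros summable_LIMSEQ sd)
  moreover have "(\<Sum>k<n. a k - a (Suc k)) = a 0 - a n" for n by (induction n) auto
  ultimately have "convergent a" by (auto simp: convergent_def)
  then show l: "a \<longlonglongrightarrow> lim a" by (simp add: convergent_LIMSEQ_iff)
  have b: "\<bar>a (k + m) - a k\<bar> \<le> C * r ^ k * ((1 - r ^ m) / (1 - r))" for m
  proof (induction m)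
    case (Suc m)
    have "\<bar>a (k + Suc m) - a k\<bar> \<le> \<bar>a (k + m) - a k\<bar> + \<bar>a (k + m) - a (Suc (k + m))\<bar>" by simp
    also have "\<dots> \<le> C * r ^ k * ((1 - r ^ m) / (1 - r)) + C * r ^ (k + m)" by (intro add_mono Suc a)
    also have "\<dots> = C * r ^ k * ((1 - r ^ m) / (1 - r) + r ^ m)" by (simp add: algebra_simps power_add)
    also have "(1 - r ^ m) / (1 - r) + r ^ m = (1 - r ^ Suc m) / (1 - r)" using r by (simp add: field_simps)
    finally show ?case .
  qed simp
  have C0: "0 \<le> C" using a[of 0] abs_ge_zero[of "a 0 - a (Suc 0)"] by simp
  have b': "\<bar>a (k + m) - a k\<bar> \<le> C * r ^ k / (1 - r)" for m
  proof -
    have "C * r ^ k * ((1 - r ^ m) / (1 - r)) \<le> C * r ^ k * (1 / (1 - r))"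
      using r C0 by (intro mult_left_mono divide_right_mono) auto
    then show ?thesis using b[of m] by simp
  qed
  have "(\<lambda>m. \<bar>a (m + k) - a k\<bar>) \<longlonglongrightarrow> \<bar>lim a - a k\<bar>"
    by (intro tendsto_intros LIMSEQ_ignore_initial_segment l)
  then show "\<bar>lim a - a k\<bar> \<le> C * r ^ k / (1 - r)"
    by (rule LIMSEQ_le_const2) (use b' in \<open>auto simp: add.commute\<close>)
qed

text \<open>The Campanato form of the Sobolev embedding: the averages over \<open>[x, x + 2\<^sup>-\<^sup>k]\<close> converge
  geometrically, at the rate \<open>\<sigma> - 1/p\<close>.\<close>
lemma slobodeckij_holder:
  fixes g :: "real \<Rightarrow> real" and p \<sigma> :: real
  assumes p: "1 \<le> p" and g: "g \<in> Lp p" and s: "1 / p < \<sigma>"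
    and fin: "(\<integral>\<^sup>+ x. \<integral>\<^sup>+ y. ennreal (\<bar>g x - g y\<bar> powr p / \<bar>x - y\<bar> powr (1 + \<sigma> * p)) \<partial>lborel \<partial>lborel) < \<infinity>"
  obtains G H L where "ae_eq g G" "0 \<le> H" "\<And>x y. \<bar>x - y\<bar> \<le> 1 \<Longrightarrow> \<bar>G x - G y\<bar> \<le> H * \<bar>x - y\<bar> powr (\<sigma> - 1 / p)"
    "\<And>x. \<bar>G x\<bar> \<le> L" "G \<in> borel_measurable borel"
proof -
  have p0: "0 < p" using p by simp
  have gm[measurable]: "g \<in> borel_measurable borel" using g by (rule Lp_measurable)
  define \<gamma> where "\<gamma> = \<sigma> - 1 / p"
  have \<gamma>: "0 < \<gamma>" using s by (simp add: \<gamma>_def)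
  define \<theta> where "\<theta> = 1 + \<sigma> * p"
  \<comment> \<open>Of the exponent in the seminorm, \<gamma> * p is the Hoelder gain; the 2 pays
    for averaging over both variables.\<close>
  have \<theta>: "\<theta> = \<gamma> * p + 2" using p by (simp add: \<theta>_def \<gamma>_def field_simps)
  obtain E where E: "0 \<le> E" "(\<integral>\<^sup>+ x. \<integral>\<^sup>+ y. ennreal (\<bar>g x - g y\<bar> powr p / \<bar>x - y\<bar> powr \<theta>) \<partial>lborel \<partial>lborel) = ennreal E"
    using fin unfolding \<theta>_def[symmetric]
    by (cases "\<integral>\<^sup>+ x. \<integral>\<^sup>+ y. ennreal (\<bar>g x - g y\<bar> powr p / \<bar>x - y\<bar> powr \<theta>) \<partial>lborel \<partial>lborel" rule: ennreal_cases) auto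
  \<comment> \<open>On pairs at distance at most l, the denominator of the seminorm is at most l
    powr \<theta>, so unweighted p-th differences over such pairs are controlled by the
    seminorm.\<close>
  have dbl: "(\<integral>\<^sup>+x. \<integral>\<^sup>+t. ennreal (indicator S x * (indicator (T x) t * \<bar>g t - g x\<bar> powr p)) \<partial>lborel \<partial>lborel) \<le> ennreal (l powr \<theta> * E)"
    if l: "0 < l" and near: "\<And>x t. x \<in> S \<Longrightarrow> t \<in> T x \<Longrightarrow> \<bar>t - x\<bar> \<le> l" for S :: "real set" and T :: "real \<Rightarrow> real set" and l
  proof -
    have "(\<integral>\<^sup>+x. \<integral>\<^sup>+t. ennreal (indicator S x * (indicator (T x) t * \<bar>g t - g x\<bar> powr p)) \<partial>lborel \<partial>lborel)
       \<le> (\<integral>\<^sup>+x. \<integral>\<^sup>+t. ennreal (l powr \<theta>) * ennreal (\<bar>g x - g t\<bar> powr p / \<bar>x - t\<bar> powr \<theta>) \<partial>lborel \<partial>lborel)"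
    proof (intro nn_integral_mono)
      fix x t
      have "indicator S x * (indicator (T x) t * \<bar>g t - g x\<bar> powr p) \<le> l powr \<theta> * (\<bar>g x - g t\<bar> powr p / \<bar>x - t\<bar> powr \<theta>)"
      proof (cases "x \<in> S \<and> t \<in> T x \<and> t \<noteq> x")
        case True
        have "0 < \<theta>" using \<theta> \<gamma> p by (simp add: add_pos_pos)
        then have "\<bar>x - t\<bar> powr \<theta> \<le> l powr \<theta>" using near[of x t] True by (intro powr_mono2) auto
        then have "\<bar>g x - g t\<bar> powr p * \<bar>x - t\<bar> powr \<theta> \<le> \<bar>g x - g t\<bar> powr p * l powr \<theta>"
          by (intro mult_left_mono) auto
        moreover have "0 < \<bar>x - t\<bar> powr \<theta>" using True by simp
        ultimately have "\<bar>g x - g t\<bar> powr p \<le> l powr \<theta> * (\<bar>g x - g t\<bar> powr p / \<bar>x - t\<bar> powr \<theta>)"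
          by (simp add: pos_le_divide_eq mult.commute)
        then show ?thesis using True by (simp add: abs_minus_commute)
      next
        case False
        then have "indicator S x * (indicator (T x) t * \<bar>g t - g x\<bar> powr p) = 0" using p0 by (auto simp: indicator_def)
        then show ?thesis by (simp only: zero_le_mult_iff zero_le_divide_iff powr_ge_zero) simp
      qed
      then show "ennreal (indicator S x * (indicator (T x) t * \<bar>g t - g x\<bar> powr p)) \<le> ennreal (l powr \<theta>) * ennreal (\<bar>g x - g t\<bar> powr p / \<bar>x - t\<bar> powr \<theta>)"
        by (simp add: ennreal_mult[symmetric] ennreal_leI)
    qed
    also have "\<dots> = ennreal (l powr \<theta>) * ennreal E"
      by (simp add: nn_integral_cmult E(2))
    finally show ?thesis using E(1) by (simp add: ennreal_mult)
  qed
  \<comment> \<open>Two subintervals of length at least l / 2 in an interval of length l: the double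
    average of |g t - g x| powr p is at most (2 / l)^2 * l powr \<theta> * E, which is 4 * E * l
    powr (\<gamma> * p).\<close>
  define C where "C = (4 * E) powr (1 / p)"
  have osc: "\<bar>avg g a1 b1 - avg g a2 b2\<bar> \<le> C * (b - a) powr \<gamma>"
    if I: "a \<le> a1" "a \<le> a2" "b1 \<le> b" "b2 \<le> b" "a < b" "(b - a) / 2 \<le> b1 - a1" "(b - a) / 2 \<le> b2 - a2" for a b a1 b1 a2 b2
  proof -
    define l where "l = b - a"
    have l: "0 < l" using I by (simp add: l_def)
    have pos: "a1 < b1" "a2 < b2" using I by auto
    define m where "m = \<bar>avg g a1 b1 - avg g a2 b2\<bar>"
    have "ennreal ((b1 - a1) * ((b2 - a2) * m powr p)) = ennreal (b1 - a1) * ennreal ((b2 - a2) * \<bar>avg g a2 b2 - avg g a1 b1\<bar> powr p)"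
      using pos by (simp add: ennreal_mult[symmetric] m_def abs_minus_commute)
    also have "\<dots> \<le> ennreal (b1 - a1) * (\<integral>\<^sup>+x. ennreal (indicator {a2..b2} x * \<bar>g x - avg g a1 b1\<bar> powr p) \<partial>lborel)"
      by (intro mult_left_mono avg_diff_le[OF p g pos(2)]) auto
    also have "\<dots> = (\<integral>\<^sup>+x. ennreal (indicator {a2..b2} x) * ennreal ((b1 - a1) * \<bar>avg g a1 b1 - g x\<bar> powr p) \<partial>lborel)"
      using pos by (subst nn_integral_cmult[symmetric])
        (auto simp: ennreal_mult[symmetric] mult_ac abs_minus_commute intro!: nn_integral_cong)
    also have "\<dots> \<le> (\<integral>\<^sup>+x. ennreal (indicator {a2..b2} x) * (\<integral>\<^sup>+t. ennreal (indicator {a1..b1} t * \<bar>g t - g x\<bar> powr p) \<partial>lborel) \<partial>lborel)"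
      by (intro nn_integral_mono mult_left_mono avg_diff_le[OF p g pos(1)]) auto
    also have "\<dots> = (\<integral>\<^sup>+x. \<integral>\<^sup>+t. ennreal (indicator {a2..b2} x * (indicator {a1..b1} t * \<bar>g t - g x\<bar> powr p)) \<partial>lborel \<partial>lborel)"
      by (simp add: nn_integral_cmult[symmetric] ennreal_mult[symmetric])
    also have "\<dots> \<le> ennreal (l powr \<theta> * E)"
      by (rule dbl[OF l]) (use I in \<open>auto simp: l_def\<close>)
    finally have "(b1 - a1) * ((b2 - a2) * m powr p) \<le> l powr \<theta> * E"
      using E(1) by (simp add: mult_nonneg_nonneg)
    moreover have "(l / 2) * ((l / 2) * m powr p) \<le> (b1 - a1) * ((b2 - a2) * m powr p)"
      using I pos l by (intro mult_mono mult_right_mono) (auto simp: l_def)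
    ultimately have "l * l * m powr p \<le> 4 * (l powr \<theta> * E)" by simp
    also have "l powr \<theta> = l powr (\<gamma> * p) * (l * l)" using l by (simp add: \<theta> powr_add power2_eq_square)
    finally have "(l * l) * m powr p \<le> (l * l) * (4 * E * l powr (\<gamma> * p))" by (simp add: mult_ac)
    then have "m powr p \<le> 4 * E * l powr (\<gamma> * p)" using l by simp
    then have "(m powr p) powr (1 / p) \<le> (4 * E * l powr (\<gamma> * p)) powr (1 / p)" using p by (intro powr_mono2) auto
    then show ?thesis using p E(1) by (simp add: powr_powr powr_mult C_def m_def l_def)
  qed
  have C0: "0 \<le> C" by (simp add: C_def)
  define h where "h k = (1 / 2 :: real) ^ k" for k :: nat
  have h: "0 < h k" "h (Suc k) = h k / 2" for k by (simp_all add: h_def)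
  define m where "m k x = avg g x (x + h k)" for k x
  define r where "r = (1 / 2 :: real) powr \<gamma>"
  have r: "0 < r" "r < 1" using powr_less_mono2[OF \<gamma>, of "1/2" 1] by (auto simp: r_def)
  have hr: "h k powr \<gamma> = r ^ k" for k
    unfolding h_def r_def by (simp add: powr_power powr_realpow[symmetric] powr_powr mult.commute)
  have m1: "\<bar>m k x - m (Suc k) x\<bar> \<le> C * r ^ k" for k x
    using osc[of x x x "x + h k" "x + h k" "x + h k / 2"] h(1)[of k] by (simp add: m_def hr h(2))
  define G where "G x = lim (\<lambda>k. m k x)" for x
  have Gl: "(\<lambda>k. m k x) \<longlonglongrightarrow> G x" and Gb: "\<bar>G x - m k x\<bar> \<le> C * r ^ k / (1 - r)" for x k
    unfolding G_def by (rule geometric_cauchy[OF _ r(2) m1]; use r in simp)+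
  have mm[measurable]: "m k \<in> borel_measurable borel" for k
  proof -
    have [measurable]: "(\<lambda>(x, t). if x \<le> t \<and> t \<le> x + h k then g t else 0) \<in> borel_measurable (borel \<Otimes>\<^sub>M borel)"
      by measurable
    have "m k = (\<lambda>x. (\<integral>t. (if x \<le> t \<and> t \<le> x + h k then g t else 0) \<partial>lborel) / h k)"
      by (auto simp: m_def avg_def indicator_def fun_eq_iff intro!: arg_cong[where f="\<lambda>x. x / h k"] Bochner_Integration.integral_cong)
    then show ?thesis by simp
  qed
  have Gm[measurable]: "G \<in> borel_measurable borel"
    by (rule borel_measurable_LIMSEQ_metric[OF mm Gl])
  \<comment> \<open>This identifies the pointwise limit G: the averages tend to g in
    \<open>L_p\<close> by the same double integral, so by Fatou G agrees with g almost
    everywhere.\<close>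
  have conv: "(\<integral>\<^sup>+x. ennreal (\<bar>m k x - g x\<bar> powr p) \<partial>lborel) \<le> ennreal (h k powr (\<gamma> * p + 1) * E)" for k
  proof -
    have "ennreal (h k) * (\<integral>\<^sup>+x. ennreal (\<bar>m k x - g x\<bar> powr p) \<partial>lborel) = (\<integral>\<^sup>+x. ennreal ((x + h k - x) * \<bar>avg g x (x + h k) - g x\<bar> powr p) \<partial>lborel)"
      using h(1)[of k] unfolding m_def[symmetric] by (subst nn_integral_cmult[symmetric]) (auto simp: ennreal_mult)
    also have "\<dots> \<le> (\<integral>\<^sup>+x. \<integral>\<^sup>+t. ennreal (indicator {x..x + h k} t * \<bar>g t - g x\<bar> powr p) \<partial>lborel \<partial>lborel)"
      by (intro nn_integral_mono avg_diff_le[OF p g]) (use h[of k] in simp)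
    also have "\<dots> \<le> ennreal (h k powr \<theta> * E)"
      using dbl[OF h(1)[of k], of UNIV "\<lambda>x. {x..x + h k}"] by simp
    also have "h k powr \<theta> * E = h k * (h k powr (\<gamma> * p + 1) * E)"
      using h(1)[of k] by (simp add: \<theta> powr_add power2_eq_square)
    also have "ennreal (h k * (h k powr (\<gamma> * p + 1) * E)) = ennreal (h k) * ennreal (h k powr (\<gamma> * p + 1) * E)"
      using h(1)[of k] E(1) by (intro ennreal_mult) auto
    finally show ?thesis using h(1)[of k] by (subst (asm) ennreal_mult_le_mult_iff) auto
  qed
  have "(\<integral>\<^sup>+x. ennreal (\<bar>G x - g x\<bar> powr p) \<partial>lborel) \<le> (\<integral>\<^sup>+x. liminf (\<lambda>k. ennreal (\<bar>m k x - g x\<bar> powr p)) \<partial>lborel)"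
  proof (rule nn_integral_mono)
    fix x
    have "(\<lambda>k. ennreal (\<bar>m k x - g x\<bar> powr p)) \<longlonglongrightarrow> ennreal (\<bar>G x - g x\<bar> powr p)"
      using p0 by (intro tendsto_ennrealI tendsto_powr2 tendsto_intros Gl) auto
    then have "liminf (\<lambda>k. ennreal (\<bar>m k x - g x\<bar> powr p)) = ennreal (\<bar>G x - g x\<bar> powr p)"
      by (rule lim_imp_Liminf[rotated]) simp
    then show "ennreal (\<bar>G x - g x\<bar> powr p) \<le> liminf (\<lambda>k. ennreal (\<bar>m k x - g x\<bar> powr p))" by simp
  qed
  also have "\<dots> \<le> liminf (\<lambda>k. \<integral>\<^sup>+x. ennreal (\<bar>m k x - g x\<bar> powr p) \<partial>lborel)"
    by (rule nn_integral_liminf) simp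
  also have "\<dots> \<le> liminf (\<lambda>k. ennreal (h k powr (\<gamma> * p + 1) * E))"
    by (intro Liminf_mono always_eventually allI conv)
  also have "\<dots> = ennreal (0 * E)"
  proof (rule lim_imp_Liminf)
    have "(\<lambda>k. h k powr (\<gamma> * p + 1)) \<longlonglongrightarrow> 0 powr (\<gamma> * p + 1)"
      unfolding h_def using \<gamma> p0 by (intro tendsto_powr2 tendsto_const LIMSEQ_power_zero) (auto simp: add_pos_pos)
    then show "(\<lambda>k. ennreal (h k powr (\<gamma> * p + 1) * E)) \<longlonglongrightarrow> ennreal (0 * E)"
      by (intro tendsto_ennrealI tendsto_mult tendsto_const) simp
  qed simp
  finally have "(\<integral>\<^sup>+x. ennreal (\<bar>G x - g x\<bar> powr p) \<partial>lborel) = 0" by simp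
  then have "AE x in lborel. ennreal (\<bar>G x - g x\<bar> powr p) = 0"
    by (subst (asm) nn_integral_0_iff_AE) auto
  then have ae: "ae_eq g G" unfolding ae_eq_def by eventually_elim (simp add: ennreal_eq_0_iff)
  define C' where "C' = C / (1 - r)"
  have C'0: "0 \<le> C'" using C0 r by (simp add: C'_def)
  \<comment> \<open>2 * C' comes from replacing G by its k-th average at x and at y, C * 2 powr
    \<gamma> from comparing these averages inside an interval of length 2 * h k, and the last factor
    from h k \<le> 2 * d.\<close>
  define H where "H = (2 * C' + C * 2 powr \<gamma>) * 2 powr \<gamma>"
  have H0: "0 \<le> H" using C0 C'0 by (simp add: H_def)
  have hol: "\<bar>G x - G y\<bar> \<le> H * (y - x) powr \<gamma>" if xy: "x < y" "y - x \<le> 1" for x y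
  proof -
    define d where "d = y - x"
    have d: "0 < d" "d \<le> 1" using xy by (auto simp: d_def)
    have ex: "\<exists>k. h k < d" unfolding h_def using d(1) by (rule real_arch_pow_inv) simp
    \<comment> \<open>The first dyadic scale below d. It is not 0 because h 0 = 1 \<ge> d, so the
      preceding scale k exists and satisfies d \<le> h k \<le> 2 * d.\<close>
    define K where "K = (LEAST k. h k < d)"
    have hK: "h K < d" unfolding K_def by (rule LeastI_ex[OF ex])
    have "K \<noteq> 0"
    proof
      assume "K = 0"
      then show False using hK d by (simp add: h_def)
    qed
    then obtain k where k: "K = Suc k" by (cases K) auto
    have dk: "d \<le> h k" using not_less_Least[of k "\<lambda>k. h k < d"] k by (force simp: K_def)
    have hd: "h k \<le> 2 * d" using hK k h(2)[of k] by simp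
    have "\<bar>m k x - m k y\<bar> \<le> C * (2 * h k) powr \<gamma>"
      using osc[of x x y "x + h k" "x + 2 * h k" "y + h k"] dk h(1)[of k] d by (simp add: m_def d_def)
    also have "\<dots> = C * 2 powr \<gamma> * r ^ k" using h(1)[of k] by (simp add: powr_mult hr)
    finally have 1: "\<bar>m k x - m k y\<bar> \<le> C * 2 powr \<gamma> * r ^ k" .
    have "\<bar>G x - G y\<bar> \<le> (2 * C' + C * 2 powr \<gamma>) * r ^ k"
      using Gb[of x k] Gb[of y k] 1 by (simp add: C'_def distrib_right)
    also have "\<dots> \<le> (2 * C' + C * 2 powr \<gamma>) * (2 * d) powr \<gamma>"
      unfolding hr[symmetric] using hd h(1)[of k] C0 C'0 \<gamma> by (intro mult_left_mono powr_mono2) auto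
    also have "\<dots> = H * d powr \<gamma>" using d by (simp add: H_def powr_mult)
    finally show ?thesis by (simp add: d_def)
  qed
  have hol': "\<bar>G x - G y\<bar> \<le> H * \<bar>x - y\<bar> powr (\<sigma> - 1 / p)" if "\<bar>x - y\<bar> \<le> 1" for x y
    using hol[of x y] hol[of y x] that H0 by (cases x y rule: linorder_cases) (auto simp: \<gamma>_def abs_minus_commute)
  have bd: "\<bar>G x\<bar> \<le> Lp_norm p g + C'" for x
  proof -
    have "ennreal (\<bar>m 0 x\<bar> powr p) \<le> (\<integral>\<^sup>+t. ennreal (indicator {x..x+1} t * \<bar>g t\<bar> powr p) \<partial>lborel)"
      using avg_diff_le[OF p g, of x "x + 1" 0] by (simp add: m_def h_def)
    also have "\<dots> \<le> (\<integral>\<^sup>+t. ennreal (\<bar>g t\<bar> powr p) \<partial>lborel)"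
      by (intro nn_integral_mono ennreal_leI) (auto simp: indicator_def)
    also have "\<dots> = ennreal (Lp_norm p g powr p)" by (rule Lp_nn[OF p0 g])
    finally have "\<bar>m 0 x\<bar> powr p \<le> Lp_norm p g powr p" by simp
    then have "\<bar>m 0 x\<bar> \<le> Lp_norm p g"
      using powr_less_mono2[OF p0 Lp_norm_ge0[of p g], of "\<bar>m 0 x\<bar>"] by linarith
    then show ?thesis using Gb[of x 0] by (simp add: C'_def)
  qed
  show ?thesis by (rule that[OF ae H0 hol' bd Gm])
qed

section \<open>Weak derivatives and continuously differentiable representatives\<close>

lemma antiderivative_UNIV:
  fixes g :: "real \<Rightarrow> real"
  assumes "\<And>x. isCont g x"
  obtains F where "\<And>x. (F has_real_derivative g x) (at x)"
  using einterval_antiderivative[of "-\<infinity>" "\<infinity>" g] assms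
  by (auto simp: has_real_derivative_iff_has_vector_derivative)

lemma integral_FTC_support:
  fixes f F :: "real \<Rightarrow> real"
  assumes "\<And>x. (F has_real_derivative f x) (at x)" "\<And>x. isCont f x" "0 < N" "\<And>x. N < \<bar>x\<bar> \<Longrightarrow> f x = 0"
  shows "(\<integral>x. f x \<partial>lborel) = F N - F (-N)"
proof -
  have "(\<integral>x. f x \<partial>lborel) = (\<integral>x. f x * indicator {-N..N} x \<partial>lborel)"
  proof (rule Bochner_Integration.integral_cong)
    fix x show "f x = f x * indicator {-N..N} x"
      using assms(4)[of x] by (cases "N < \<bar>x\<bar>") (auto simp: indicator_def)
  qed simp
  also have "\<dots> = F N - F (-N)" by (rule integral_FTC_Icc_real) (use assms in auto)
  finally show ?thesis .
qed

lemma integrable_continuous_support: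
  fixes f :: "real \<Rightarrow> real"
  assumes "\<And>x. isCont f x" "\<And>x. N < \<bar>x\<bar> \<Longrightarrow> f x = 0"
  shows "integrable lborel f"
proof -
  have c: "continuous_on UNIV f" using assms(1) by (simp add: continuous_at_imp_continuous_on)
  obtain K where K: "\<And>x. \<bar>f x\<bar> \<le> K" using continuous_compact_support_bounded[OF c assms(2)] by metis
  have "f \<in> Lp 1" by (rule bounded_support_Lp[OF borel_measurable_continuous_onI[OF c] K assms(2)]) auto
  then show ?thesis using integrable_abs_cancel[of lborel f] by (simp add: Lp_def)
qed

lemma test_fun_isCont: "test_fun \<phi> \<Longrightarrow> isCont \<phi> x" "test_fun \<phi> \<Longrightarrow> isCont (deriv \<phi>) x"
  using test_fun_continuous[of \<phi> UNIV] test_fun_deriv_cont[of \<phi> UNIV]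
  by (auto simp: continuous_on_eq_continuous_at)

text \<open>A primitive that vanishes to the left of the support vanishes to the right as well,
  because its total increment is the integral of \<eta>.\<close>

lemma test_fun_primitive:
  assumes e: "test_fun \<eta>" and z: "(\<integral>x. \<eta> x \<partial>lborel) = 0"
  obtains \<Phi> where "test_fun \<Phi>" "deriv \<Phi> = \<eta>"
proof -
  obtain N where N: "0 < N" "\<And>x. N < \<bar>x\<bar> \<Longrightarrow> \<eta> x = 0" using test_fun_support[OF e] by metis
  obtain P where P: "\<And>x. (P has_real_derivative \<eta> x) (at x)"
    using antiderivative_UNIV[OF test_fun_isCont(1)[OF e]] by metis
  define \<Phi> where "\<Phi> x = P x - P (-(N + 1))" for x
  have d: "(\<Phi> has_real_derivative \<eta> x) (at x)" for x
    unfolding \<Phi>_def by (auto intro!: derivative_eq_intros P)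
  have dd: "deriv \<Phi> = \<eta>" using d DERIV_imp_deriv by blast
  have PM: "P M = P (-M)" if "N < M" for M
    using integral_FTC_support[OF P test_fun_isCont(1)[OF e], of M] N that z by simp
  have Pl: "P x = P (-(N+1))" if "x < -N" for x
  proof -
    have "\<exists>c. \<forall>y\<in>{..<-N}. P y = c"
      by (rule has_field_derivative_zero_constant) (use N in \<open>auto intro!: has_field_derivative_at_within P[THEN DERIV_cong]\<close>)
    then show ?thesis using that by force
  qed
  have sup: "\<Phi> x = 0" if "N < \<bar>x\<bar>" for x
  proof (cases "x < 0")
    case True then show ?thesis using Pl[of x] that by (simp add: \<Phi>_def)
  next
    case False
    then have "P x = P (-x)" using PM that by simp
    then show ?thesis using Pl[of "-x"] that False by (simp add: \<Phi>_def)
  qed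
  have "test_fun \<Phi>" unfolding test_fun_def
  proof (intro conjI allI)
    fix n x show "(deriv ^^ n) \<Phi> differentiable at x"
    proof (cases n)
      case 0 then show ?thesis using d by (auto simp: real_differentiable_def)
    next
      case (Suc m)
      then have "(deriv ^^ n) \<Phi> = (deriv ^^ m) \<eta>" by (simp add: dd funpow_swap1)
      then show ?thesis using e by (simp add: test_fun_def)
    qed
    have "{x. \<Phi> x \<noteq> 0} \<subseteq> {-N..N}" using sup by (force simp: abs_le_iff not_less)
    then show "bounded {x. \<Phi> x \<noteq> 0}" using bounded_subset bounded_closed_interval by blast
  qed
  then show ?thesis using dd that by blast
qed

text \<open>Du Bois-Reymond: subtracting from \<phi> the multiple of a fixed bump \<rho> with the
  same integral leaves a derivative of a test function. Testing v against it shows that v - c is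
  orthogonal to every \<phi>, with c the \<rho>-weighted mean of v.\<close>

lemma weak_deriv_zero_const:
  assumes [measurable]: "v \<in> borel_measurable borel"
    and i: "\<And>\<phi>. test_fun \<phi> \<Longrightarrow> integrable lborel (\<lambda>x. v x * \<phi> x)"
    and z: "\<And>\<phi>. test_fun \<phi> \<Longrightarrow> (\<integral>x. v x * deriv \<phi> x \<partial>lborel) = 0"
  obtains c where "AE x in lborel. v x = c"
proof -
  define \<rho> where "\<rho> = bump 0 1 1"
  have rt: "test_fun \<rho>" unfolding \<rho>_def by (rule bump_test) auto
  have it: "integrable lborel \<phi>" if "test_fun \<phi>" for \<phi>
    using test_fun_support[OF that] integrable_continuous_support test_fun_isCont(1)[OF that] by metis
  define R where "R = (\<integral>x. \<rho> x \<partial>lborel)"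
  have "R \<noteq> 0"
  proof
    assume "R = 0"
    then have "AE x in lborel. \<rho> x = 0"
      unfolding R_def using it[OF rt] bump_bounds(1)[of 1 0 1] by (subst (asm) integral_nonneg_eq_0_iff_AE) (auto simp: \<rho>_def)
    then have "AE x in lborel. x \<notin> {0<..<1::real}" by eventually_elim (auto simp: \<rho>_def bump_def)
    then have "emeasure lborel {x \<in> space lborel. \<not> x \<notin> {0<..<1::real}} = 0" by (subst (asm) AE_iff_measurable[OF _ refl]) auto
    moreover have "{x \<in> space lborel. \<not> x \<notin> {0<..<1::real}} = {0<..<1}" by auto
    ultimately show False by (simp only: emeasure_lborel_Ioo) simp
  qed
  define c where "c = (\<integral>x. v x * \<rho> x \<partial>lborel) / R"
  have "AE x in lborel. v x - c = 0"
  proof (rule test_fun_orthogonal_zero)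
    fix \<phi> assume t: "test_fun \<phi>"
    show "integrable lborel (\<lambda>x. (v x - c) * \<phi> x)" using i[OF t] it[OF t] by (simp add: left_diff_distrib)
    define k where "k = (\<integral>x. \<phi> x \<partial>lborel) / R"
    have et: "test_fun (\<lambda>x. 1 * \<phi> x + (-k) * \<rho> x)" by (rule test_fun_comb[OF t rt])
    have "(\<integral>x. 1 * \<phi> x + (-k) * \<rho> x \<partial>lborel) = 0"
      using it[OF t] it[OF rt] \<open>R \<noteq> 0\<close> by (simp add: k_def R_def[symmetric])
    then obtain \<Phi> where "test_fun \<Phi>" "deriv \<Phi> = (\<lambda>x. 1 * \<phi> x + (-k) * \<rho> x)" using test_fun_primitive[OF et] by metis
    from z[OF this(1)] this(2) have "(\<integral>x. v x * (1 * \<phi> x + (-k) * \<rho> x) \<partial>lborel) = 0" by simp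
    moreover have "(\<integral>x. v x * (1 * \<phi> x + (-k) * \<rho> x) \<partial>lborel) = (\<integral>x. v x * \<phi> x - k * (v x * \<rho> x) \<partial>lborel)"
      by (rule Bochner_Integration.integral_cong) (auto simp: algebra_simps)
    ultimately have "(\<integral>x. v x * \<phi> x \<partial>lborel) - k * (\<integral>x. v x * \<rho> x \<partial>lborel) = 0"
      using i[OF t] i[OF rt] by simp
    then have "(\<integral>x. v x * \<phi> x \<partial>lborel) - c * (\<integral>x. \<phi> x \<partial>lborel) = 0"
      using \<open>R \<noteq> 0\<close> by (simp add: k_def c_def)
    then show "(\<integral>x. (v x - c) * \<phi> x \<partial>lborel) = 0" using i[OF t] it[OF t] by (simp add: left_diff_distrib)
  qed measurable
  then have "AE x in lborel. v x = c" by simp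
  then show ?thesis by (rule that)
qed

lemma holder_isCont:
  fixes G :: "real \<Rightarrow> real"
  assumes a: "0 < \<alpha>" and holder: "\<And>x y. \<bar>x - y\<bar> \<le> 1 \<Longrightarrow> \<bar>G x - G y\<bar> \<le> H * \<bar>x - y\<bar> powr \<alpha>"
  shows "isCont G x"
proof -
  have "((\<lambda>y. G y - G x) \<longlongrightarrow> 0) (at x)"
  proof (rule Lim_null_comparison)
    have "eventually (\<lambda>y. dist y x < 1) (at x)" by (auto simp: eventually_at intro!: exI[of _ 1])
    then show "eventually (\<lambda>y. norm (G y - G x) \<le> H * \<bar>y - x\<bar> powr \<alpha>) (at x)"
      by eventually_elim (use holder in \<open>auto simp: dist_real_def\<close>)
    have "((\<lambda>y. H * \<bar>y - x\<bar> powr \<alpha>) \<longlongrightarrow> H * \<bar>x - x\<bar> powr \<alpha>) (at x)"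
      using a by (intro tendsto_mult tendsto_powr2 tendsto_intros) auto
    then show "((\<lambda>y. H * \<bar>y - x\<bar> powr \<alpha>) \<longlongrightarrow> 0) (at x)" by simp
  qed
  then show ?thesis by (simp add: isCont_def LIM_zero_iff)
qed

text \<open>All that later arguments retain of the Sobolev class: the order s survives only in the
  Hoelder exponent \<alpha>, and f itself is replaced by its representative F. The symmetry under F
  to -F, used for the lower side of the graph, is visible in this list.\<close>

locale graph =
  fixes p L M H \<alpha> :: real and F G :: "real \<Rightarrow> real"
  assumes p: "1 < p" "p \<le> 2"
    and deriv_F: "\<And>x. (F has_real_derivative G x) (at x)"
    and G_bound: "\<And>x. \<bar>G x\<bar> \<le> L" and F_bound: "\<And>x. \<bar>F x\<bar> \<le> M"
    and alpha: "0 < \<alpha>" and H0: "0 \<le> H"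
    and holder: "\<And>x y. \<bar>x - y\<bar> \<le> 1 \<Longrightarrow> \<bar>G x - G y\<bar> \<le> H * \<bar>x - y\<bar> powr \<alpha>"
    and G_Lp: "G \<in> Lp p"
    and F_decay: "\<And>e. 0 < e \<Longrightarrow> \<exists>N. \<forall>x. N < \<bar>x\<bar> \<longrightarrow> \<bar>F x\<bar> < e"
begin

lemma isCont_F: "isCont F x" using DERIV_isCont deriv_F by blast

lemma L0: "0 \<le> L" using G_bound[of 0] by linarith
lemma M0: "0 \<le> M" using F_bound[of 0] by linarith

lemma F_lip: "\<bar>F x - F y\<bar> \<le> L * \<bar>x - y\<bar>"
  using field_differentiable_bound[of UNIV F G L x y] deriv_F G_bound by auto

end

lemma Lp_tail_zero:
  assumes p: "1 \<le> p" and g: "g \<in> Lp p"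
  shows "(\<lambda>n. Lp_norm p (\<lambda>x. indicator {x. real n < \<bar>x\<bar>} x * g x)) \<longlonglongrightarrow> 0"
proof -
  have [measurable]: "g \<in> borel_measurable borel" using g by (rule Lp_measurable)
  have "(\<lambda>n. Lp_norm p (\<lambda>x. indicator {x. real n < \<bar>x\<bar>} x * g x - 0)) \<longlonglongrightarrow> 0"
  proof (rule Lp_dominated(3)[OF p Lp_abs(1)[OF g]])
    show "AE x in lborel. (\<lambda>n. indicator {x. real n < \<bar>x\<bar>} x * g x) \<longlonglongrightarrow> 0"
    proof (intro AE_I2 tendsto_eventually)
      fix x :: real
      obtain m where m: "\<bar>x\<bar> \<le> real m" using real_arch_simple by blast
      show "\<forall>\<^sub>F n in sequentially. indicator {x. real n < \<bar>x\<bar>} x * g x = 0"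
        using eventually_ge_at_top[of m] by eventually_elim (use m in \<open>auto simp: indicator_def\<close>)
    qed
  qed (auto simp: indicator_def)
  then show ?thesis by simp
qed

text \<open>F x differs by at most L * h from its average over {x..x + h}, and that average is at
  most the \<open>L_p\<close> norm over any S containing the interval, divided by h powr (1 / p). S
  = UNIV with h = 1 gives boundedness; a tail S with small h gives decay.\<close>

lemma lipschitz_Lp_decay:
  assumes p: "1 \<le> p" and F: "F \<in> Lp p" and lip: "\<And>x y. \<bar>F x - F y\<bar> \<le> L * \<bar>x - y\<bar>"
  shows "\<bar>F x\<bar> \<le> L + Lp_norm p F" "0 < e \<Longrightarrow> \<exists>N. \<forall>x. N < \<bar>x\<bar> \<longrightarrow> \<bar>F x\<bar> < e"
proof -
  have p0: "0 < p" using p by simp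
  have [measurable]: "F \<in> borel_measurable borel" using F by (rule Lp_measurable)
  have L0: "0 \<le> L" using lip[of 0 1] by simp
  have key: "\<bar>F x\<bar> \<le> L * h + Lp_norm p (\<lambda>t. indicator S t * F t) / h powr (1/p)"
    if h: "0 < h" and S: "{x..x+h} \<subseteq> S" "S \<in> sets borel" for x h S
  proof -
    let ?T = "Lp_norm p (\<lambda>t. indicator S t * F t)"
    have SL: "(\<lambda>t. indicator S t * F t) \<in> Lp p"
      by (rule Lp_mono(1)[OF p0 F]) (use S in \<open>auto simp: indicator_def\<close>)
    have "ennreal (h * \<bar>avg F x (x + h)\<bar> powr p) \<le> (\<integral>\<^sup>+t. ennreal (indicator {x..x+h} t * \<bar>F t\<bar> powr p) \<partial>lborel)"
      using avg_diff_le[OF p F, of x "x + h" 0] h by simp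
    also have "\<dots> \<le> (\<integral>\<^sup>+t. ennreal (\<bar>indicator S t * F t\<bar> powr p) \<partial>lborel)"
      by (intro nn_integral_mono ennreal_leI) (use S in \<open>auto simp: indicator_def\<close>)
    also have "\<dots> = ennreal (?T powr p)" by (rule Lp_nn[OF p0 SL])
    finally have "h * \<bar>avg F x (x + h)\<bar> powr p \<le> ?T powr p" by simp
    moreover have "h * \<bar>avg F x (x + h)\<bar> powr p = (h powr (1/p) * \<bar>avg F x (x + h)\<bar>) powr p"
      using h p0 by (simp add: powr_mult powr_powr)
    ultimately have "h powr (1/p) * \<bar>avg F x (x + h)\<bar> \<le> ?T"
      using powr_less_mono2[OF p0 Lp_norm_ge0, of p "\<lambda>t. indicator S t * F t"] by (metis not_less)
    then have 1: "\<bar>avg F x (x + h)\<bar> \<le> ?T / h powr (1/p)" using h by (simp add: pos_le_divide_eq mult.commute)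
    have "ennreal (h * \<bar>avg F x (x + h) - F x\<bar> powr 1) \<le> (\<integral>\<^sup>+t. ennreal (indicator {x..x+h} t * \<bar>F t - F x\<bar> powr 1) \<partial>lborel)"
    proof -
      \<comment> \<open>\<open>avg_diff_le\<close> is now applied with exponent 1, so F is first cut
        to the interval to become integrable; neither side changes.\<close>
      have i: "(\<lambda>t. indicator {x..x+h} t * F t) \<in> Lp 1"
        using Lp_integrable_interval[OF p F] by (simp add: Lp_def)
      have "avg (\<lambda>t. indicator {x..x+h} t * F t) x (x + h) = avg F x (x + h)"
        unfolding avg_def by (intro arg_cong2[where f="(/)"] Bochner_Integration.integral_cong) (auto simp: indicator_def)
      then have "ennreal (h * \<bar>avg F x (x + h) - F x\<bar> powr 1) \<le>
        (\<integral>\<^sup>+t. ennreal (indicator {x..x+h} t * \<bar>indicator {x..x+h} t * F t - F x\<bar> powr 1) \<partial>lborel)"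
        using avg_diff_le[OF _ i, of x "x + h" "F x"] h by simp
      also have "\<dots> = (\<integral>\<^sup>+t. ennreal (indicator {x..x+h} t * \<bar>F t - F x\<bar> powr 1) \<partial>lborel)"
        by (intro nn_integral_cong) (auto simp: indicator_def)
      finally show ?thesis .
    qed
    also have "\<dots> \<le> (\<integral>\<^sup>+t. ennreal (L * h) * indicator {x..x+h} t \<partial>lborel)"
    proof (intro nn_integral_mono)
      fix t
      have "\<bar>F t - F x\<bar> \<le> L * h" if "t \<in> {x..x+h}"
        using lip[of t x] mult_left_mono[OF _ L0, of "\<bar>t - x\<bar>" h] that by auto
      then show "ennreal (indicator {x..x+h} t * \<bar>F t - F x\<bar> powr 1) \<le> ennreal (L * h) * indicator {x..x+h} t"
        by (auto simp: indicator_def intro: ennreal_leI)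
    qed
    also have "\<dots> = ennreal (L * h * h)" using h L0 by (simp add: nn_integral_cmult_indicator ennreal_mult)
    finally have "h * \<bar>avg F x (x + h) - F x\<bar> \<le> L * h * h" using h L0 by simp
    then have "\<bar>avg F x (x + h) - F x\<bar> \<le> L * h" using h by simp
    then show ?thesis using 1 by linarith
  qed
  show "\<bar>F x\<bar> \<le> L + Lp_norm p F" using key[of 1 x UNIV] by simp
  assume e: "0 < e"
  define h where "h = e / (2 * (L + 1))"
  have h: "0 < h" "L * h < e / 2 + 0" using e L0 by (auto simp: h_def field_simps)
  have "eventually (\<lambda>n. Lp_norm p (\<lambda>x. indicator {x. real n < \<bar>x\<bar>} x * F x) < (e / 2) * h powr (1/p)) sequentially"
    by (rule order_tendstoD(2)[OF Lp_tail_zero[OF p F]]) (use e h in simp)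
  then obtain n where n: "Lp_norm p (\<lambda>x. indicator {x. real n < \<bar>x\<bar>} x * F x) < (e / 2) * h powr (1/p)"
    by (auto simp: eventually_sequentially)
  show "\<exists>N. \<forall>x. N < \<bar>x\<bar> \<longrightarrow> \<bar>F x\<bar> < e"
  proof (intro exI allI impI)
    fix x assume x: "real n + h < \<bar>x\<bar>"
    have "\<bar>F x\<bar> \<le> L * h + Lp_norm p (\<lambda>t. indicator {x. real n < \<bar>x\<bar>} t * F t) / h powr (1/p)"
      by (rule key[OF h(1)]) (use x h in auto)
    also have "Lp_norm p (\<lambda>t. indicator {x. real n < \<bar>x\<bar>} t * F t) / h powr (1/p) < e / 2"
      using n h by (simp add: pos_divide_less_eq)
    finally show "\<bar>F x\<bar> < e" using h by linarith
  qed
qed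

lemma weak_deriv_ae_eq:
  assumes "weak_deriv u g" "weak_deriv u h"
  shows "ae_eq g h"
proof -
  have [measurable]: "g \<in> borel_measurable borel" "h \<in> borel_measurable borel" using assms by (auto simp: weak_deriv_def)
  have "AE x in lborel. g x - h x = 0"
  proof (rule test_fun_orthogonal_zero)
    fix \<phi> assume t: "test_fun \<phi>"
    have i: "integrable lborel (\<lambda>x. g x * \<phi> x)" "integrable lborel (\<lambda>x. h x * \<phi> x)"
      and e: "(\<integral>x. g x * \<phi> x \<partial>lborel) = (\<integral>x. h x * \<phi> x \<partial>lborel)"
      using assms t by (auto simp: weak_deriv_def)
    show "integrable lborel (\<lambda>x. (g x - h x) * \<phi> x)" using i by (simp add: left_diff_distrib)
    show "(\<integral>x. (g x - h x) * \<phi> x \<partial>lborel) = 0" using i e by (simp add: left_diff_distrib)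
  qed measurable
  then show ?thesis by (simp add: ae_eq_def)
qed

theorem sobolev_regular:
  assumes p: "1 < p" "p \<le> 2" and s: "1 + 1 / p < s" and f: "f \<in> sobolev_slobodeckij s p"
  obtains L M H \<alpha> F G where "graph p L M H \<alpha> F G" "ae_eq f F" "ae_eq (wderiv f) G"
proof -
  have p1: "1 \<le> p" and p0: "0 < p" using p by auto
  obtain g where fL: "f \<in> Lp p" and wd: "weak_deriv f g" and gL: "g \<in> Lp p"
    and fin: "(\<integral>\<^sup>+ x. \<integral>\<^sup>+ y. ennreal (\<bar>g x - g y\<bar> powr p / \<bar>x - y\<bar> powr (1 + (s - 1) * p)) \<partial>lborel \<partial>lborel) < \<infinity>"
    using f unfolding sobolev_slobodeckij_def by blast
  \<comment> \<open>The derivative has smoothness s - 1, and the embedding costs 1 / p; positivity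
    is exactly the assumption on s.\<close>
  define \<alpha> where "\<alpha> = s - 1 - 1 / p"
  have a: "0 < \<alpha>" using s by (simp add: \<alpha>_def)
  obtain G H L where G: "ae_eq g G" "0 \<le> H" "\<And>x y. \<bar>x - y\<bar> \<le> 1 \<Longrightarrow> \<bar>G x - G y\<bar> \<le> H * \<bar>x - y\<bar> powr \<alpha>"
    "\<And>x. \<bar>G x\<bar> \<le> L" "G \<in> borel_measurable borel"
    using slobodeckij_holder[OF p1 gL _ fin] s unfolding \<alpha>_def by (metis add.commute less_diff_eq)
  note [measurable] = G(5) Lp_measurable[OF fL] Lp_measurable[OF gL]
  have GL: "G \<in> Lp p" by (rule Lp_cong_AE[OF G(5) gL G(1) p0])
  have cG: "isCont G x" for x by (rule holder_isCont[OF a G(3)])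
  obtain F0 where F0: "\<And>x. (F0 has_real_derivative G x) (at x)" using antiderivative_UNIV[OF cG] by metis
  have cF0: "isCont F0 x" for x using F0 DERIV_isCont by blast
  have [measurable]: "F0 \<in> borel_measurable borel"
    by (intro borel_measurable_continuous_onI continuous_at_imp_continuous_on ballI cF0)
  have q: "p / (p - 1) > 0" using p by simp
  obtain c where c: "AE x in lborel. f x - F0 x = c"
  proof (rule weak_deriv_zero_const[of "\<lambda>x. f x - F0 x"])
    have F0i: "integrable lborel (\<lambda>x. F0 x * \<phi> x)" if t: "test_fun \<phi>" for \<phi>
    proof -
      obtain N where N: "\<And>x. N < \<bar>x\<bar> \<Longrightarrow> \<phi> x = 0" using test_fun_support[OF t] by metis
      show ?thesis by (rule integrable_continuous_support[of _ N])
        (use N test_fun_isCont(1)[OF t] cF0 in \<open>auto intro!: continuous_intros\<close>)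
    qed
    have fi: "integrable lborel (\<lambda>x. f x * \<phi> x)" if "test_fun \<phi>" for \<phi>
    proof -
      have "integrable lborel (\<lambda>x. \<bar>\<phi> x * f x\<bar>)"
        by (rule holder_bound(1)[OF p(1) test_fun_Lp[OF that q] fL])
      then show ?thesis using test_fun_measurable[OF that]
        by (subst integrable_abs_iff[symmetric]) (auto simp: mult.commute)
    qed
    fix \<phi> assume t: "test_fun \<phi>"
    show "integrable lborel (\<lambda>x. (f x - F0 x) * \<phi> x)"
      using fi[OF t] F0i[OF t] by (simp add: left_diff_distrib)
    obtain N where N: "0 < N" "\<And>x. N < \<bar>x\<bar> \<Longrightarrow> \<phi> x = 0" "\<And>x. N < \<bar>x\<bar> \<Longrightarrow> deriv \<phi> x = 0" using test_fun_support[OF t] by metis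
    note tc = test_fun_isCont[OF t]
    have i1: "integrable lborel (\<lambda>x. F0 x * deriv \<phi> x)" and i2: "integrable lborel (\<lambda>x. G x * \<phi> x)"
      by (rule integrable_continuous_support[of _ N]; use N tc cF0 cG in \<open>auto intro!: continuous_intros\<close>)+
    have "(\<integral>x. G x * \<phi> x + F0 x * deriv \<phi> x \<partial>lborel) = F0 (N + 1) * \<phi> (N + 1) - F0 (-(N+1)) * \<phi> (-(N+1))"
      by (rule integral_FTC_support)
         (use N tc cF0 cG in \<open>auto intro!: continuous_intros derivative_eq_intros F0 test_fun_deriv[OF t] simp: mult.commute\<close>)
    then have 1: "(\<integral>x. F0 x * deriv \<phi> x \<partial>lborel) = - (\<integral>x. G x * \<phi> x \<partial>lborel)"
      using i1 i2 N by simp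
    have 2: "(\<integral>x. g x * \<phi> x \<partial>lborel) = (\<integral>x. G x * \<phi> x \<partial>lborel)"
      by (rule integral_cong_AE) (use G(1) test_fun_measurable[OF t] in \<open>auto simp: ae_eq_def elim!: eventually_mono\<close>)
    have "integrable lborel (\<lambda>x. f x * deriv \<phi> x)" "(\<integral>x. f x * deriv \<phi> x \<partial>lborel) = - (\<integral>x. g x * \<phi> x \<partial>lborel)"
      using wd t unfolding weak_deriv_def by auto
    then show "(\<integral>x. (f x - F0 x) * deriv \<phi> x \<partial>lborel) = 0"
      using i1 1 2 by (simp add: left_diff_distrib)
  qed measurable
  define F where "F x = F0 x + c" for x
  have F: "(F has_real_derivative G x) (at x)" for x unfolding F_def by (auto intro!: derivative_eq_intros F0)
  have [measurable]: "F \<in> borel_measurable borel" unfolding F_def by measurable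
  have fF: "ae_eq f F" unfolding ae_eq_def F_def using c by eventually_elim simp
  have FL: "F \<in> Lp p" by (rule Lp_cong_AE[OF _ fL fF p0]) measurable
  have lip: "\<bar>F x - F y\<bar> \<le> L * \<bar>x - y\<bar>" for x y
    using field_differentiable_bound[of UNIV F G L x y] F G(4) by auto
  have "graph p L (L + Lp_norm p F) H \<alpha> F G"
    by unfold_locales (use p F G a GL lipschitz_Lp_decay[OF p1 FL lip] in auto)
  moreover have "ae_eq (wderiv f) G"
  proof -
    \<comment> \<open>\<open>wderiv f\<close> is an arbitrary choice among the weak derivatives, so
      it is tied to G only almost everywhere.\<close>
    have "weak_deriv f (wderiv f)" using someI[of "weak_deriv f", OF wd] by (simp add: wderiv_def)
    from weak_deriv_ae_eq[OF this wd] G(1) show ?thesis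
      unfolding ae_eq_def by eventually_elim simp
  qed
  ultimately show ?thesis using fF that by blast
qed

section \<open>The Rellich identity\<close>

lemma integrable_inverse_square: "integrable lborel (\<lambda>x::real. 1 / (1 + \<bar>x\<bar>)\<^sup>2)"
proof (rule Bochner_Integration.integrable_bound)
  have i: "integrable lborel (indicator {-1..1} :: real \<Rightarrow> real)"
    by (intro integrable_real_indicator) (auto simp: emeasure_lborel_Icc_eq)
  show "integrable lborel (\<lambda>x::real. indicator {-1..1} x + indicator {1<..} \<bar>x\<bar> * \<bar>x\<bar> powr (- 2))"
    using i integrable_powr_far[of 2 1] by simp
  show "AE x::real in lborel. norm (1 / (1 + \<bar>x\<bar>)\<^sup>2) \<le> norm (indicator {-1..1} x + indicator {1<..} \<bar>x\<bar> * \<bar>x\<bar> powr (- 2))"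
  proof (intro AE_I2)
    fix x :: real
    show "norm (1 / (1 + \<bar>x\<bar>)\<^sup>2) \<le> norm (indicator {-1..1} x + indicator {1<..} \<bar>x\<bar> * \<bar>x\<bar> powr (- 2))"
    proof (cases "\<bar>x\<bar> \<le> 1")
      case True
      have "1 \<le> (1 + \<bar>x\<bar>)\<^sup>2" by (simp add: one_le_power)
      then show ?thesis using True by (auto simp: indicator_def abs_le_iff divide_le_eq)
    next
      case False
      have "\<bar>x\<bar>\<^sup>2 \<le> (1 + \<bar>x\<bar>)\<^sup>2" by (intro power_mono) auto
      then have "1 / (1 + \<bar>x\<bar>)\<^sup>2 \<le> 1 / \<bar>x\<bar>\<^sup>2" using False by (intro divide_left_mono) auto
      also have "1 / \<bar>x\<bar>\<^sup>2 = \<bar>x\<bar> powr (- 2)" using False by (simp add: powr_minus divide_inverse)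
      finally show ?thesis using False by (auto simp: indicator_def)
    qed
  qed
qed measurable

lemma integral_whole_line_FTC:
  fixes f \<Phi> :: "real \<Rightarrow> complex"
  assumes i: "integrable lborel f" and d: "\<And>x. (\<Phi> has_vector_derivative f x) (at x)" and c: "continuous_on UNIV f"
    and l: "(\<lambda>n. \<Phi> (real n)) \<longlonglongrightarrow> 0" "(\<lambda>n. \<Phi> (- real n)) \<longlonglongrightarrow> 0"
  shows "(\<integral>x. f x \<partial>lborel) = 0"
proof -
  have "(\<lambda>n. \<integral>x. indicator {-real n..real n} x *\<^sub>R f x \<partial>lborel) \<longlonglongrightarrow> (\<integral>x. f x \<partial>lborel)"
  proof (rule integral_dominated_convergence)
    show "integrable lborel (\<lambda>x. norm (f x))" using i by simp
    show "AE x in lborel. (\<lambda>n. indicator {-real n..real n} x *\<^sub>R f x) \<longlonglongrightarrow> f x"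
    proof (intro AE_I2 tendsto_eventually)
      fix x :: real
      obtain m where m: "\<bar>x\<bar> \<le> real m" using real_arch_simple by blast
      show "\<forall>\<^sub>F n in sequentially. indicator {-real n..real n} x *\<^sub>R f x = f x"
        using eventually_ge_at_top[of m] by eventually_elim (use m in \<open>auto simp: indicator_def\<close>)
    qed
  qed (use i in \<open>auto simp: indicator_def\<close>)
  moreover have "(\<integral>x. indicator {-real n..real n} x *\<^sub>R f x \<partial>lborel) = \<Phi> (real n) - \<Phi> (- real n)" for n
    by (rule integral_FTC_Icc) (auto intro: has_vector_derivative_at_within d continuous_on_subset[OF c])
  ultimately have "(\<lambda>n. \<Phi> (real n) - \<Phi> (- real n)) \<longlonglongrightarrow> (\<integral>x. f x \<partial>lborel)" by simp
  moreover have "(\<lambda>n. \<Phi> (real n) - \<Phi> (- real n)) \<longlonglongrightarrow> 0 - 0" by (intro tendsto_intros l)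
  ultimately show ?thesis using LIMSEQ_unique by fastforce
qed

text \<open>The half-planes above and below the real axis are convex, avoid the branch cut, and the
  derivative of \<open>Ln\<close> is at most 1 / m there. This shows that a difference of two
  logarithms tends to zero although each one grows.\<close>

lemma Ln_diff_half_plane:
  assumes m: "0 < m" and s: "\<bar>s\<bar> = 1" and w: "m \<le> s * Im w1" "m \<le> s * Im w2"
  shows "norm (Ln w1 - Ln w2) \<le> norm (w1 - w2) / m"
proof -
  have "norm (Ln w1 - Ln w2) \<le> (1 / m) * norm (w1 - w2)"
  proof (rule field_differentiable_bound[of "{w. m \<le> s * Im w}" Ln inverse])
    have "{w. m \<le> s * Im w} = {w. inner (s *\<^sub>R \<i>) w \<ge> m}" by (simp add: inner_complex_def)
    with convex_halfspace_ge[of m "s *\<^sub>R \<i>"] show "convex {w. m \<le> s * Im w}" by (simp only:)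
  next
    fix w assume "w \<in> {w. m \<le> s * Im w}"
    then have im: "m \<le> \<bar>Im w\<bar>" using abs_ge_self[of "s * Im w"] s by (simp add: abs_mult)
    then have "Im w \<noteq> 0" using m by fastforce
    then have nz: "w \<notin> \<real>\<^sub>\<le>\<^sub>0" by (simp add: complex_nonpos_Reals_iff)
    show "(Ln has_field_derivative inverse w) (at w within {w. m \<le> s * Im w})"
      by (rule has_field_derivative_at_within[OF has_field_derivative_Ln[OF nz]])
    have "m \<le> norm w" using im abs_Im_le_cmod[of w] by linarith
    then show "norm (inverse w) \<le> 1 / m"
      using m frac_le[of 1 1 m "norm w"] by (simp add: norm_inverse norm_divide inverse_eq_divide)
  qed (use w in auto)
  then show ?thesis by simp
qed

section \<open>The graph as a curve in the complex plane and the Cauchy kernel on shifted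
  contours\<close>

context graph
begin

text \<open>Tangent vector of the curve parametrised by x + i F x; \<open>chord x z\<close> is the
  difference of the points of the curve with parameters x and z.\<close>

definition slope :: "real \<Rightarrow> complex" where "slope x = 1 + \<i> * of_real (G x)"
definition chord :: "real \<Rightarrow> real \<Rightarrow> complex" where "chord x z = of_real (x - z) + \<i> * of_real (F x - F z)"

lemma slope_Re [simp]: "Re (slope x) = 1" and slope_Im [simp]: "Im (slope x) = G x"
  by (auto simp: slope_def)
lemma chord_Re [simp]: "Re (chord x z) = x - z" and chord_Im [simp]: "Im (chord x z) = F x - F z"
  by (auto simp: chord_def)

lemma slope_nz: "slope x \<noteq> 0"
  by (auto simp: complex_eq_iff)

lemma isCont_G: "isCont G x"
  by (rule holder_isCont[OF alpha holder])

lemma F_measurable [measurable]: "F \<in> borel_measurable borel"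
  and G_measurable [measurable]: "G \<in> borel_measurable borel"
  by (intro borel_measurable_continuous_onI continuous_at_imp_continuous_on ballI isCont_F isCont_G)+

lemma slope_measurable [measurable]: "slope \<in> borel_measurable borel"
  unfolding slope_def by measurable

lemma chord_measurable [measurable]: "(\<lambda>(x, z). chord x z) \<in> borel_measurable (borel \<Otimes>\<^sub>M borel)"
  unfolding chord_def by measurable

lemma slope_cont: "continuous_on S slope"
  unfolding slope_def by (intro continuous_intros continuous_at_imp_continuous_on ballI isCont_G)

lemma chord_cont: "continuous_on S (\<lambda>x. chord x z)"
  unfolding chord_def by (intro continuous_intros continuous_at_imp_continuous_on ballI isCont_F)

lemma norm_slope: "norm (slope x) \<le> 1 + L"
  using norm_triangle_ineq[of 1 "\<i> * of_real (G x)"] G_bound[of x] by (simp add: slope_def norm_mult)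

lemma chord_deriv: "((\<lambda>x. chord x z + w) has_vector_derivative slope x) (at x)"
proof -
  have "((\<lambda>x. of_real (x - z)) has_vector_derivative (of_real 1 :: complex)) (at x)"
    by (intro has_vector_derivative_of_real) (auto intro!: derivative_eq_intros)
  moreover have "((\<lambda>x. of_real (F x - F z)) has_vector_derivative (of_real (G x) :: complex)) (at x)"
    by (intro has_vector_derivative_of_real) (auto intro!: derivative_eq_intros deriv_F simp: has_real_derivative_iff_has_vector_derivative[symmetric])
  ultimately have "((\<lambda>x. of_real (x - z) + \<i> * of_real (F x - F z) + w) has_vector_derivative (of_real 1 + \<i> * of_real (G x) + 0)) (at x)"
    by (intro has_vector_derivative_add has_vector_derivative_const has_vector_derivative_mult_right)
  then show ?thesis by (simp add: chord_def slope_def)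
qed

definition low :: "real \<Rightarrow> real" where "low e = 1 / (1 + 2 * (L + 1) / e)"

lemma low_pos: "0 < e \<Longrightarrow> 0 < low e"
  using L0 by (auto simp: low_def intro!: divide_pos_pos add_pos_nonneg)

lemma chord_norm_ge: "\<bar>x - z\<bar> \<le> norm (chord x z + \<i> * of_real e)"
  using abs_Re_le_cmod[of "chord x z + \<i> * of_real e"] by simp

text \<open>If |x - z| is at least k = e / (2 * (L + 1)), the real part suffices. Otherwise F
  changes by at most e / 2 and the imaginary part is still at least e / 2. Together with the bound
  by |x - z| this gives growth as well as distance from zero.\<close>

lemma chord_norm_low:
  assumes e: "0 < e"
  shows "low e * (1 + \<bar>x - z\<bar>) \<le> norm (chord x z + \<i> * of_real e)"
proof -
  define k where "k = e / (2 * (L + 1))"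
  have k: "0 < k" using e L0 by (simp add: k_def)
  let ?w = "chord x z + \<i> * of_real e"
  have "k \<le> norm ?w"
  proof (cases "k \<le> \<bar>x - z\<bar>")
    case True then show ?thesis using chord_norm_ge[of x z e] by linarith
  next
    case False
    have "L * \<bar>x - z\<bar> \<le> L * k" using False L0 by (intro mult_left_mono) auto
    moreover have "L * k \<le> e / 2" "k \<le> e / 2" using e L0 by (auto simp: k_def field_simps)
    ultimately have "k \<le> Im ?w" using F_lip[of x z] by simp
    then show ?thesis using abs_Im_le_cmod[of ?w] by linarith
  qed
  then have "1 \<le> norm ?w / k" using k by simp
  then have "1 + \<bar>x - z\<bar> \<le> (1 + 1 / k) * norm ?w" using chord_norm_ge[of x z e] by (simp add: distrib_right)
  moreover have "low e = 1 / (1 + 1 / k)" by (simp add: low_def k_def)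
  moreover have "0 < 1 + 1 / k" using k by (simp add: add_pos_pos)
  ultimately show ?thesis by (simp add: pos_divide_le_eq mult.commute)
qed

lemma chord_nz: "0 < e \<Longrightarrow> chord x z + \<i> * of_real e \<noteq> 0"
  using chord_norm_low[of e x z] low_pos[of e] by (auto simp: zero_less_mult_iff mult_le_0_iff)

text \<open>The Cauchy kernel with pole on the graph at parameter z, evaluated at height e above the
  graph at parameter x.\<close>

definition ck :: "real \<Rightarrow> real \<Rightarrow> real \<Rightarrow> complex" where
  "ck e x z = 1 / (chord x z + \<i> * of_real e)"

lemma ck_norm:
  assumes e: "0 < e" shows "norm (ck e x z) \<le> 1 / (low e * (1 + \<bar>x - z\<bar>))"
proof -
  have "0 < low e * (1 + \<bar>x - z\<bar>)" using low_pos[OF e] by (intro mult_pos_pos) auto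
  moreover from this have "0 < norm (chord x z + \<i> * of_real e)"
    using chord_norm_low[OF e, of x z] by linarith
  ultimately show ?thesis unfolding ck_def norm_divide norm_one
    using chord_norm_low[OF e, of x z] low_pos[OF e] by (intro divide_left_mono mult_pos_pos) auto
qed

lemma ck_norm_far:
  assumes e: "0 < e" and z: "\<bar>z\<bar> \<le> N"
  shows "norm (ck e x z) \<le> (1 + N) / low e / (1 + \<bar>x\<bar>)"
proof -
  have N: "0 \<le> N" using z by linarith
  have "1 + \<bar>x\<bar> \<le> 1 + N + \<bar>x - z\<bar>" using z by linarith
  also have "\<dots> \<le> (1 + N) * (1 + \<bar>x - z\<bar>)" using N by (simp add: algebra_simps)
  finally have *: "1 + \<bar>x\<bar> \<le> (1 + N) * (1 + \<bar>x - z\<bar>)" .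
  have "norm (ck e x z) \<le> 1 / (low e * (1 + \<bar>x - z\<bar>))" by (rule ck_norm[OF e])
  also have "\<dots> \<le> (1 + N) / low e / (1 + \<bar>x\<bar>)"
  proof -
    have "1 / (1 + \<bar>x - z\<bar>) \<le> (1 + N) / (1 + \<bar>x\<bar>)"
      using * by (simp add: divide_le_eq le_divide_eq mult.commute add_pos_nonneg)
    then have "1 / (1 + \<bar>x - z\<bar>) / low e \<le> (1 + N) / (1 + \<bar>x\<bar>) / low e"
      using low_pos[OF e] by (intro divide_right_mono) auto
    then show ?thesis by (simp add: mult.commute)
  qed
  finally show ?thesis .
qed

lemma ck_measurable [measurable]: "(\<lambda>(x, z). ck e x z) \<in> borel_measurable (borel \<Otimes>\<^sub>M borel)"
  unfolding ck_def chord_def by measurable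

lemma ck_cont: "0 < e \<Longrightarrow> continuous_on S (\<lambda>x. ck e x z)"
  unfolding ck_def by (intro continuous_intros chord_cont) (simp add: chord_nz)

text \<open>Both poles lie below the contour, which is the graph shifted upwards by \<open>e\<close>.\<close>
lemma ck_pair_integral:
  assumes e: "0 < e"
  shows "integrable lborel (\<lambda>x. slope x * ck e x z * ck e x t)"
    "(\<integral>x. slope x * ck e x z * ck e x t \<partial>lborel) = 0"
proof -
  define N where "N = max \<bar>z\<bar> \<bar>t\<bar>"
  define C where "C = (1 + N) / low e"
  have C0: "0 \<le> C" using low_pos[OF e] by (simp add: C_def N_def)
  have bd: "norm (ck e x z) \<le> C / (1 + \<bar>x\<bar>)" "norm (ck e x t) \<le> C / (1 + \<bar>x\<bar>)" for x
    unfolding C_def by (rule ck_norm_far[OF e]; simp add: N_def)+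
  have cont: "continuous_on UNIV (\<lambda>x. slope x * ck e x z * ck e x t)"
    by (intro continuous_intros slope_cont ck_cont e)
  show i: "integrable lborel (\<lambda>x. slope x * ck e x z * ck e x t)"
  proof (rule Bochner_Integration.integrable_bound)
    show "integrable lborel (\<lambda>x. ((1 + L) * C * C) * (1 / (1 + \<bar>x\<bar>)\<^sup>2))"
      using integrable_inverse_square by (rule integrable_mult_right)
    show "(\<lambda>x. slope x * ck e x z * ck e x t) \<in> borel_measurable lborel"
      using borel_measurable_continuous_onI[OF cont] by simp
    show "AE x in lborel. norm (slope x * ck e x z * ck e x t) \<le> norm ((1 + L) * C * C * (1 / (1 + \<bar>x\<bar>)\<^sup>2))"
    proof (intro AE_I2)
      fix x
      have "norm (slope x * ck e x z * ck e x t) \<le> (1 + L) * (C / (1 + \<bar>x\<bar>)) * (C / (1 + \<bar>x\<bar>))"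
        unfolding norm_mult using bd[of x] norm_slope[of x] L0 C0 by (intro mult_mono) auto
      also have "\<dots> = (1 + L) * C * C * (1 / (1 + \<bar>x\<bar>)\<^sup>2)" by (simp add: power2_eq_square)
      finally show "norm (slope x * ck e x z * ck e x t) \<le> norm ((1 + L) * C * C * (1 / (1 + \<bar>x\<bar>)\<^sup>2))"
        by (rule order_trans) (simp only: real_norm_def abs_ge_self)
    qed
  qed
  show "(\<integral>x. slope x * ck e x z * ck e x t \<partial>lborel) = 0"
  \<comment> \<open>A double pole has primitive -1/w. Two distinct simple poles are separated by
    partial fractions with coefficients 1/d and -1/d, and their primitive is a quotient of a
    difference of logarithms by d.\<close>
  proof (cases "z = t")
    case True
    show ?thesis
    proof (rule integral_whole_line_FTC[OF i _ cont])
      fix x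
      have "((\<lambda>w. - inverse w) has_field_derivative inverse ((chord x z + \<i> * of_real e)\<^sup>2)) (at (chord x z + \<i> * of_real e))"
        using chord_nz[OF e, of x z] by (auto intro!: derivative_eq_intros simp: power2_eq_square)
      from field_vector_diff_chain_at[OF chord_deriv this]
      show "((\<lambda>x. - ck e x z) has_vector_derivative slope x * ck e x z * ck e x t) (at x)"
        using True by (simp add: ck_def o_def inverse_eq_divide power2_eq_square)
    next
      have l: "(\<lambda>n. C / (1 + real n)) \<longlonglongrightarrow> 0"
        by (intro tendsto_divide_0[OF tendsto_const] filterlim_at_top_imp_at_infinity
            filterlim_tendsto_add_at_top[OF tendsto_const] filterlim_real_sequentially)
      have "norm (- ck e (real n) z) \<le> C / (1 + real n)" "norm (- ck e (- real n) z) \<le> C / (1 + real n)" for n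
        using bd(1)[of "real n"] bd(1)[of "- real n"] by simp_all
      then show "(\<lambda>n. - ck e (real n) z) \<longlonglongrightarrow> 0" "(\<lambda>n. - ck e (- real n) z) \<longlonglongrightarrow> 0"
        by (auto intro!: Lim_null_comparison[OF _ l])
    qed
  next
    case False
    \<comment> \<open>The factor -i turns the picture so that the cut is avoided: the argument is
      real only at x = u, and there it equals e > 0.\<close>
    define lg where "lg u x = Ln (- \<i> * (chord x u + \<i> * of_real e))" for u x
    have lg: "(lg u has_vector_derivative slope x * ck e x u) (at x)" for u x
    proof -
      have im: "Im (- \<i> * (chord x u + \<i> * of_real e)) = u - x" and re: "Re (- \<i> * (chord x u + \<i> * of_real e)) = F x - F u + e"
        by simp_all
      have "- \<i> * (chord x u + \<i> * of_real e) \<notin> \<real>\<^sub>\<le>\<^sub>0"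
        using e im re by (auto simp: complex_nonpos_Reals_iff)
      then have "((\<lambda>w. Ln (- \<i> * w)) has_field_derivative inverse (- \<i> * (chord x u + \<i> * of_real e)) * (- \<i>)) (at (chord x u + \<i> * of_real e))"
        by (intro derivative_eq_intros) (auto intro!: derivative_eq_intros)
      moreover have "inverse (- \<i> * (chord x u + \<i> * of_real e)) * (- \<i>) = ck e x u"
        by (simp add: ck_def inverse_eq_divide)
      ultimately have "((\<lambda>w. Ln (- \<i> * w)) has_field_derivative ck e x u) (at (chord x u + \<i> * of_real e))" by simp
      from field_vector_diff_chain_at[OF chord_deriv this] show ?thesis by (simp add: lg_def[abs_def] o_def)
    qed
    define d where "d = chord z t"
    have d0: "d \<noteq> 0" using False by (auto simp: d_def complex_eq_iff)
    have dd: "chord x t = chord x z + d" for x by (simp add: d_def complex_eq_iff)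
    have split: "(ck e x z - ck e x t) / d = ck e x z * ck e x t" for x
    proof -
      define W where "W = chord x z + \<i> * of_real e"
      have Wt: "chord x t + \<i> * of_real e = W + d" by (simp add: W_def dd)
      have "W \<noteq> 0" "W + d \<noteq> 0" using chord_nz[OF e, of x z] chord_nz[OF e, of x t] Wt by (simp_all add: W_def)
      then show ?thesis using d0 unfolding ck_def Wt W_def[symmetric] by (simp add: diff_frac_eq)
    qed
    show ?thesis
    proof (rule integral_whole_line_FTC[OF i _ cont])
      fix x
      have "((\<lambda>x. (lg z x - lg t x) / d) has_vector_derivative (slope x * ck e x z - slope x * ck e x t) / d) (at x)"
        by (intro has_vector_derivative_divide has_vector_derivative_diff lg)
      also have "(slope x * ck e x z - slope x * ck e x t) / d = slope x * ((ck e x z - ck e x t) / d)"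
        by (simp add: right_diff_distrib)
      finally show "((\<lambda>x. (lg z x - lg t x) / d) has_vector_derivative slope x * ck e x z * ck e x t) (at x)"
        by (simp add: split mult.assoc)
    next
      have nd: "norm ((- \<i> * (chord x z + \<i> * of_real e)) - (- \<i> * (chord x t + \<i> * of_real e))) = norm d" for x
      proof -
        have "(- \<i> * (chord x z + \<i> * of_real e)) - (- \<i> * (chord x t + \<i> * of_real e)) = \<i> * d"
          by (simp add: dd algebra_simps)
        then show ?thesis by (simp add: norm_mult)
      qed
      \<comment> \<open>The two arguments differ by a constant of modulus |d|, while their imaginary
        parts z - x and t - x tend to infinity with a common sign; hence the decay at both
        ends.\<close>
      have b: "norm ((lg z x - lg t x) / d) \<le> 1 / m" if "0 < m" "\<bar>s\<bar> = 1" "m \<le> s * (z - x)" "m \<le> s * (t - x)" for x m s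
      proof -
        have "norm (lg z x - lg t x) \<le> norm d / m"
          unfolding lg_def using Ln_diff_half_plane[OF that(1,2), of "- \<i> * (chord x z + \<i> * of_real e)" "- \<i> * (chord x t + \<i> * of_real e)"] that
          unfolding nd by simp
        then show ?thesis using d0 that by (simp add: norm_divide field_simps)
      qed
      have l: "(\<lambda>n. 1 / (- N + real n)) \<longlonglongrightarrow> 0"
        by (intro tendsto_divide_0[OF tendsto_const] filterlim_at_top_imp_at_infinity
            filterlim_tendsto_add_at_top[OF tendsto_const] filterlim_real_sequentially)
      obtain n0 where n0: "N < real n0" using reals_Archimedean2 by blast
      have ev: "eventually (\<lambda>n. N < real n) sequentially"
        using eventually_ge_at_top[of n0] by eventually_elim (use n0 in linarith)
      show "(\<lambda>n. (lg z (real n) - lg t (real n)) / d) \<longlonglongrightarrow> 0"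
        by (rule Lim_null_comparison[OF eventually_mono[OF ev] l], rule b[where s="-1"]) (auto simp: N_def)
      show "(\<lambda>n. (lg z (- real n) - lg t (- real n)) / d) \<longlonglongrightarrow> 0"
        by (rule Lim_null_comparison[OF eventually_mono[OF ev] l], rule b[where s="1"]) (auto simp: N_def)
    qed
  qed
qed

end

lemma integral_norm_le_dominated:
  fixes f :: "'a \<Rightarrow> 'b :: {banach, second_countable_topology}" and g :: "'a \<Rightarrow> real"
  assumes f: "f \<in> borel_measurable M" and g: "integrable M g" and le: "AE x in M. norm (f x) \<le> g x"
  shows "integrable M f" "norm (\<integral>x. f x \<partial>M) \<le> (\<integral>x. g x \<partial>M)"
proof -
  show i: "integrable M f"
    by (rule Bochner_Integration.integrable_bound[OF g f]) (use le in \<open>auto elim!: eventually_mono\<close>)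
  have "norm (\<integral>x. f x \<partial>M) \<le> (\<integral>x. norm (f x) \<partial>M)" by (rule integral_norm_bound)
  also have "\<dots> \<le> (\<integral>x. g x \<partial>M)" by (rule integral_mono_AE) (use i g le in auto)
  finally show "norm (\<integral>x. f x \<partial>M) \<le> (\<integral>x. g x \<partial>M)" .
qed

lemma Ln_bound:
  assumes "1 \<le> \<bar>Im w\<bar>" "norm w \<le> B"
  shows "norm (Ln w) \<le> B + pi"
proof -
  have w1: "1 \<le> norm w" using assms(1) abs_Im_le_cmod[of w] by linarith
  then have w: "w \<noteq> 0" by auto
  have "ln (norm w) \<le> norm w - 1" using w1 by (intro ln_le_minus_one) auto
  then have "\<bar>Re (Ln w)\<bar> \<le> B" using w w1 assms(2) by simp
  moreover have "\<bar>Im (Ln w)\<bar> \<le> pi" using mpi_less_Im_Ln[OF w] Im_Ln_le_pi[OF w] by linarith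
  ultimately show ?thesis using cmod_le[of "Ln w"] by linarith
qed

section \<open>The Cauchy integral and its boundary values from above\<close>

context graph
begin

text \<open>Mean value theorem for F t - t * G x, whose derivative G t - G x is small by Hoelder
  continuity. The extra power \<alpha> makes the kernel of A integrable across the diagonal.\<close>

lemma chord_near:
  assumes y: "\<bar>y\<bar> \<le> 1"
  shows "\<bar>F x - F (x - y) - y * G x\<bar> \<le> H * \<bar>y\<bar> powr \<alpha> * \<bar>y\<bar>"
proof -
  have "norm ((\<lambda>t. F t - t * G x) x - (\<lambda>t. F t - t * G x) (x - y)) \<le> H * \<bar>y\<bar> powr \<alpha> * norm (x - (x - y))"
  proof (rule field_differentiable_bound[of "{min x (x-y)..max x (x-y)}" _ "\<lambda>t. G t - G x"])
    fix t assume t: "t \<in> {min x (x-y)..max x (x-y)}"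
    show "((\<lambda>t. F t - t * G x) has_field_derivative G t - G x) (at t within {min x (x-y)..max x (x-y)})"
      by (rule has_field_derivative_at_within) (auto intro!: derivative_eq_intros deriv_F)
    have tx: "\<bar>t - x\<bar> \<le> \<bar>y\<bar>" using t by auto
    then have "\<bar>G t - G x\<bar> \<le> H * \<bar>t - x\<bar> powr \<alpha>" using y by (intro holder) auto
    also have "\<dots> \<le> H * \<bar>y\<bar> powr \<alpha>" using tx alpha H0 by (intro mult_left_mono powr_mono2) auto
    finally show "norm (G t - G x) \<le> H * \<bar>y\<bar> powr \<alpha>" by simp
  qed auto
  then show ?thesis by (simp add: algebra_simps)
qed

context
  fixes \<omega> :: "real \<Rightarrow> real" and K \<Lambda> N :: real
  assumes om_bound: "\<And>x. \<bar>\<omega> x\<bar> \<le> K" and om_supp: "\<And>x. N < \<bar>x\<bar> \<Longrightarrow> \<omega> x = 0" and N0: "0 < N"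
    and om_lip: "\<And>x y. \<bar>\<omega> x - \<omega> y\<bar> \<le> \<Lambda> * \<bar>x - y\<bar>" and om_cont: "\<And>x. isCont \<omega> x"
begin

lemma om_measurable [measurable]: "\<omega> \<in> borel_measurable borel"
  by (intro borel_measurable_continuous_onI continuous_at_imp_continuous_on ballI om_cont)

lemma om_integrable: "integrable lborel \<omega>"
  by (rule integrable_continuous_support[OF om_cont om_supp])

lemma K0: "0 \<le> K" using om_bound[of 0] by linarith
lemma La0: "0 \<le> \<Lambda>" using om_lip[of 0 1] by simp

definition om1 :: real where "om1 = (\<integral>z. \<bar>\<omega> z\<bar> \<partial>lborel)"

lemma om1_ge0: "0 \<le> om1" by (simp add: om1_def)

text \<open>Up to normalisation, the Cauchy integral over the graph with density \<omega> with
  respect to dz on the parameter line, hence without a factor \<open>slope z\<close>; e is the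
  height of the evaluation point above the graph.\<close>

definition cauchy :: "real \<Rightarrow> real \<Rightarrow> complex" where
  "cauchy e x = (\<integral>z. of_real (\<omega> z) * ck e x z \<partial>lborel)"

lemma cauchy_measurable [measurable]: "cauchy e \<in> borel_measurable borel"
  unfolding cauchy_def by measurable

lemma ck_section_measurable [measurable]: "ck e x \<in> borel_measurable borel"
  using measurable_compose[OF measurable_Pair1' ck_measurable[of e], of x] by simp

lemma cauchy_norm:
  assumes e: "0 < e"
  shows "norm (cauchy e x) \<le> ((1 + N) / low e * om1) / (1 + \<bar>x\<bar>)"
proof -
  have i: "integrable lborel (\<lambda>z. (1 + N) / low e / (1 + \<bar>x\<bar>) * \<bar>\<omega> z\<bar>)" using om_integrable by simp
  have le: "norm (of_real (\<omega> z) * ck e x z) \<le> (1 + N) / low e / (1 + \<bar>x\<bar>) * \<bar>\<omega> z\<bar>" for z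
  proof (cases "N < \<bar>z\<bar>")
    case False
    then have "\<bar>\<omega> z\<bar> * norm (ck e x z) \<le> \<bar>\<omega> z\<bar> * ((1 + N) / low e / (1 + \<bar>x\<bar>))"
      by (intro mult_left_mono ck_norm_far[OF e]) auto
    then show ?thesis by (simp only: norm_mult norm_of_real mult.commute)
  qed (simp add: om_supp)
  have "norm (cauchy e x) \<le> (\<integral>z. (1 + N) / low e / (1 + \<bar>x\<bar>) * \<bar>\<omega> z\<bar> \<partial>lborel)"
    unfolding cauchy_def by (rule integral_norm_le_dominated(2)[OF _ i AE_I2[OF le]]) measurable
  then show ?thesis by (simp add: om1_def mult_ac)
qed

text \<open>Both \<Phi> and the kernel decay like 1 / (1 + |x|), the latter uniformly for z in the
  support of \<omega>, so the product is integrable in x.\<close>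

lemma cauchy_fubini:
  assumes e: "0 < e" and [measurable]: "\<Phi> \<in> borel_measurable borel" and bd: "\<And>x. norm (\<Phi> x) \<le> C / (1 + \<bar>x\<bar>)"
  shows "(\<integral>x. \<Phi> x * cauchy e x \<partial>lborel) = (\<integral>z. of_real (\<omega> z) * (\<integral>x. \<Phi> x * ck e x z \<partial>lborel) \<partial>lborel)"
proof -
  have C0: "0 \<le> C" using order_trans[OF norm_ge_zero bd[of 0]] by simp
  define B where "B = C * ((1 + N) / low e)"
  have B0: "0 \<le> B" using C0 N0 low_pos[OF e] by (simp add: B_def)
  have ip: "integrable (lborel \<Otimes>\<^sub>M lborel) (\<lambda>(x, z). (B * (1 / (1 + \<bar>x\<bar>)\<^sup>2)) * \<omega> z)"
  proof (rule lborel_pair.Fubini_integrable)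
    have "(\<lambda>x. \<integral>z. norm (case (x, z) of (x, z) \<Rightarrow> (B * (1 / (1 + \<bar>x\<bar>)\<^sup>2)) * \<omega> z) \<partial>lborel) = (\<lambda>x. (B * om1) * (1 / (1 + \<bar>x\<bar>)\<^sup>2))"
      using B0 by (auto simp: abs_mult om1_def fun_eq_iff)
    then show "integrable lborel (\<lambda>x. \<integral>z. norm (case (x, z) of (x, z) \<Rightarrow> (B * (1 / (1 + \<bar>x\<bar>)\<^sup>2)) * \<omega> z) \<partial>lborel)"
      using integrable_mult_right[OF integrable_inverse_square, of "B * om1"] by simp
  qed (use om_integrable in auto)
  have i: "integrable (lborel \<Otimes>\<^sub>M lborel) (\<lambda>(x, z). \<Phi> x * (of_real (\<omega> z) * ck e x z))"
  proof (rule Bochner_Integration.integrable_bound[OF ip])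
    show "AE v in lborel \<Otimes>\<^sub>M lborel. norm (case v of (x, z) \<Rightarrow> \<Phi> x * (of_real (\<omega> z) * ck e x z)) \<le> norm (case v of (x, z) \<Rightarrow> (B * (1 / (1 + \<bar>x\<bar>)\<^sup>2)) * \<omega> z)"
    proof (intro AE_I2, clarify)
      fix x z :: real
      show "norm (\<Phi> x * (of_real (\<omega> z) * ck e x z)) \<le> norm ((B * (1 / (1 + \<bar>x\<bar>)\<^sup>2)) * \<omega> z)"
      proof (cases "N < \<bar>z\<bar>")
        case False
        have "norm (\<Phi> x) * (\<bar>\<omega> z\<bar> * norm (ck e x z)) \<le> (C / (1 + \<bar>x\<bar>)) * (\<bar>\<omega> z\<bar> * ((1 + N) / low e / (1 + \<bar>x\<bar>)))"
          using bd[of x] ck_norm_far[OF e, of z N x] False C0 by (intro mult_mono mult_left_mono) auto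
        also have "\<dots> = B * (1 / (1 + \<bar>x\<bar>)\<^sup>2) * \<bar>\<omega> z\<bar>" by (simp add: B_def power2_eq_square mult_ac)
        finally show ?thesis using B0 by (simp add: norm_mult abs_mult)
      qed (simp add: om_supp)
    qed
  qed measurable
  have "(\<integral>x. \<Phi> x * cauchy e x \<partial>lborel) = (\<integral>x. \<integral>z. \<Phi> x * (of_real (\<omega> z) * ck e x z) \<partial>lborel \<partial>lborel)"
    unfolding cauchy_def by simp
  also have "\<dots> = (\<integral>z. \<integral>x. \<Phi> x * (of_real (\<omega> z) * ck e x z) \<partial>lborel \<partial>lborel)"
    by (rule lborel_pair.Fubini_integral[symmetric]) (use i in simp)
  also have "\<dots> = (\<integral>z. of_real (\<omega> z) * (\<integral>x. \<Phi> x * ck e x z \<partial>lborel) \<partial>lborel)"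
  proof (rule Bochner_Integration.integral_cong[OF refl])
    fix z
    have "(\<lambda>x. \<Phi> x * (of_real (\<omega> z) * ck e x z)) = (\<lambda>x. of_real (\<omega> z) * (\<Phi> x * ck e x z))"
      by (auto simp: mult_ac)
    then show "(\<integral>x. \<Phi> x * (of_real (\<omega> z) * ck e x z) \<partial>lborel) = of_real (\<omega> z) * (\<integral>x. \<Phi> x * ck e x z \<partial>lborel)"
      by (simp only: integral_mult_right_zero)
  qed
  finally show ?thesis .
qed

text \<open>Expanding the square and exchanging integrals twice reduces the claim to the vanishing
  of \<open>ck_pair_integral\<close> for each pair of poles.\<close>

lemma cauchy_square_integral:
  assumes e: "0 < e"
  shows "(\<integral>x. slope x * cauchy e x * cauchy e x \<partial>lborel) = 0"
proof -
  have 1: "(\<integral>x. slope x * cauchy e x * ck e x t \<partial>lborel) = 0" if t: "\<bar>t\<bar> \<le> N" for t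
  proof -
    have "(\<integral>x. (slope x * ck e x t) * cauchy e x \<partial>lborel) = (\<integral>z. of_real (\<omega> z) * (\<integral>x. (slope x * ck e x t) * ck e x z \<partial>lborel) \<partial>lborel)"
    proof (rule cauchy_fubini[OF e])
      show "(\<lambda>x. slope x * ck e x t) \<in> borel_measurable borel"
        by (intro borel_measurable_continuous_onI continuous_intros slope_cont ck_cont e)
      show "norm (slope x * ck e x t) \<le> ((1 + L) * ((1 + N) / low e)) / (1 + \<bar>x\<bar>)" for x
        using mult_mono[OF norm_slope[of x] ck_norm_far[OF e t, of x]] L0 by (simp add: norm_mult)
    qed
    also have "\<dots> = 0" by (simp add: ck_pair_integral[OF e])
    finally show ?thesis by (simp add: mult_ac)
  qed
  have "(\<integral>x. (slope x * cauchy e x) * cauchy e x \<partial>lborel) = (\<integral>z. of_real (\<omega> z) * (\<integral>x. (slope x * cauchy e x) * ck e x z \<partial>lborel) \<partial>lborel)"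
  proof (rule cauchy_fubini[OF e])
    show "norm (slope x * cauchy e x) \<le> ((1 + L) * ((1 + N) / low e * om1)) / (1 + \<bar>x\<bar>)" for x
      using mult_mono[OF norm_slope[of x] cauchy_norm[OF e, of x]] L0 by (simp add: norm_mult)
  qed measurable
  also have "\<dots> = (\<integral>z. 0 \<partial>(lborel :: real measure))"
  proof (rule Bochner_Integration.integral_cong[OF refl])
    fix z show "of_real (\<omega> z) * (\<integral>x. (slope x * cauchy e x) * ck e x z \<partial>lborel) = 0"
      using 1[of z] om_supp[of z] by (cases "N < \<bar>z\<bar>") auto
  qed
  finally show ?thesis by simp
qed

text \<open>The Cauchy integrand in the displacement y, minus on [-1, 1] the same integrand with the
  curve replaced by its tangent line and \<omega> frozen at x. What is subtracted has an explicit
  integral; what remains has a majorant independent of e.\<close>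

definition near :: "real \<Rightarrow> real \<Rightarrow> real \<Rightarrow> complex" where
  "near e x y = of_real (\<omega> (x - y)) / (chord x (x - y) + \<i> * of_real e)
     - indicator {-1..1} y *\<^sub>R (of_real (\<omega> x) / (slope x * of_real y + \<i> * of_real e))"

definition near_dom :: "real \<Rightarrow> real \<Rightarrow> real" where
  "near_dom x y = indicator {0..1} \<bar>y\<bar> * (\<Lambda> + K * H * \<bar>y\<bar> powr (\<alpha> - 1)) + \<bar>\<omega> (x - y)\<bar>"

lemma near_measurable [measurable]: "(\<lambda>(x, y). near e x y) \<in> borel_measurable (borel \<Otimes>\<^sub>M borel)"
  unfolding near_def chord_def by measurable

lemma near_section_measurable [measurable]: "near e x \<in> borel_measurable borel"
  using measurable_compose[OF measurable_Pair1' near_measurable[of e], of x] by simp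

text \<open>Both denominators have modulus at least |y| because their real part is y, whatever e is.
  One majorant therefore serves for all shifts and for the limit e = 0.\<close>

lemma near_bound:
  assumes y: "y \<noteq> 0"
  shows "norm (near e x y) \<le> near_dom x y"
proof -
  define P Q where "P = chord x (x - y) + \<i> * of_real e" and "Q = slope x * of_real y + \<i> * of_real e"
  have P: "\<bar>y\<bar> \<le> norm P" using chord_norm_ge[of x "x - y" e] by (simp add: P_def)
  have Q: "\<bar>y\<bar> \<le> norm Q" using abs_Re_le_cmod[of Q] by (simp add: Q_def)
  have nz: "P \<noteq> 0" "Q \<noteq> 0" using P Q y by auto
  have yp: "0 < \<bar>y\<bar>" using y by simp
  show ?thesis
  proof (cases "\<bar>y\<bar> \<le> 1")
    case True
    have ind: "indicator {-1..1} y = (1::real)" "indicator {0..1} \<bar>y\<bar> = (1::real)" using True by (auto simp: indicator_def)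
    \<comment> \<open>Changing the density costs a Lipschitz difference over P. Changing the
      denominator costs Q - P, from which e cancels and which is the Taylor remainder of F.\<close>
    have "near e x y = of_real (\<omega> (x - y) - \<omega> x) / P + of_real (\<omega> x) * ((Q - P) / (P * Q))"
      using nz unfolding near_def P_def[symmetric] Q_def[symmetric] by (simp add: ind field_simps)
    then have "norm (near e x y) \<le> \<bar>\<omega> (x - y) - \<omega> x\<bar> / norm P + \<bar>\<omega> x\<bar> * (norm (Q - P) / (norm P * norm Q))"
      using norm_triangle_ineq[of "of_real (\<omega> (x - y) - \<omega> x) / P" "of_real (\<omega> x) * ((Q - P) / (P * Q))"]
      by (simp add: norm_mult norm_divide flip: of_real_diff)
    also have "\<dots> \<le> (\<Lambda> * \<bar>y\<bar>) / \<bar>y\<bar> + K * ((H * \<bar>y\<bar> powr \<alpha> * \<bar>y\<bar>) / (\<bar>y\<bar> * \<bar>y\<bar>))"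
    proof (intro add_mono mult_mono frac_le)
      show "\<bar>\<omega> (x - y) - \<omega> x\<bar> \<le> \<Lambda> * \<bar>y\<bar>" using om_lip[of "x - y" x] by simp
      have "Q - P = \<i> * of_real (y * G x - (F x - F (x - y)))"
        by (simp add: complex_eq_iff Q_def P_def)
      then have "norm (Q - P) = \<bar>F x - F (x - y) - y * G x\<bar>" by (simp add: norm_mult del: of_real_diff of_real_mult)
      then show "norm (Q - P) \<le> H * \<bar>y\<bar> powr \<alpha> * \<bar>y\<bar>" using chord_near[OF True, of x] by simp
      show "\<bar>\<omega> x\<bar> \<le> K" by (rule om_bound)
    qed (use P Q yp La0 H0 K0 in \<open>auto simp: zero_less_mult_iff\<close>)
    also have "\<dots> = \<Lambda> + K * H * \<bar>y\<bar> powr (\<alpha> - 1)"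
    proof -
      have "(H * \<bar>y\<bar> powr \<alpha> * \<bar>y\<bar>) / (\<bar>y\<bar> * \<bar>y\<bar>) = H * \<bar>y\<bar> powr (\<alpha> - 1)"
        using yp by (simp add: powr_diff del: abs_mult_self_eq)
      then show ?thesis using yp by (simp only: mult.assoc) simp
    qed
    finally show ?thesis by (simp add: near_dom_def ind)
  next
    case False
    then have ind: "indicator {-1..1} y = (0::real)" by (auto simp: indicator_def)
    have "norm (near e x y) = \<bar>\<omega> (x - y)\<bar> / norm P"
      by (simp add: near_def ind P_def norm_divide)
    also have "\<dots> \<le> \<bar>\<omega> (x - y)\<bar> / 1" using P False by (intro divide_left_mono) auto
    also have "indicator {0..1} \<bar>y\<bar> = (0::real)" using False by (simp add: indicator_def)
    then have "\<bar>\<omega> (x - y)\<bar> / 1 = near_dom x y" by (simp add: near_dom_def)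
    finally show ?thesis .
  qed
qed

definition near_const :: real where
  "near_const = (\<integral>y. indicator {0..1} \<bar>y\<bar> * (\<Lambda> + K * H * \<bar>y\<bar> powr (\<alpha> - 1)) \<partial>lborel) + om1"

lemma near_dom_integral:
  shows "integrable lborel (near_dom x)" "(\<integral>y. near_dom x y \<partial>lborel) = near_const"
proof -
  have i: "integrable lborel (indicator {-1..1} :: real \<Rightarrow> real)"
    by (intro integrable_real_indicator) (auto simp: emeasure_lborel_Icc_eq)
  have i1: "integrable lborel (\<lambda>y::real. indicator {0..1} \<bar>y\<bar> * (\<Lambda> + K * H * \<bar>y\<bar> powr (\<alpha> - 1)))"
  proof (rule integrable_cong_AE_imp)
    show "integrable lborel (\<lambda>y. \<Lambda> * indicator {-1..1} y + K * H * (indicator {0..1} \<bar>y\<bar> * \<bar>y\<bar> powr (\<alpha> - 1)))"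
      using i integrable_powr_near[OF alpha] by simp
  qed (auto simp: indicator_def)
  have i2: "integrable lborel (\<lambda>y. \<bar>\<omega> (x - y)\<bar>)" "(\<integral>y. \<bar>\<omega> (x - y)\<bar> \<partial>lborel) = om1"
    using integrable_shift_iff(2)[of "\<lambda>y. \<bar>\<omega> y\<bar>" x] om_integrable integral_shift(2)[of "\<lambda>y. \<bar>\<omega> y\<bar>" x]
    by (simp_all add: om1_def)
  show "integrable lborel (near_dom x)" "(\<integral>y. near_dom x y \<partial>lborel) = near_const"
    unfolding near_dom_def[abs_def] near_const_def using i1 i2 by simp_all
qed

lemma near_bound_AE: "AE y in lborel. norm (near e x y) \<le> near_dom x y"
  using AE_lborel_singleton[of 0] by eventually_elim (rule near_bound)

lemma near_integrable: "integrable lborel (near e x)"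
  by (rule Bochner_Integration.integrable_bound[OF near_dom_integral(1)[of x]])
     (use near_bound_AE[of e x] in \<open>auto elim!: eventually_mono intro: order_trans[OF _ abs_ge_self]\<close>)

text \<open>Value of the integral of 1 / (slope x * y + i e) over [-1, 1], by the logarithmic
  primitive at the two end points.\<close>

definition slope_int :: "real \<Rightarrow> real \<Rightarrow> complex" where
  "slope_int e x = (Ln (- \<i> * slope x + of_real e) - Ln (\<i> * slope x + of_real e)) / slope x"

lemma slope_int:
  assumes e: "0 < e"
  shows "has_bochner_integral lborel (\<lambda>y. indicator {-1..1} y *\<^sub>R (1 / (slope x * of_real y + \<i> * of_real e))) (slope_int e x)"
proof -
  have nz: "slope x * of_real y + \<i> * of_real e \<noteq> 0" for y
    using e by (auto simp: complex_eq_iff)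
  have "has_bochner_integral lborel (\<lambda>y. indicator {-1..1} y *\<^sub>R (1 / (slope x * of_real y + \<i> * of_real e)))
     (Ln (- \<i> * (slope x * of_real 1 + \<i> * of_real e)) / slope x - Ln (- \<i> * (slope x * of_real (-1) + \<i> * of_real e)) / slope x)"
  proof (rule has_bochner_integral_FTC_Icc)
    fix y :: real
    have "- \<i> * (slope x * of_real y + \<i> * of_real e) \<notin> \<real>\<^sub>\<le>\<^sub>0"
      using e by (auto simp: complex_nonpos_Reals_iff)
    then have "((\<lambda>w. Ln (- \<i> * (slope x * w + \<i> * of_real e)) / slope x) has_field_derivative
       inverse (- \<i> * (slope x * of_real y + \<i> * of_real e)) * (- \<i> * slope x) / slope x) (at (of_real y))"
      by (auto intro!: derivative_eq_intros)
    also have "inverse (- \<i> * (slope x * of_real y + \<i> * of_real e)) * (- \<i> * slope x) / slope x = 1 / (slope x * of_real y + \<i> * of_real e)"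
      using slope_nz[of x] nz[of y] by (simp add: inverse_eq_divide)
    finally have "((\<lambda>w. Ln (- \<i> * (slope x * w + \<i> * of_real e)) / slope x) has_field_derivative
       1 / (slope x * of_real y + \<i> * of_real e)) (at (of_real y))" .
    from field_vector_diff_chain_at[OF has_vector_derivative_of_real[of "\<lambda>x. x" 1] this]
    have "((\<lambda>y. Ln (- \<i> * (slope x * of_real y + \<i> * of_real e)) / slope x) has_vector_derivative
       1 / (slope x * of_real y + \<i> * of_real e)) (at y)" by (simp add: o_def)
    then show "((\<lambda>y. Ln (- \<i> * (slope x * of_real y + \<i> * of_real e)) / slope x) has_vector_derivative
       1 / (slope x * of_real y + \<i> * of_real e)) (at y within {-1..1})" by (rule has_vector_derivative_at_within)
  next
    show "continuous_on {- 1..1} (\<lambda>y. 1 / (slope x * of_real y + \<i> * of_real e))"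
      by (intro continuous_intros) (use nz in auto)
  qed simp
  then show ?thesis by (simp add: slope_int_def algebra_simps diff_divide_distrib)
qed

text \<open>In the limit the arguments of the logarithms are opposite numbers, and i * slope x has
  imaginary part 1 > 0, so the principal branch contributes exactly -i \<pi>.\<close>

lemma slope_int_lim: "((\<lambda>e. slope_int e x) \<longlongrightarrow> - \<i> * pi / slope x) (at_right 0)"
proof -
  have "\<i> * slope x \<notin> \<real>\<^sub>\<le>\<^sub>0" "- (\<i> * slope x) \<notin> \<real>\<^sub>\<le>\<^sub>0" by (auto simp: complex_nonpos_Reals_iff)
  then have "((\<lambda>e. slope_int e x) \<longlongrightarrow> (Ln (- \<i> * slope x + of_real 0) - Ln (\<i> * slope x + of_real 0)) / slope x) (at_right 0)"
    unfolding slope_int_def by (intro tendsto_intros) (auto simp: slope_nz)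
  moreover have "Ln (- (\<i> * slope x)) = Ln (\<i> * slope x) - \<i> * pi"
    using slope_nz[of x] by (subst Ln_minus) auto
  ultimately show ?thesis by simp
qed

lemma slope_int_norm:
  assumes e: "0 < e" "e \<le> 1"
  shows "norm (slope_int e x) \<le> 2 * (L + 2 + pi)"
proof -
  have n: "norm (\<i> * slope x + of_real e) \<le> L + 2" "norm (- \<i> * slope x + of_real e) \<le> L + 2"
    using norm_triangle_ineq[of "\<i> * slope x" "of_real e"] norm_triangle_ineq[of "- \<i> * slope x" "of_real e"] norm_slope[of x] e
    by (simp_all add: norm_mult)
  have "norm (Ln (- \<i> * slope x + of_real e)) \<le> L + 2 + pi" "norm (Ln (\<i> * slope x + of_real e)) \<le> L + 2 + pi"
    by (rule Ln_bound[OF _ n(2)], simp, rule Ln_bound[OF _ n(1)], simp)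
  then have 1: "norm (Ln (- \<i> * slope x + of_real e) - Ln (\<i> * slope x + of_real e)) \<le> 2 * (L + 2 + pi)"
    using norm_triangle_ineq4[of "Ln (- \<i> * slope x + of_real e)" "Ln (\<i> * slope x + of_real e)"] by simp
  have s1: "1 \<le> norm (slope x)" using abs_Re_le_cmod[of "slope x"] by simp
  have "norm (slope_int e x) \<le> norm (Ln (- \<i> * slope x + of_real e) - Ln (\<i> * slope x + of_real e)) / 1"
    unfolding slope_int_def norm_divide using s1 by (intro divide_left_mono) auto
  then show ?thesis using 1 by simp
qed

lemma cauchy_split:
  assumes e: "0 < e"
  shows "cauchy e x = (\<integral>y. near e x y \<partial>lborel) + of_real (\<omega> x) * slope_int e x"
proof -
  have "cauchy e x = (\<integral>y. of_real (\<omega> (x - y)) / (chord x (x - y) + \<i> * of_real e) \<partial>lborel)"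
    unfolding cauchy_def ck_def using integral_shift(2)[of "\<lambda>z. of_real (\<omega> z) * (1 / (chord x z + \<i> * of_real e))" x] by simp
  also have "\<dots> = (\<integral>y. near e x y + of_real (\<omega> x) * (indicator {-1..1} y *\<^sub>R (1 / (slope x * of_real y + \<i> * of_real e))) \<partial>lborel)"
    by (rule Bochner_Integration.integral_cong) (auto simp: near_def)
  also have "\<dots> = (\<integral>y. near e x y \<partial>lborel) + of_real (\<omega> x) * slope_int e x"
  proof -
    note si = slope_int[OF e, of x, unfolded has_bochner_integral_iff]
    show ?thesis
      by (subst Bochner_Integration.integral_add[OF near_integrable integrable_mult_right[OF conjunct1[OF si]]])
         (simp only: integral_mult_right_zero conjunct2[OF si])
  qed
  finally show ?thesis .
qed

text \<open>The boundary value from above. The term with \<pi> is half of the Plemelj jump; the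
  regularised integral plays the part of the principal value.\<close>

definition bdry :: "real \<Rightarrow> complex" where
  "bdry x = (\<integral>y. near 0 x y \<partial>lborel) - \<i> * pi * of_real (\<omega> x) / slope x"

lemma bdry_measurable [measurable]: "bdry \<in> borel_measurable borel"
  unfolding bdry_def by measurable

lemma cauchy_tendsto:
  "(\<lambda>n. cauchy (1 / Suc n) x) \<longlonglongrightarrow> bdry x"
proof -
  have e0: "(\<lambda>n. 1 / real (Suc n)) \<longlonglongrightarrow> 0" using LIMSEQ_Suc[OF lim_1_over_n] by simp
  have fl: "filterlim (\<lambda>n. 1 / real (Suc n)) (at_right 0) sequentially"
    using e0 by (auto simp: filterlim_at intro!: always_eventually)
  have "(\<lambda>n. \<integral>y. near (1 / Suc n) x y \<partial>lborel) \<longlonglongrightarrow> (\<integral>y. near 0 x y \<partial>lborel)"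
  proof (rule integral_dominated_convergence)
    show "integrable lborel (near_dom x)" by (rule near_dom_integral)
    show "AE y in lborel. norm (near (1 / real (Suc n)) x y) \<le> near_dom x y" for n by (rule near_bound_AE)
    show "AE y in lborel. (\<lambda>n. near (1 / real (Suc n)) x y) \<longlonglongrightarrow> near 0 x y"
      using AE_lborel_singleton[of 0]
    proof eventually_elim
      case (elim y)
      have "chord x (x - y) + \<i> * of_real 0 \<noteq> 0" "slope x * of_real y + \<i> * of_real 0 \<noteq> 0"
        using elim by (auto simp: complex_eq_iff)
      then show ?case unfolding near_def by (intro tendsto_intros e0)
    qed
  qed measurable
  then have "(\<lambda>n. (\<integral>y. near (1 / Suc n) x y \<partial>lborel) + of_real (\<omega> x) * slope_int (1 / Suc n) x) \<longlonglongrightarrow>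
      (\<integral>y. near 0 x y \<partial>lborel) + of_real (\<omega> x) * (- \<i> * pi / slope x)"
    by (intro tendsto_intros filterlim_compose[OF slope_int_lim fl])
  then show ?thesis by (simp add: cauchy_split bdry_def mult_ac)
qed

definition bdry_const :: real where
  "bdry_const = (near_const + K * (2 * (L + 2 + pi))) * (2 * N + 2) + 2 * om1"

text \<open>\<open>cauchy_norm\<close> degenerates as e tends to 0; this version supplies the
  dominating function for the limit. Near the support the majorant of \<open>near\<close> is used,
  far away the real part of the chord.\<close>

lemma cauchy_uniform:
  assumes e: "0 < e" "e \<le> 1"
  shows "norm (cauchy e x) \<le> bdry_const / (1 + \<bar>x\<bar>)"
proof -
  define B where "B = near_const + K * (2 * (L + 2 + pi))"
  have "norm (\<integral>y. near e x y \<partial>lborel) \<le> (\<integral>y. near_dom x y \<partial>lborel)"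
    by (rule integral_norm_le_dominated(2)[OF _ near_dom_integral(1) near_bound_AE]) measurable
  moreover have "\<bar>\<omega> x\<bar> * norm (slope_int e x) \<le> K * (2 * (L + 2 + pi))"
    using slope_int_norm[OF e, of x] om_bound[of x] K0 by (intro mult_mono) auto
  ultimately have "norm (cauchy e x) \<le> B"
    unfolding cauchy_split[OF e(1)] B_def near_dom_integral(2)
    by (intro order_trans[OF norm_triangle_ineq] add_mono) (simp_all add: norm_mult)
  have B0: "0 \<le> B" using \<open>norm (cauchy e x) \<le> B\<close> norm_ge_zero order_trans by blast
  show ?thesis
  \<comment> \<open>Beyond 2 * N + 1 every z in the support satisfies |x - z| \<ge> (1 + |x|) / 2;
    below it 1 + |x| \<le> 2 * N + 2.\<close>
  proof (cases "\<bar>x\<bar> \<le> 2 * N + 1")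
    case True
    have "B * (1 + \<bar>x\<bar>) \<le> B * (2 * N + 2)" using True B0 by (intro mult_left_mono) auto
    then have "B * (1 + \<bar>x\<bar>) \<le> bdry_const" using om1_ge0 by (simp add: bdry_const_def B_def)
    then have "B \<le> bdry_const / (1 + \<bar>x\<bar>)" by (simp add: pos_le_divide_eq add_pos_nonneg)
    then show ?thesis using \<open>norm (cauchy e x) \<le> B\<close> by simp
  next
    case False
    have i: "integrable lborel (\<lambda>z. 2 / (1 + \<bar>x\<bar>) * \<bar>\<omega> z\<bar>)" using om_integrable by simp
    have le: "norm (of_real (\<omega> z) * ck e x z) \<le> 2 / (1 + \<bar>x\<bar>) * \<bar>\<omega> z\<bar>" for z
    proof (cases "N < \<bar>z\<bar>")
      case zN: False
      have "(1 + \<bar>x\<bar>) / 2 \<le> \<bar>x - z\<bar>" using False zN abs_triangle_ineq[of "x - z" z] by (simp add: field_simps)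
      then have d: "(1 + \<bar>x\<bar>) / 2 \<le> norm (chord x z + \<i> * of_real e)" using chord_norm_ge[of x z e] by linarith
      have "norm (ck e x z) \<le> 1 / ((1 + \<bar>x\<bar>) / 2)"
        unfolding ck_def norm_divide norm_one using d by (intro frac_le) auto
      then show ?thesis using mult_right_mono[of "norm (ck e x z)" "2 / (1 + \<bar>x\<bar>)" "\<bar>\<omega> z\<bar>"] by (simp add: norm_mult mult.commute)
    qed (simp add: om_supp)
    have "norm (cauchy e x) \<le> (\<integral>z. 2 / (1 + \<bar>x\<bar>) * \<bar>\<omega> z\<bar> \<partial>lborel)"
      unfolding cauchy_def by (rule integral_norm_le_dominated(2)[OF _ i AE_I2[OF le]]) measurable
    also have "\<dots> = 2 * om1 / (1 + \<bar>x\<bar>)" by (simp add: om1_def)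
    also have "\<dots> \<le> bdry_const / (1 + \<bar>x\<bar>)"
      using B0 N0 by (intro divide_right_mono) (simp_all add: bdry_const_def B_def)
    finally show ?thesis .
  qed
qed

lemma bdry_norm: "norm (bdry x) \<le> bdry_const / (1 + \<bar>x\<bar>)"
  by (rule LIMSEQ_le_const2[OF tendsto_norm[OF cauchy_tendsto]]) (auto intro!: exI[of _ 0] cauchy_uniform)

lemma bdry_square_integral:
  shows "integrable lborel (\<lambda>x. slope x * bdry x * bdry x)" "(\<integral>x. slope x * bdry x * bdry x \<partial>lborel) = 0"
proof -
  define C where "C = (1 + L) * bdry_const * bdry_const"
  have b0: "0 \<le> bdry_const / (1 + \<bar>x\<bar>)" for x using bdry_norm[of x] norm_ge_zero order_trans by blast
  have bc: "0 \<le> bdry_const" using b0[of 0] by simp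
  have sq: "norm (slope x * u * u) \<le> C * (1 / (1 + \<bar>x\<bar>)\<^sup>2)" if "norm u \<le> bdry_const / (1 + \<bar>x\<bar>)" for x u
  proof -
    have "norm (slope x * u * u) \<le> (1 + L) * (bdry_const / (1 + \<bar>x\<bar>)) * (bdry_const / (1 + \<bar>x\<bar>))"
      unfolding norm_mult using norm_slope[of x] that L0 bc by (intro mult_mono) auto
    also have "\<dots> = C * (1 / (1 + \<bar>x\<bar>)\<^sup>2)" by (simp add: power2_eq_square C_def)
    finally show ?thesis .
  qed
  have i: "integrable lborel (\<lambda>x. C * (1 / (1 + \<bar>x\<bar>)\<^sup>2))"
    by (rule integrable_mult_right[OF integrable_inverse_square])
  show "integrable lborel (\<lambda>x. slope x * bdry x * bdry x)"
    by (rule Bochner_Integration.integrable_bound[OF i])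
       (auto intro!: AE_I2 order_trans[OF sq[OF bdry_norm]] simp del: times_divide_eq_right)
  have "(\<lambda>n. \<integral>x. slope x * cauchy (1 / Suc n) x * cauchy (1 / Suc n) x \<partial>lborel) \<longlonglongrightarrow> (\<integral>x. slope x * bdry x * bdry x \<partial>lborel)"
  proof (rule integral_dominated_convergence[OF _ _ i])
    show "AE x in lborel. (\<lambda>n. slope x * cauchy (1 / real (Suc n)) x * cauchy (1 / real (Suc n)) x) \<longlonglongrightarrow> slope x * bdry x * bdry x"
      by (intro AE_I2 tendsto_intros cauchy_tendsto)
    show "AE x in lborel. norm (slope x * cauchy (1 / real (Suc n)) x * cauchy (1 / real (Suc n)) x) \<le> C * (1 / (1 + \<bar>x\<bar>)\<^sup>2)" for n
      by (intro AE_I2 sq cauchy_uniform) auto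
  qed measurable
  then show "(\<integral>x. slope x * bdry x * bdry x \<partial>lborel) = 0"
    using LIMSEQ_unique[OF _ tendsto_const] by (force simp: cauchy_square_integral)
qed

end

declare om_measurable [measurable del] cauchy_measurable [measurable del] ck_section_measurable [measurable del]
  near_measurable [measurable del] near_section_measurable [measurable del] bdry_measurable [measurable del]

end

section \<open>The operators A and B, and facts about square integrable functions\<close>

definition A_ker :: "(real \<Rightarrow> real) \<Rightarrow> (real \<Rightarrow> real) \<Rightarrow> real \<Rightarrow> real \<Rightarrow> real" where
  "A_ker F G x y = (y * G x - (F x - F (x - y))) / (y\<^sup>2 + (F x - F (x - y))\<^sup>2)"

definition A_op :: "(real \<Rightarrow> real) \<Rightarrow> (real \<Rightarrow> real) \<Rightarrow> (real \<Rightarrow> real) \<Rightarrow> real \<Rightarrow> real" where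
  "A_op F G u x = (1 / pi) * kop (A_ker F G) u x"

text \<open>The tangential companion of \<open>A_op\<close>; the principal value is regularised by subtracting the odd
  kernel \<open>1/y\<close> on \<open>[-1, 1]\<close>.\<close>
definition B_op :: "(real \<Rightarrow> real) \<Rightarrow> (real \<Rightarrow> real) \<Rightarrow> (real \<Rightarrow> real) \<Rightarrow> real \<Rightarrow> real" where
  "B_op F G u x = (1 / pi) * (\<integral>y. (y + G x * (F x - F (x - y))) / (y\<^sup>2 + (F x - F (x - y))\<^sup>2) * u (x - y)
      - indicator {-1..1} y * u x / y \<partial>lborel)"

lemma L2_iff: "u \<in> Lp 2 \<longleftrightarrow> u \<in> borel_measurable borel \<and> integrable lborel (\<lambda>x. (u x)\<^sup>2)"
  by (simp add: Lp_def)

lemma L2_norm_square: "(Lp_norm 2 u)\<^sup>2 = (\<integral>x. (u x)\<^sup>2 \<partial>lborel)"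
  using Lp_norm_powr[of 2 u] Lp_norm_ge0[of 2 u] by simp

lemma L2_prod:
  assumes u: "u \<in> Lp 2" and v: "v \<in> Lp 2" and [measurable]: "m \<in> borel_measurable borel" and B: "\<And>x. \<bar>m x\<bar> \<le> B"
  shows "integrable lborel (\<lambda>x. m x * (u x * v x))"
proof (rule Bochner_Integration.integrable_bound)
  show "integrable lborel (\<lambda>x. B * ((u x)\<^sup>2 + (v x)\<^sup>2))" using u v by (simp add: L2_iff)
  show "AE x in lborel. norm (m x * (u x * v x)) \<le> norm (B * ((u x)\<^sup>2 + (v x)\<^sup>2))"
  proof (intro AE_I2)
    fix x
    have B0: "0 \<le> B" using B[of 0] by linarith
    have "\<bar>u x * v x\<bar> \<le> (u x)\<^sup>2 + (v x)\<^sup>2"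
    proof -
      have "2 * (\<bar>u x\<bar> * \<bar>v x\<bar>) \<le> (u x)\<^sup>2 + (v x)\<^sup>2"
        using sum_squares_bound[of "\<bar>u x\<bar>" "\<bar>v x\<bar>"] by (simp add: mult.assoc)
      moreover have "0 \<le> \<bar>u x\<bar> * \<bar>v x\<bar>" by simp
      ultimately show ?thesis unfolding abs_mult by linarith
    qed
    then have "\<bar>m x\<bar> * \<bar>u x * v x\<bar> \<le> B * ((u x)\<^sup>2 + (v x)\<^sup>2)" using B[of x] B0 by (intro mult_mono) auto
    then show "norm (m x * (u x * v x)) \<le> norm (B * ((u x)\<^sup>2 + (v x)\<^sup>2))" using B0 by (simp add: abs_mult)
  qed
qed (simp add: borel_measurable_times assms(3) Lp_measurable[OF u] Lp_measurable[OF v])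

lemma L2_decay:
  fixes u :: "real \<Rightarrow> real"
  assumes "u \<in> borel_measurable borel" and C: "\<And>x. \<bar>u x\<bar> \<le> C / (1 + \<bar>x\<bar>)"
  shows "u \<in> Lp 2"
  unfolding L2_iff
proof
  show "integrable lborel (\<lambda>x. (u x)\<^sup>2)"
  proof (rule Bochner_Integration.integrable_bound)
    show "integrable lborel (\<lambda>x. C\<^sup>2 * (1 / (1 + \<bar>x\<bar>)\<^sup>2))" by (rule integrable_mult_right[OF integrable_inverse_square])
    show "AE x in lborel. norm ((u x)\<^sup>2) \<le> norm (C\<^sup>2 * (1 / (1 + \<bar>x\<bar>)\<^sup>2))"
    proof (intro AE_I2)
      fix x
      have "\<bar>u x\<bar>\<^sup>2 \<le> (C / (1 + \<bar>x\<bar>))\<^sup>2" by (intro power_mono C) auto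
      then show "norm ((u x)\<^sup>2) \<le> norm (C\<^sup>2 * (1 / (1 + \<bar>x\<bar>)\<^sup>2))" by (simp add: power_divide)
    qed
  qed (use assms in measurable)
qed fact

lemma test_fun_lipschitz:
  assumes "test_fun \<phi>"
  obtains \<Lambda> where "\<And>x y. \<bar>\<phi> x - \<phi> y\<bar> \<le> \<Lambda> * \<bar>x - y\<bar>"
proof -
  obtain N where N: "\<And>x. N < \<bar>x\<bar> \<Longrightarrow> deriv \<phi> x = 0" using test_fun_support[OF assms] by metis
  obtain \<Lambda> where K: "\<And>x. \<bar>deriv \<phi> x\<bar> \<le> \<Lambda>"
    using continuous_compact_support_bounded[OF test_fun_deriv_cont[OF assms] N] by metis
  have "\<bar>\<phi> x - \<phi> y\<bar> \<le> \<Lambda> * \<bar>x - y\<bar>" for x y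
    using field_differentiable_bound[of UNIV \<phi> "deriv \<phi>" \<Lambda> x y] test_fun_deriv[OF assms] K by auto
  then show ?thesis by (rule that)
qed

section \<open>Rellich identities from the upper and from the lower side\<close>

context graph
begin

text \<open>The reciprocal of |slope x|^2, which appears when slope * bdry^2 is written as (slope *
  bdry)^2 / slope.\<close>

definition wt :: "real \<Rightarrow> real" where "wt x = 1 / (1 + (G x)\<^sup>2)"

lemma wt_pos: "0 < wt x" by (simp add: wt_def add_pos_nonneg)
lemma wt_le1: "wt x \<le> 1" by (simp add: wt_def divide_le_eq add_pos_nonneg)
lemma wt_ge: "1 / (1 + L\<^sup>2) \<le> wt x"
proof -
  have "\<bar>G x\<bar>\<^sup>2 \<le> L\<^sup>2" by (intro power_mono G_bound) auto
  then show ?thesis unfolding wt_def by (intro divide_left_mono) (auto simp: add_pos_nonneg)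
qed

lemma wt_measurable [measurable]: "wt \<in> borel_measurable borel"
  unfolding wt_def by measurable

text \<open>Multiplied by the slope, the boundary value becomes \<pi> (b + i (a - \<omega>)); the
  identity is the real part of the vanishing integral of slope * bdry^2 in these terms. The decay of
  bdry also places a and b in \<open>L_2\<close> for test functions, which covers B without a
  separate boundedness theory.\<close>

lemma rellich_upper:
  assumes t: "test_fun \<omega>"
  defines "a \<equiv> A_op F G \<omega>" and "b \<equiv> B_op F G \<omega>"
  shows "a \<in> Lp 2" "b \<in> Lp 2"
    "integrable lborel (\<lambda>x. wt x * ((b x)\<^sup>2 - (a x - \<omega> x)\<^sup>2 + 2 * G x * b x * (a x - \<omega> x)))"
    "(\<integral>x. wt x * ((b x)\<^sup>2 - (a x - \<omega> x)\<^sup>2 + 2 * G x * b x * (a x - \<omega> x)) \<partial>lborel) = 0"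
proof -
  obtain K where K: "\<And>x. \<bar>\<omega> x\<bar> \<le> K" using test_fun_bounded[OF t] by metis
  obtain N where N: "0 < N" "\<And>x. N < \<bar>x\<bar> \<Longrightarrow> \<omega> x = 0" using test_fun_support[OF t] by metis
  obtain \<Lambda> where La: "\<And>x y. \<bar>\<omega> x - \<omega> y\<bar> \<le> \<Lambda> * \<bar>x - y\<bar>" using test_fun_lipschitz[OF t] by metis
  note om = K N(2) N(1) La test_fun_isCont(1)[OF t]
  note near_int = near_integrable[OF om]
  note bnorm = bdry_norm[OF om]
  note bsq = bdry_square_integral[OF om]
  note bme[measurable] = bdry_measurable[OF om]
  define D where "D = bdry \<omega>"
  define C where "C = (1 + L) * bdry_const \<omega> K \<Lambda> N"
  have [measurable]: "D \<in> borel_measurable borel" unfolding D_def by (rule bme)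
  \<comment> \<open>slope / chord has the kernel of B as real part and that of A as imaginary part.
    The subtracted tangent model becomes the real term \<omega> x / y, so A needs no
    regularisation.\<close>
  have pt: "slope x * near \<omega> 0 x y = Complex ((y + G x * (F x - F (x - y))) / (y\<^sup>2 + (F x - F (x - y))\<^sup>2) * \<omega> (x - y)
      - indicator {-1..1} y * \<omega> x / y) (A_ker F G x y * \<omega> (x - y))" for x y
  proof -
    define q where "q = slope x / chord x (x - y)"
    have "slope x * near \<omega> 0 x y = of_real (\<omega> (x - y)) * q - of_real (indicator {-1..1} y * \<omega> x / y)"
      using slope_nz[of x] by (cases "y = 0") (auto simp: near_def[OF om] q_def right_diff_distrib scaleR_conv_of_real)
    also have "\<dots> = Complex (Re q * \<omega> (x - y) - indicator {-1..1} y * \<omega> x / y) (Im q * \<omega> (x - y))"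
      by (simp add: complex_eq_iff)
    also have "Re q = (y + G x * (F x - F (x - y))) / (y\<^sup>2 + (F x - F (x - y))\<^sup>2)"
      by (simp add: q_def Re_divide)
    also have "Im q = A_ker F G x y"
      by (simp add: q_def Im_divide A_ker_def mult.commute)
    finally show ?thesis .
  qed
  have val: "slope x * D x = of_real pi * Complex (b x) (a x - \<omega> x)" for x
  proof -
    have i: "integrable lborel (\<lambda>y. slope x * near \<omega> 0 x y)" using near_int by (intro integrable_mult_right)
    have "slope x * D x = (\<integral>y. slope x * near \<omega> 0 x y \<partial>lborel) - \<i> * pi * of_real (\<omega> x)"
      using slope_nz[of x] by (simp add: D_def bdry_def[OF om] right_diff_distrib)
    then show ?thesis
      using integral_Re[OF i] integral_Im[OF i]
      by (simp add: complex_eq_iff pt a_def b_def A_op_def B_op_def kop_def right_diff_distrib)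
  qed
  have Re: "b x = Re (slope x * D x) / pi" and Im: "a x = Im (slope x * D x) / pi + \<omega> x" for x
    by (simp_all add: val)
  have nb: "norm (slope x * D x) \<le> C / (1 + \<bar>x\<bar>)" for x
    using mult_mono[OF norm_slope[of x] bnorm[of x]] L0 by (simp add: norm_mult C_def D_def)
  have pi1: "1 \<le> pi" using pi_gt3 by linarith
  have bl: "\<bar>b x\<bar> \<le> C / (1 + \<bar>x\<bar>)" and al: "\<bar>a x - \<omega> x\<bar> \<le> C / (1 + \<bar>x\<bar>)" for x
  proof -
    have "\<bar>b x\<bar> \<le> \<bar>Re (slope x * D x)\<bar> / 1" unfolding Re abs_divide using pi1 by (intro divide_left_mono) auto
    then show "\<bar>b x\<bar> \<le> C / (1 + \<bar>x\<bar>)" using abs_Re_le_cmod[of "slope x * D x"] nb[of x] by linarith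
    have "\<bar>a x - \<omega> x\<bar> \<le> \<bar>Im (slope x * D x)\<bar> / 1" unfolding Im using pi1 by (simp add: divide_le_eq mult_le_cancel_left1)
    then show "\<bar>a x - \<omega> x\<bar> \<le> C / (1 + \<bar>x\<bar>)" using abs_Im_le_cmod[of "slope x * D x"] nb[of x] by linarith
  qed
  have om2: "\<omega> \<in> Lp 2" by (rule test_fun_Lp[OF t]) simp
  have [measurable]: "\<omega> \<in> borel_measurable borel" by (rule test_fun_measurable[OF t])
  have bm: "b \<in> borel_measurable borel" and am: "a \<in> borel_measurable borel"
    using borel_measurable_complex_iff[of "\<lambda>x. slope x * D x" borel]
    by (simp_all add: Re[abs_def] Im[abs_def])
  show b2: "b \<in> Lp 2" by (rule L2_decay[OF bm bl])
  have "(\<lambda>x. a x - \<omega> x) \<in> Lp 2" by (rule L2_decay[OF _ al]) (use am in measurable)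
  from Lp_add(1)[OF _ this om2] show "a \<in> Lp 2" by simp
  have sq: "wt x * ((b x)\<^sup>2 - (a x - \<omega> x)\<^sup>2 + 2 * G x * b x * (a x - \<omega> x)) = (1 / pi\<^sup>2) * Re (slope x * D x * D x)" for x
  proof -
    define v where "v = Complex (b x) (a x - \<omega> x)"
    have "D x = of_real pi * v / slope x" using val[of x] slope_nz[of x] by (simp add: v_def field_simps)
    then have "slope x * D x * D x = of_real (pi\<^sup>2) * (v * v / slope x)"
      using slope_nz[of x] by (simp add: power2_eq_square)
    moreover have "Re (of_real r * z) = r * Re z" for r z by simp
    ultimately have "Re (slope x * D x * D x) = pi\<^sup>2 * Re (v * v / slope x)" by (simp only:)
    also have "Re (v * v / slope x) = wt x * ((b x)\<^sup>2 - (a x - \<omega> x)\<^sup>2 + 2 * G x * b x * (a x - \<omega> x))"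
    proof -
      have "Re (v * v) = (b x)\<^sup>2 - (a x - \<omega> x)\<^sup>2" "Im (v * v) = 2 * b x * (a x - \<omega> x)"
        by (simp_all add: v_def power2_eq_square)
      moreover have "Re (v * v / slope x) = (Re (v * v) + Im (v * v) * G x) / (1 + (G x)\<^sup>2)"
        by (simp only: Re_divide slope_Re slope_Im mult_1_right power_one)
      ultimately show ?thesis by (simp add: wt_def mult_ac)
    qed
    finally show ?thesis by simp
  qed
  note i = bsq(1)[folded D_def]
  show "integrable lborel (\<lambda>x. wt x * ((b x)\<^sup>2 - (a x - \<omega> x)\<^sup>2 + 2 * G x * b x * (a x - \<omega> x)))"
    unfolding sq using i by (intro integrable_mult_right integrable_Re)
  show "(\<integral>x. wt x * ((b x)\<^sup>2 - (a x - \<omega> x)\<^sup>2 + 2 * G x * b x * (a x - \<omega> x)) \<partial>lborel) = 0"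
    unfolding sq using integral_Re[OF i] bsq(2)[folded D_def] by simp
qed

lemma graph_minus: "graph p L M H \<alpha> (\<lambda>x. - F x) (\<lambda>x. - G x)"
proof
  show "\<bar>- G x - - G y\<bar> \<le> H * \<bar>x - y\<bar> powr \<alpha>" if "\<bar>x - y\<bar> \<le> 1" for x y
    using holder[OF that] by simp
  show "(\<lambda>x. - G x) \<in> Lp p" using G_Lp p by (auto simp: Lp_def)
qed (use p deriv_F G_bound F_bound alpha H0 F_decay in \<open>auto intro: DERIV_minus\<close>)

end

lemma A_op_minus: "A_op (\<lambda>x. - F x) (\<lambda>x. - G x) u x = - A_op F G u x"
proof -
  have "A_ker (\<lambda>x. - F x) (\<lambda>x. - G x) x y = - A_ker F G x y" for x y
  proof -
    have "(- F x - - F (x - y))\<^sup>2 = (F x - F (x - y))\<^sup>2" by (simp add: power2_eq_square algebra_simps)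
    then show ?thesis by (simp add: A_ker_def minus_divide_left algebra_simps)
  qed
  then show ?thesis by (simp add: A_op_def kop_def)
qed

lemma B_op_minus: "B_op (\<lambda>x. - F x) (\<lambda>x. - G x) u x = B_op F G u x"
proof -
  have "(- F x - - F (x - y))\<^sup>2 = (F x - F (x - y))\<^sup>2" "- G x * (- F x - - F (x - y)) = G x * (F x - F (x - y))" for x y
    by (simp_all add: power2_eq_square algebra_simps)
  then show ?thesis unfolding B_op_def by presburger
qed

context graph
begin

text \<open>Reflection F to -F exchanges the two sides of the graph. It reverses the sign of A,
  keeps B, and so turns a - \<omega> into a + \<omega> in the upper identity.\<close>

lemma rellich_lower:
  assumes t: "test_fun \<omega>"
  defines "a \<equiv> A_op F G \<omega>" and "b \<equiv> B_op F G \<omega>"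
  shows "integrable lborel (\<lambda>x. wt x * ((b x)\<^sup>2 - (a x + \<omega> x)\<^sup>2 + 2 * G x * b x * (a x + \<omega> x)))"
    "(\<integral>x. wt x * ((b x)\<^sup>2 - (a x + \<omega> x)\<^sup>2 + 2 * G x * b x * (a x + \<omega> x)) \<partial>lborel) = 0"
proof -
  interpret m: graph p L M H \<alpha> "\<lambda>x. - F x" "\<lambda>x. - G x" by (rule graph_minus)
  have eq: "m.wt x * ((B_op (\<lambda>x. - F x) (\<lambda>x. - G x) \<omega> x)\<^sup>2 - (A_op (\<lambda>x. - F x) (\<lambda>x. - G x) \<omega> x - \<omega> x)\<^sup>2 +
         2 * - G x * B_op (\<lambda>x. - F x) (\<lambda>x. - G x) \<omega> x * (A_op (\<lambda>x. - F x) (\<lambda>x. - G x) \<omega> x - \<omega> x))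
     = wt x * ((b x)\<^sup>2 - (a x + \<omega> x)\<^sup>2 + 2 * G x * b x * (a x + \<omega> x))" for x
    unfolding A_op_minus B_op_minus a_def b_def m.wt_def wt_def
    by (simp add: power2_eq_square algebra_simps)
  show "integrable lborel (\<lambda>x. wt x * ((b x)\<^sup>2 - (a x + \<omega> x)\<^sup>2 + 2 * G x * b x * (a x + \<omega> x)))"
    "(\<integral>x. wt x * ((b x)\<^sup>2 - (a x + \<omega> x)\<^sup>2 + 2 * G x * b x * (a x + \<omega> x)) \<partial>lborel) = 0"
    using m.rellich_upper(3,4)[OF t] unfolding eq by auto
qed

text \<open>The factor 1 + L^2 is the price of removing the weight; the rest comes from inserting
  the bound on b, with constant 2 * (1 + 2 * L^2), into the bound on \<omega>.\<close>

definition rellich_const :: real where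
  "rellich_const = sqrt ((1 + L\<^sup>2) * (2 * (1 + 2 * L\<^sup>2 * (1 + 2 * L\<^sup>2))))"

text \<open>With g = lam * \<omega> - a, two combinations of the identities are used. The first
  controls b by g, the second controls \<omega> by g and b. Neither constant involves lam, as the
  continuity method requires.\<close>

lemma rellich_estimate_test:
  assumes t: "test_fun \<omega>" and lam: "1 \<le> \<bar>lam\<bar>"
  shows "Lp_norm 2 \<omega> \<le> rellich_const * Lp_norm 2 (\<lambda>x. lam * \<omega> x - A_op F G \<omega> x)"
proof -
  define a b where "a = A_op F G \<omega>" and "b = B_op F G \<omega>"
  define g where "g x = lam * \<omega> x - a x" for x
  note up = rellich_upper[OF t, folded a_def b_def] and lo = rellich_lower[OF t, folded a_def b_def]
  define U V where "U x = wt x * ((b x)\<^sup>2 - (a x - \<omega> x)\<^sup>2 + 2 * G x * b x * (a x - \<omega> x))"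
    and "V x = wt x * ((b x)\<^sup>2 - (a x + \<omega> x)\<^sup>2 + 2 * G x * b x * (a x + \<omega> x))" for x
  have UV: "integrable lborel U" "integrable lborel V" "(\<integral>x. U x \<partial>lborel) = 0" "(\<integral>x. V x \<partial>lborel) = 0"
    unfolding U_def[abs_def] V_def[abs_def] by (rule up(3) up(4) lo)+
  have o2: "\<omega> \<in> Lp 2" by (rule test_fun_Lp[OF t]) simp
  have g2: "g \<in> Lp 2" using Lp_comb[OF _ o2 up(1), of lam "-1"] by (simp add: g_def[abs_def])
  have wb: "\<bar>wt x\<bar> \<le> 1" for x using wt_pos[of x] wt_le1[of x] by simp
  have ib: "integrable lborel (\<lambda>x. wt x * (b x)\<^sup>2)" and ig: "integrable lborel (\<lambda>x. wt x * (g x)\<^sup>2)" and io: "integrable lborel (\<lambda>x. wt x * (\<omega> x)\<^sup>2)"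
    unfolding power2_eq_square by (rule L2_prod[OF _ _ wt_measurable wb]; fact up(2) g2 o2)+
  have lam2: "1 \<le> lam\<^sup>2" using lam by (metis abs_ge_zero one_le_power power2_abs)
  have Gx: "(G x)\<^sup>2 \<le> L\<^sup>2" for x using power_mono[OF G_bound[of x], of 2] by simp
  define P \<Gamma> Q where "P = (\<integral>x. wt x * (b x)\<^sup>2 \<partial>lborel)" and "\<Gamma> = (\<integral>x. wt x * (g x)\<^sup>2 \<partial>lborel)" and "Q = (\<integral>x. wt x * (\<omega> x)\<^sup>2 \<partial>lborel)"
  \<comment> \<open>The right side integrates to zero; pointwise it is wt times b^2 + (lam^2 - 1)
    \<omega>^2 - g^2 - 2 G b g. The square (b - 2 G g)^2 absorbs the mixed term at the cost of half
    of b^2.\<close>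
  have 1: "(\<integral>x. (1/2) * (wt x * (b x)\<^sup>2) - (1 + 2 * L\<^sup>2) * (wt x * (g x)\<^sup>2) \<partial>lborel) \<le> (\<integral>x. (1/2 + lam/2) * U x + (1/2 - lam/2) * V x \<partial>lborel)"
  proof (rule integral_mono)
    fix x
    have "(b x)\<^sup>2 / 2 - (1 + 2 * L\<^sup>2) * (g x)\<^sup>2 \<le> (b x)\<^sup>2 - (g x)\<^sup>2 - 2 * G x * b x * g x"
    proof -
      have "0 \<le> (b x - 2 * (G x * g x))\<^sup>2" by simp
      moreover have "(G x)\<^sup>2 * (g x)\<^sup>2 \<le> L\<^sup>2 * (g x)\<^sup>2" using Gx by (intro mult_right_mono) auto
      ultimately show ?thesis by (simp add: power2_eq_square algebra_simps)
    qed
    moreover have "0 \<le> (lam\<^sup>2 - 1) * (\<omega> x)\<^sup>2" using lam2 by simp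
    ultimately have "(b x)\<^sup>2 / 2 - (1 + 2 * L\<^sup>2) * (g x)\<^sup>2 \<le> (b x)\<^sup>2 + (lam\<^sup>2 - 1) * (\<omega> x)\<^sup>2 - (g x)\<^sup>2 - 2 * G x * b x * g x"
      by linarith
    then have "wt x * ((b x)\<^sup>2 / 2 - (1 + 2 * L\<^sup>2) * (g x)\<^sup>2) \<le> wt x * ((b x)\<^sup>2 + (lam\<^sup>2 - 1) * (\<omega> x)\<^sup>2 - (g x)\<^sup>2 - 2 * G x * b x * g x)"
      using wt_pos[of x] by (intro mult_left_mono) auto
    also have "(b x)\<^sup>2 + (lam\<^sup>2 - 1) * (\<omega> x)\<^sup>2 - (g x)\<^sup>2 - 2 * G x * b x * g x =
       (1/2 + lam/2) * ((b x)\<^sup>2 - (a x - \<omega> x)\<^sup>2 + 2 * G x * b x * (a x - \<omega> x))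
     + (1/2 - lam/2) * ((b x)\<^sup>2 - (a x + \<omega> x)\<^sup>2 + 2 * G x * b x * (a x + \<omega> x))"
      by (simp add: g_def power2_eq_square field_simps)
    finally show "(1/2) * (wt x * (b x)\<^sup>2) - (1 + 2 * L\<^sup>2) * (wt x * (g x)\<^sup>2) \<le> (1/2 + lam/2) * U x + (1/2 - lam/2) * V x"
      by (simp add: U_def V_def algebra_simps)
  qed (use ib ig UV in auto)
  have P: "P \<le> 2 * (1 + 2 * L\<^sup>2) * \<Gamma>"
  proof -
    have "(1/2) * P - (1 + 2 * L\<^sup>2) * \<Gamma> \<le> 0" using 1 ib ig UV by (simp add: P_def \<Gamma>_def)
    then show ?thesis by (simp add: algebra_simps)
  qed
  define s where "s = sgn lam"
  have s: "s * lam = \<bar>lam\<bar>" "s * s = 1" using lam by (auto simp: s_def sgn_if)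
  \<comment> \<open>In a quarter of the difference all squares cancel and a \<omega> - G b \<omega>
    is left; with a = lam * \<omega> - g and the sign s of lam this contains |lam| \<omega>^2 \<ge>
    \<omega>^2. Each mixed term absorbs a quarter of \<omega>^2.\<close>
  have 2: "(\<integral>x. (1/2) * (wt x * (\<omega> x)\<^sup>2) - wt x * (g x)\<^sup>2 - L\<^sup>2 * (wt x * (b x)\<^sup>2) \<partial>lborel) \<le> (\<integral>x. (s/4) * U x - (s/4) * V x \<partial>lborel)"
  proof (rule integral_mono)
    fix x
    have "(\<omega> x)\<^sup>2 \<le> \<bar>lam\<bar> * (\<omega> x)\<^sup>2" using lam by (simp add: mult_le_cancel_right1)
    moreover have "0 \<le> (\<omega> x / 2 - s * g x)\<^sup>2" "0 \<le> (\<omega> x / 2 - s * (G x * b x))\<^sup>2" by simp_all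
    moreover have "(\<omega> x / 2 - s * v)\<^sup>2 = (\<omega> x)\<^sup>2 / 4 - s * (\<omega> x * v) + v\<^sup>2" for v
    proof -
      have "(\<omega> x / 2 - s * v)\<^sup>2 = (\<omega> x)\<^sup>2 / 4 - s * (\<omega> x * v) + (s * s) * v\<^sup>2"
        by (simp add: power2_eq_square field_simps)
      then show ?thesis using s(2) by simp
    qed
    moreover have "(G x * b x)\<^sup>2 \<le> L\<^sup>2 * (b x)\<^sup>2" using Gx by (simp add: power_mult_distrib mult_right_mono)
    ultimately have "(\<omega> x)\<^sup>2 / 2 - (g x)\<^sup>2 - L\<^sup>2 * (b x)\<^sup>2 \<le> \<bar>lam\<bar> * (\<omega> x)\<^sup>2 - s * (\<omega> x * g x) - s * (\<omega> x * (G x * b x))"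
      by simp
    then have "wt x * ((\<omega> x)\<^sup>2 / 2 - (g x)\<^sup>2 - L\<^sup>2 * (b x)\<^sup>2) \<le> wt x * (\<bar>lam\<bar> * (\<omega> x)\<^sup>2 - s * (\<omega> x * g x) - s * (\<omega> x * (G x * b x)))"
      using wt_pos[of x] by (intro mult_left_mono) auto
    also have "\<bar>lam\<bar> * (\<omega> x)\<^sup>2 - s * (\<omega> x * g x) - s * (\<omega> x * (G x * b x)) =
       (s/4) * ((b x)\<^sup>2 - (a x - \<omega> x)\<^sup>2 + 2 * G x * b x * (a x - \<omega> x))
     - (s/4) * ((b x)\<^sup>2 - (a x + \<omega> x)\<^sup>2 + 2 * G x * b x * (a x + \<omega> x))"
      unfolding s(1)[symmetric] by (simp add: g_def power2_eq_square field_simps)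
    finally show "(1/2) * (wt x * (\<omega> x)\<^sup>2) - wt x * (g x)\<^sup>2 - L\<^sup>2 * (wt x * (b x)\<^sup>2) \<le> (s/4) * U x - (s/4) * V x"
      by (simp add: U_def V_def algebra_simps)
  qed (use ib ig io UV in auto)
  have Q: "Q \<le> 2 * (\<Gamma> + L\<^sup>2 * P)"
  proof -
    have "(1/2) * Q - \<Gamma> - L\<^sup>2 * P \<le> 0" using 2 ib ig io UV by (simp add: P_def \<Gamma>_def Q_def)
    then show ?thesis by (simp add: algebra_simps)
  qed
  have "L\<^sup>2 * P \<le> L\<^sup>2 * (2 * (1 + 2 * L\<^sup>2) * \<Gamma>)" by (rule mult_left_mono[OF P]) simp
  with Q have Q': "Q \<le> (2 * (1 + 2 * L\<^sup>2 * (1 + 2 * L\<^sup>2))) * \<Gamma>" by (simp add: algebra_simps)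
  have L2p: "0 < 1 + L\<^sup>2" by (simp add: add_pos_nonneg)
  have "(1 / (1 + L\<^sup>2)) * (\<integral>x. (\<omega> x)\<^sup>2 \<partial>lborel) \<le> Q"
    unfolding Q_def integral_mult_right_zero[symmetric]
  proof (rule integral_mono)
    show "1 / (1 + L\<^sup>2) * (\<omega> x)\<^sup>2 \<le> wt x * (\<omega> x)\<^sup>2" for x by (rule mult_right_mono[OF wt_ge]) simp
  qed (use io o2 in \<open>auto simp: L2_iff\<close>)
  then have "(\<integral>x. (\<omega> x)\<^sup>2 \<partial>lborel) \<le> (1 + L\<^sup>2) * Q" using L2p by (simp add: divide_le_eq mult.commute)
  also have "\<dots> \<le> (1 + L\<^sup>2) * ((2 * (1 + 2 * L\<^sup>2 * (1 + 2 * L\<^sup>2))) * \<Gamma>)" by (rule mult_left_mono[OF Q']) simp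
  also have "\<dots> \<le> (1 + L\<^sup>2) * ((2 * (1 + 2 * L\<^sup>2 * (1 + 2 * L\<^sup>2))) * (\<integral>x. (g x)\<^sup>2 \<partial>lborel))"
  proof (intro mult_left_mono)
    show "\<Gamma> \<le> (\<integral>x. (g x)\<^sup>2 \<partial>lborel)" unfolding \<Gamma>_def
      by (rule integral_mono) (use ig g2 wt_le1 in \<open>auto simp: L2_iff mult_left_le_one_le order_less_imp_le[OF wt_pos]\<close>)
  qed (auto simp: add_nonneg_nonneg)
  finally have "(Lp_norm 2 \<omega>)\<^sup>2 \<le> ((1 + L\<^sup>2) * (2 * (1 + 2 * L\<^sup>2 * (1 + 2 * L\<^sup>2)))) * (Lp_norm 2 g)\<^sup>2"
    by (simp only: L2_norm_square mult.assoc)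
  then have "sqrt ((Lp_norm 2 \<omega>)\<^sup>2) \<le> sqrt (((1 + L\<^sup>2) * (2 * (1 + 2 * L\<^sup>2 * (1 + 2 * L\<^sup>2)))) * (Lp_norm 2 g)\<^sup>2)"
    by (rule real_sqrt_le_mono)
  then show ?thesis using Lp_norm_ge0[of 2 \<omega>] Lp_norm_ge0[of 2 g]
    by (simp add: real_sqrt_mult rellich_const_def g_def[abs_def] a_def)
qed

lemma rellich_const_ge0: "0 \<le> rellich_const"
  by (simp add: rellich_const_def)

end

section \<open>Invertibility\<close>

context fspace
begin

lemma lin_op_uminus: "lin_op A C \<Longrightarrow> lin_op (\<lambda>u x. (-1) * A u x) C"
  using lin_op_scale[of A C "-1"] by simp

lemma N_neg: "u \<in> X \<Longrightarrow> N (\<lambda>x. - u x) = N u"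
  using N_scale[of u "-1"] by simp

lemma solve_large_abs:
  assumes A: "lin_op A C" and l: "C < \<bar>l\<bar>" and g: "g \<in> X"
  shows "\<exists>u\<in>X. N (\<lambda>x. l * u x - A u x - g x) = 0"
proof (cases "0 \<le> l")
  case True
  then show ?thesis using solve_large[OF A _ g, of l] l by auto
next
  case False
  have "(\<lambda>x. (-1) * g x) \<in> X" by (rule scale_mem[OF g])
  then obtain u where u: "u \<in> X" "N (\<lambda>x. (- l) * u x - (-1) * A u x - (-1) * g x) = 0"
    using solve_large[OF lin_op_uminus[OF A], of "- l" "\<lambda>x. (-1) * g x"] l False by auto
  have "(\<lambda>x. l * u x - A u x - g x) \<in> X" by (intro diff_mem scale_mem u(1) lin_op_mem[OF A] g)
  from N_neg[OF this] u(2) have "N (\<lambda>x. l * u x - A u x - g x) = 0" by (simp add: algebra_simps)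
  then show ?thesis using u(1) by blast
qed

text \<open>The set |l| \<ge> 1 is disconnected, so negative l are reached by a descent of their
  own, applied to -A and -l.\<close>

lemma continuity_method_abs:
  assumes A: "lin_op A C" and c: "0 \<le> c"
    and lower: "\<And>u l. u \<in> X \<Longrightarrow> 1 \<le> \<bar>l\<bar> \<Longrightarrow> N u \<le> c * N (\<lambda>x. l * u x - A u x)"
    and l: "1 \<le> \<bar>l\<bar>" and g: "g \<in> X"
  shows "\<exists>u\<in>X. N (\<lambda>x. l * u x - A u x - g x) = 0"
proof (cases "0 \<le> l")
  case True
  then show ?thesis using continuity_method[OF A c lower _ g, of l] l by auto
next
  case False
  have gm: "(\<lambda>x. (-1) * g x) \<in> X" by (rule scale_mem[OF g])
  have low: "N u \<le> c * N (\<lambda>x. m * u x - (-1) * A u x)" if "u \<in> X" "1 \<le> m" for u m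
  proof -
    have "(\<lambda>x. (- m) * u x - A u x) \<in> X" using that by (intro diff_mem scale_mem lin_op_mem[OF A])
    from N_neg[OF this] have "N (\<lambda>x. m * u x - (-1) * A u x) = N (\<lambda>x. (- m) * u x - A u x)" by (simp add: algebra_simps)
    then show ?thesis using lower[OF that(1), of "- m"] that(2) by simp
  qed
  obtain u where u: "u \<in> X" "N (\<lambda>x. (- l) * u x - (-1) * A u x - (-1) * g x) = 0"
    using continuity_method[OF lin_op_uminus[OF A] c low _ gm, of "- l"] l False by auto
  have "(\<lambda>x. l * u x - A u x - g x) \<in> X" by (intro diff_mem scale_mem u(1) lin_op_mem[OF A] g)
  from N_neg[OF this] u(2) have "N (\<lambda>x. l * u x - A u x - g x) = 0" by (simp add: algebra_simps)
  then show ?thesis using u(1) by blast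
qed

end

section \<open>Kernel operators on \<open>L_q\<close>\<close>

lemma Lp_norm_diff_eq_0:
  assumes "1 \<le> q" "u \<in> Lp q" "v \<in> Lp q"
  shows "Lp_norm q (\<lambda>x. u x - v x) = 0 \<longleftrightarrow> (AE x in lborel. u x = v x)"
  using Lp_norm_eq_0[OF _ Lp_diff[OF assms]] assms(1) by (simp add: ae_eq_def)

text \<open>Convergence of the integral is part of the notion because a divergent Bochner integral
  has the value 0: a norm bound alone would not give linearity.\<close>

definition kernel_bounded :: "real \<Rightarrow> (real \<Rightarrow> real \<Rightarrow> real) \<Rightarrow> real \<Rightarrow> bool" where
  "kernel_bounded q k C \<longleftrightarrow> (\<lambda>(x, y). k x y) \<in> borel_measurable (borel \<Otimes>\<^sub>M borel) \<and> 0 \<le> C \<and>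
     (\<forall>u\<in>Lp q. (AE x in lborel. integrable lborel (\<lambda>y. k x y * u (x - y))) \<and> kop k u \<in> Lp q \<and>
        Lp_norm q (kop k u) \<le> C * Lp_norm q u)"

lemma kernel_boundedD:
  assumes "kernel_bounded q k C"
  shows "(\<lambda>(x, y). k x y) \<in> borel_measurable (borel \<Otimes>\<^sub>M borel)" "0 \<le> C"
    "u \<in> Lp q \<Longrightarrow> AE x in lborel. integrable lborel (\<lambda>y. k x y * u (x - y))"
    "u \<in> Lp q \<Longrightarrow> kop k u \<in> Lp q" "u \<in> Lp q \<Longrightarrow> Lp_norm q (kop k u) \<le> C * Lp_norm q u"
  using assms by (auto simp: kernel_bounded_def)

lemma kop_comb:
  assumes "integrable lborel (\<lambda>y. k x y * u (x - y))" "integrable lborel (\<lambda>y. k x y * v (x - y))"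
  shows "kop k (\<lambda>x. a * u x + b * v x) x = a * kop k u x + b * kop k v x"
proof -
  have "kop k (\<lambda>x. a * u x + b * v x) x = (\<integral>y. a * (k x y * u (x - y)) + b * (k x y * v (x - y)) \<partial>lborel)"
    unfolding kop_def by (rule Bochner_Integration.integral_cong) (auto simp: algebra_simps)
  then show ?thesis using assms by (simp add: kop_def)
qed

lemma kop_comb_AE:
  assumes "kernel_bounded q k C" "u \<in> Lp q" "v \<in> Lp q"
  shows "AE x in lborel. kop k (\<lambda>x. a * u x + b * v x) x = a * kop k u x + b * kop k v x"
  using kernel_boundedD(3)[OF assms(1,2)] kernel_boundedD(3)[OF assms(1,3)]
  by eventually_elim (rule kop_comb)

lemma kop_lin_op:
  assumes q: "1 \<le> q" and k: "kernel_bounded q k C"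
  shows "fspace.lin_op (Lp q) (Lp_norm q) (kop k) C"
proof -
  interpret fspace "Lp q" "Lp_norm q" by (rule fspace_Lp[OF q])
  note d = kernel_boundedD[OF k]
  show ?thesis unfolding lin_op_def
  proof (intro conjI ballI allI)
    fix u v a b assume uv: "u \<in> Lp q" "v \<in> Lp q"
    show "Lp_norm q (\<lambda>x. kop k (\<lambda>x. a * u x + b * v x) x - (a * kop k u x + b * kop k v x)) = 0"
      by (subst Lp_norm_diff_eq_0[OF q]) (intro d comb_mem uv, intro d comb_mem uv, rule kop_comb_AE[OF k uv])
  qed (use d in auto)
qed

lemma kop_cong_AE:
  assumes "(\<lambda>(x, y). k x y) \<in> borel_measurable (borel \<Otimes>\<^sub>M borel)"
    and [measurable]: "u \<in> borel_measurable borel" "v \<in> borel_measurable borel" and ae: "AE x in lborel. u x = v x"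
  shows "kop k u x = kop k v x"
proof -
  have [measurable]: "k x \<in> borel_measurable borel"
    using measurable_compose[OF measurable_Pair1' assms(1), of x] by simp
  have "AE y in lborel. u (x + (-1) * y) = v (x + (-1) * y)"
    by (rule AE_borel_affine[OF _ _ ae]) auto
  then have ae': "AE y in lborel. k x y * u (x - y) = k x y * v (x - y)" by eventually_elim simp
  show ?thesis unfolding kop_def using integral_cong_AE[OF _ _ ae'] by simp
qed

section \<open>Bounds for the kernel, its splitting, and invertibility on \<open>L_2\<close>\<close>

context graph
begin

lemma A_ker_measurable: "(\<lambda>(x, y). A_ker F G x y) \<in> borel_measurable (borel \<Otimes>\<^sub>M borel)"
  unfolding A_ker_def by measurable

lemma A_ker_0 [simp]: "A_ker F G x 0 = 0"
  by (simp add: A_ker_def)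

lemma A_ker_near:
  assumes "\<bar>y\<bar> \<le> 1"
  shows "\<bar>A_ker F G x y\<bar> \<le> H * \<bar>y\<bar> powr (\<alpha> - 1)"
proof (cases "y = 0")
  case False
  have d: "\<bar>y\<bar> * \<bar>y\<bar> \<le> y\<^sup>2 + (F x - F (x - y))\<^sup>2" by (simp add: power2_eq_square)
  have "\<bar>A_ker F G x y\<bar> = \<bar>F x - F (x - y) - y * G x\<bar> / (y\<^sup>2 + (F x - F (x - y))\<^sup>2)"
    by (simp add: A_ker_def abs_minus_commute)
  also have "\<dots> \<le> (H * \<bar>y\<bar> powr \<alpha> * \<bar>y\<bar>) / (\<bar>y\<bar> * \<bar>y\<bar>)"
    using chord_near[OF assms, of x] d False H0 by (intro frac_le) (auto simp: zero_less_mult_iff)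
  also have "\<dots> = H * \<bar>y\<bar> powr (\<alpha> - 1)" using False by (simp add: powr_diff del: abs_mult_self_eq)
  finally show ?thesis .
qed (simp add: H0)

lemma A_ker_far: "\<bar>A_ker F G x y\<bar> \<le> \<bar>G x\<bar> / \<bar>y\<bar> + \<bar>F x - F (x - y)\<bar> / y\<^sup>2"
proof (cases "y = 0")
  case False
  have d: "y\<^sup>2 \<le> y\<^sup>2 + (F x - F (x - y))\<^sup>2" by simp
  have "\<bar>A_ker F G x y\<bar> = \<bar>y * G x - (F x - F (x - y))\<bar> / (y\<^sup>2 + (F x - F (x - y))\<^sup>2)"
    by (simp add: A_ker_def)
  also have "\<dots> \<le> (\<bar>y\<bar> * \<bar>G x\<bar> + \<bar>F x - F (x - y)\<bar>) / y\<^sup>2"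
    using abs_triangle_ineq4[of "y * G x" "F x - F (x - y)"] d False by (intro frac_le) (auto simp: abs_mult)
  also have "\<dots> = \<bar>G x\<bar> / \<bar>y\<bar> + \<bar>F x - F (x - y)\<bar> / y\<^sup>2"
  proof -
    have "y\<^sup>2 = \<bar>y\<bar> * \<bar>y\<bar>" by (simp add: power2_eq_square)
    moreover have "\<bar>y\<bar> * \<bar>G x\<bar> / (\<bar>y\<bar> * \<bar>y\<bar>) = \<bar>G x\<bar> / \<bar>y\<bar>"
      using False by (simp del: abs_mult_self_eq)
    ultimately show ?thesis by (simp only: add_divide_distrib)
  qed
  finally show ?thesis .
qed simp

text \<open>|G|^2 \<le> L powr (2 - p) * |G| powr p since G is bounded. Here p \<le> 2 enters, and
  it allows the slowly decaying part of the kernel to act on \<open>L_2\<close> as well.\<close>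

lemma G_L2: "G \<in> Lp 2"
  unfolding L2_iff
proof
  show "integrable lborel (\<lambda>x. (G x)\<^sup>2)"
  proof (rule Bochner_Integration.integrable_bound)
    show "integrable lborel (\<lambda>x. L powr (2 - p) * \<bar>G x\<bar> powr p)" using Lp_integrable[OF G_Lp] by simp
    show "AE x in lborel. norm ((G x)\<^sup>2) \<le> norm (L powr (2 - p) * \<bar>G x\<bar> powr p)"
    proof (intro AE_I2)
      fix x
      have "\<bar>G x\<bar> powr 2 = \<bar>G x\<bar> powr (2 - p) * \<bar>G x\<bar> powr p" by (simp add: powr_add[symmetric])
      also have "\<dots> \<le> L powr (2 - p) * \<bar>G x\<bar> powr p"
        using p G_bound[of x] by (intro mult_right_mono powr_mono2) auto
      finally show "norm ((G x)\<^sup>2) \<le> norm (L powr (2 - p) * \<bar>G x\<bar> powr p)" by simp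
    qed
  qed measurable
qed measurable

text \<open>Not integrable, but in the dual space of every \<open>L_q\<close> with q > 1; it serves
  as the second factor of product majorants. The integrable weights are \<open>near_kap\<close> and
  \<open>sq_kap\<close>.\<close>

definition far :: "real \<Rightarrow> real \<Rightarrow> real" where "far d y = indicator {d<..} \<bar>y\<bar> / \<bar>y\<bar>"

lemma far_mem: "1 < q \<Longrightarrow> 0 < d \<Longrightarrow> far d \<in> Lp (q / (q - 1))"
  unfolding far_def[abs_def] by (rule far_Lp) auto

lemma far_ge0: "0 \<le> far d y" by (simp add: far_def)

definition near_kap :: "real \<Rightarrow> real \<Rightarrow> real" where
  "near_kap d y = indicator {0..d} \<bar>y\<bar> * (H * \<bar>y\<bar> powr (\<alpha> - 1))"

definition sq_kap :: "real \<Rightarrow> real \<Rightarrow> real" where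
  "sq_kap d y = indicator {d<..} \<bar>y\<bar> * \<bar>y\<bar> powr (- 2)"

lemma sq_kap_integrable: "0 < d \<Longrightarrow> integrable lborel (sq_kap d)"
  unfolding sq_kap_def[abs_def] by (rule integrable_powr_far) auto

lemma kap_ge0: "0 \<le> near_kap d y" "0 \<le> sq_kap d y"
  using H0 by (auto simp: near_kap_def sq_kap_def)

lemma kap_measurable [measurable]: "near_kap d \<in> borel_measurable borel" "sq_kap d \<in> borel_measurable borel"
  unfolding near_kap_def[abs_def] sq_kap_def[abs_def] by measurable

lemma near_kap_integrable:
  assumes "d \<le> 1" shows "integrable lborel (near_kap d)"
proof (rule Bochner_Integration.integrable_bound)
  show "integrable lborel (\<lambda>y. H * (indicator {0..1} \<bar>y\<bar> * \<bar>y\<bar> powr (\<alpha> - 1)))"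
    using integrable_powr_near[OF alpha] by (rule integrable_mult_right)
  show "AE y in lborel. norm (near_kap d y) \<le> norm (H * (indicator {0..1} \<bar>y\<bar> * \<bar>y\<bar> powr (\<alpha> - 1)))"
    using H0 assms by (auto simp: near_kap_def indicator_def abs_mult)
qed measurable

lemma near_kap_small: "(\<lambda>n. \<integral>y. near_kap (1 / Suc n) y \<partial>lborel) \<longlonglongrightarrow> 0"
proof -
  have "(\<lambda>n. \<integral>y. near_kap (1 / Suc n) y \<partial>lborel) \<longlonglongrightarrow> (\<integral>y. 0 \<partial>(lborel :: real measure))"
  proof (rule integral_dominated_convergence)
    show "integrable lborel (near_kap 1)" by (rule near_kap_integrable) simp
    show "AE y in lborel. norm (near_kap (1 / Suc n) y) \<le> near_kap 1 y" for n
      using H0 by (intro AE_I2) (auto simp: near_kap_def indicator_def divide_le_eq intro: order_trans)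
    show "AE y in lborel. (\<lambda>n. near_kap (1 / Suc n) y) \<longlonglongrightarrow> 0"
      using AE_lborel_singleton[of 0]
    proof eventually_elim
      case (elim y)
      have "(\<lambda>n. 1 / real (Suc n)) \<longlonglongrightarrow> 0" using LIMSEQ_Suc[OF lim_1_over_n] by simp
      then have "eventually (\<lambda>n. 1 / real (Suc n) < \<bar>y\<bar>) sequentially" using elim by (intro order_tendstoD) auto
      then show ?case by (intro tendsto_eventually) (auto simp: near_kap_def elim!: eventually_mono)
    qed
  qed measurable
  then show ?thesis by simp
qed

text \<open>Small for two different reasons: close to the diagonal the weight is integrated over a
  short interval, and for large |x| both F x and the tail of G are small. The complement
  \<open>kR\<close> has |x| \<le> N and |y| > d.\<close>

definition kS :: "real \<Rightarrow> real \<Rightarrow> real \<Rightarrow> real \<Rightarrow> real" where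
  "kS d N x y = (if \<bar>y\<bar> \<le> d \<or> N < \<bar>x\<bar> then A_ker F G x y else 0)"
definition kR :: "real \<Rightarrow> real \<Rightarrow> real \<Rightarrow> real \<Rightarrow> real" where
  "kR d N x y = (if \<bar>y\<bar> \<le> d \<or> N < \<bar>x\<bar> then 0 else A_ker F G x y)"

lemma kSR_measurable:
  "(\<lambda>(x, y). kS d N x y) \<in> borel_measurable (borel \<Otimes>\<^sub>M borel)"
  "(\<lambda>(x, y). kR d N x y) \<in> borel_measurable (borel \<Otimes>\<^sub>M borel)"
  unfolding kS_def kR_def A_ker_def by measurable

lemma kSR: "A_ker F G x y = kS d N x y + kR d N x y"
  by (simp add: kS_def kR_def)

text \<open>Far from the diagonal both parts of the kernel are at most L / |y|, and x is confined to
  a compact interval. The factor in x thus lies in every \<open>L_r\<close>, which gives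
  \<open>kR_op\<close> its free output exponent.\<close>

lemma kR_bound: "\<bar>kR d N x y\<bar> \<le> (2 * L * indicator {-N..N} x) * far d y"
proof (cases "\<bar>y\<bar> \<le> d \<or> N < \<bar>x\<bar>")
  case False
  have "\<bar>A_ker F G x y\<bar> \<le> \<bar>G x\<bar> / \<bar>y\<bar> + \<bar>F x - F (x - y)\<bar> / y\<^sup>2" by (rule A_ker_far)
  also have "\<dots> \<le> L / \<bar>y\<bar> + (L * \<bar>y\<bar>) / y\<^sup>2"
    using G_bound[of x] F_lip[of x "x - y"] by (intro add_mono divide_right_mono) auto
  also have "(L * \<bar>y\<bar>) / y\<^sup>2 = L / \<bar>y\<bar>" by (simp add: power2_eq_square divide_simps)
  finally show ?thesis using False by (auto simp: kR_def far_def indicator_def)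
qed (use L0 far_ge0 in \<open>auto simp: kR_def\<close>)

lemma indicator_Lp: "0 < r \<Longrightarrow> (\<lambda>x. c * indicator {-N..N} x) \<in> Lp r" for c N r :: real
  by (rule bounded_support_Lp[of _ "\<bar>c\<bar>" N]) (auto simp: indicator_def)

definition R_const :: "real \<Rightarrow> real \<Rightarrow> real \<Rightarrow> real \<Rightarrow> real" where
  "R_const d N q r = hconst q (far d) * Lp_norm r (\<lambda>x. 2 * L * indicator {-N..N} x)"

lemma kR_op:
  assumes q: "1 < q" and r: "1 \<le> r" and d: "0 < d" and u: "u \<in> Lp q"
  shows "\<And>x. integrable lborel (\<lambda>y. kR d N x y * u (x - y))"
    "kop (kR d N) u \<in> Lp r" "Lp_norm r (kop (kR d N) u) \<le> R_const d N q r * Lp_norm q u"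
  unfolding R_const_def
  by (rule kop_rank_one_bound[OF q r kSR_measurable(2) kR_bound _ far_ge0 _ far_mem[OF q d] u];
      use L0 r in \<open>auto intro!: indicator_Lp\<close>)+

lemma R_const_ge0: "0 \<le> R_const d N q r"
  unfolding R_const_def using hconst_pos[of q "far d"] Lp_norm_ge0 by simp

text \<open>Near the diagonal and in the term with F, bounded by 2 * M / y^2, the majorant is an
  integrable weight in y; the remaining |G x| / |y| is a product.\<close>

lemma A_bounded:
  assumes q: "1 < q" and G: "G \<in> Lp q"
  obtains C where "kernel_bounded q (A_ker F G) C"
proof -
  define \<kappa> where "\<kappa> y = near_kap 1 y + 2 * M * sq_kap 1 y" for y
  have ki: "integrable lborel \<kappa>" and k0: "0 \<le> \<kappa> y" for y
    unfolding \<kappa>_def[abs_def] using near_kap_integrable[of 1] sq_kap_integrable[of 1] kap_ge0 M0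
    by auto
  have bd: "\<bar>A_ker F G x y\<bar> \<le> \<kappa> y + \<bar>G x\<bar> * far 1 y" for x y
  proof (cases "\<bar>y\<bar> \<le> 1")
    case True
    then have "\<bar>A_ker F G x y\<bar> \<le> near_kap 1 y" using A_ker_near[OF True, of x] by (simp add: near_kap_def)
    also have "\<dots> \<le> \<kappa> y + \<bar>G x\<bar> * far 1 y"
      using kap_ge0[of 1 y] M0 far_ge0[of 1 y] by (simp add: \<kappa>_def)
    finally show ?thesis .
  next
    case False
    have "\<bar>F x - F (x - y)\<bar> \<le> 2 * M" using F_bound[of x] F_bound[of "x - y"] by linarith
    then have "\<bar>F x - F (x - y)\<bar> / y\<^sup>2 \<le> 2 * M / y\<^sup>2" by (intro divide_right_mono) auto
    also have "\<dots> = 2 * M * sq_kap 1 y" using False by (simp add: sq_kap_def powr_minus divide_inverse)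
    finally show ?thesis using A_ker_far[of x y] False kap_ge0[of 1 y] by (simp add: \<kappa>_def far_def)
  qed
  have Ga: "(\<lambda>x. \<bar>G x\<bar>) \<in> Lp q" by (rule Lp_abs(1)[OF G])
  define C where "C = (\<integral>y. \<kappa> y \<partial>lborel) + hconst q (far 1) * Lp_norm q (\<lambda>x. \<bar>G x\<bar>)"
  have C0: "0 \<le> C" unfolding C_def using k0 hconst_pos[of q "far 1"] Lp_norm_ge0
    by (intro add_nonneg_nonneg mult_nonneg_nonneg) auto
  note kb = kop_bound[OF q A_ker_measurable bd abs_ge_zero far_ge0 ki k0 Ga far_mem[OF q]]
  have "kernel_bounded q (A_ker F G) C"
    unfolding kernel_bounded_def C_def using A_ker_measurable C0 kb C_def by auto
  then show ?thesis by (rule that)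
qed

text \<open>For |x| > N the value F x is below e, and so is F (x - y) unless x - y returns to
  {-N0..N0}. The latter forces |y| > N - N0, where the tail of the weight is small.\<close>

lemma kS_bound:
  assumes d: "0 < d" "d \<le> 1" and e: "0 \<le> e" and N0: "\<And>x. N0 < \<bar>x\<bar> \<Longrightarrow> \<bar>F x\<bar> < e" and N: "N0 \<le> N"
  shows "\<bar>kS d N x y\<bar> \<le> (near_kap d y + 2 * e * sq_kap d y + M * (indicator {x. N - N0 < \<bar>x\<bar>} y * sq_kap d y))
      + (indicator {x. N < \<bar>x\<bar>} x * \<bar>G x\<bar>) * far d y"
proof (cases "\<bar>y\<bar> \<le> d")
  case True
  then have "\<bar>kS d N x y\<bar> \<le> near_kap d y" using A_ker_near[of y x] d by (simp add: near_kap_def kS_def)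
  also have "\<dots> \<le> (near_kap d y + 2 * e * sq_kap d y + M * (indicator {x. N - N0 < \<bar>x\<bar>} y * sq_kap d y))
      + (indicator {x. N < \<bar>x\<bar>} x * \<bar>G x\<bar>) * far d y"
    using kap_ge0[of d y] M0 far_ge0[of d y] e by simp
  finally show ?thesis .
next
  case y: False
  show ?thesis
  proof (cases "N < \<bar>x\<bar>")
    case False
    then show ?thesis using y kap_ge0[of d y] M0 far_ge0[of d y] e by (simp add: kS_def)
  next
    case True
    have "\<bar>F x\<bar> \<le> e" using N0[of x] True N by simp
    moreover have "\<bar>F (x - y)\<bar> \<le> e + M * indicator {x. N - N0 < \<bar>x\<bar>} y"
    proof (cases "N0 < \<bar>x - y\<bar>")
      case True
      then show ?thesis using N0[of "x - y"] M0 by (auto simp: indicator_def)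
    next
      case False
      then have "N - N0 < \<bar>y\<bar>" using \<open>N < \<bar>x\<bar>\<close> by linarith
      then show ?thesis using F_bound[of "x - y"] e by (simp add: indicator_def)
    qed
    ultimately have "\<bar>F x - F (x - y)\<bar> \<le> 2 * e + M * indicator {x. N - N0 < \<bar>x\<bar>} y" by linarith
    then have "\<bar>F x - F (x - y)\<bar> / y\<^sup>2 \<le> (2 * e + M * indicator {x. N - N0 < \<bar>x\<bar>} y) / y\<^sup>2" by (intro divide_right_mono) auto
    also have "\<dots> = (2 * e + M * indicator {x. N - N0 < \<bar>x\<bar>} y) * sq_kap d y"
      using y d by (simp add: sq_kap_def powr_minus divide_inverse)
    finally have "\<bar>A_ker F G x y\<bar> \<le> \<bar>G x\<bar> * far d y + (2 * e + M * indicator {x. N - N0 < \<bar>x\<bar>} y) * sq_kap d y"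
      using A_ker_far[of x y] y by (simp add: far_def)
    then show ?thesis using True y kap_ge0[of d y] by (simp add: kS_def algebra_simps)
  qed
qed

text \<open>The restriction of the kernel to a neighbourhood of the diagonal and to base points \<open>x\<close> outside a
  compact set has small norm; this replaces a compactness argument.\<close>
lemma kS_small:
  obtains d N where "0 < d" "kernel_bounded p (kS d N) 1" "kernel_bounded 2 (kS d N) 1"
proof -
  have p1: "1 \<le> p" using p by simp
  have "eventually (\<lambda>n. (\<integral>y. near_kap (1 / Suc n) y \<partial>lborel) < 1 / 4) sequentially"
    by (rule order_tendstoD(2)[OF near_kap_small]) simp
  then obtain n where n: "(\<integral>y. near_kap (1 / Suc n) y \<partial>lborel) < 1 / 4" by (auto simp: eventually_sequentially)
  \<comment> \<open>The total norm 1 is shared in quarters by the diagonal part, the e-term, the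
    tail of the weight and the tail of G. The choices depend on one another in this order: d, then
    e, then N0, then N.\<close>
  define d where "d = 1 / real (Suc n)"
  have d: "0 < d" "d \<le> 1" "(\<integral>y. near_kap d y \<partial>lborel) \<le> 1 / 4" using n by (auto simp: d_def)
  define A where "A = (\<integral>y. sq_kap d y \<partial>lborel)"
  have A0: "0 \<le> A" unfolding A_def using kap_ge0 by simp
  define e where "e = 1 / (8 * (A + 1))"
  have e: "0 < e" "2 * e * A \<le> 1 / 4" using A0 by (auto simp: e_def field_simps)
  obtain N0 where N0: "\<And>x. N0 < \<bar>x\<bar> \<Longrightarrow> \<bar>F x\<bar> < e" using F_decay[OF e(1)] by blast
  have sq1: "sq_kap d \<in> Lp 1" using sq_kap_integrable[OF d(1)] by (simp add: Lp_def)
  have Ga: "(\<lambda>x. \<bar>G x\<bar>) \<in> Lp p" "(\<lambda>x. \<bar>G x\<bar>) \<in> Lp 2" by (rule Lp_abs(1) G_Lp G_L2)+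
  have T1: "eventually (\<lambda>n. Lp_norm 1 (\<lambda>x. indicator {x. real n < \<bar>x\<bar>} x * sq_kap d x) < 1 / (4 * (M + 1))) sequentially"
    by (rule order_tendstoD(2)[OF Lp_tail_zero[OF _ sq1]]) (use M0 in auto)
  have T2: "eventually (\<lambda>n. Lp_norm q (\<lambda>x. indicator {x. real n < \<bar>x\<bar>} x * \<bar>G x\<bar>) < 1 / (4 * hconst q (far d))) sequentially"
    if "1 \<le> q" "(\<lambda>x. \<bar>G x\<bar>) \<in> Lp q" for q
    by (rule order_tendstoD(2)[OF Lp_tail_zero[OF that]]) (use hconst_pos[of q "far d"] in auto)
  obtain m1 where m1: "Lp_norm 1 (\<lambda>x. indicator {x. real m1 < \<bar>x\<bar>} x * sq_kap d x) < 1 / (4 * (M + 1))"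
    using T1 by (auto simp: eventually_sequentially)
  have m2_ex: "\<exists>m2. \<forall>n\<ge>m2. Lp_norm p (\<lambda>x. indicator {x. real n < \<bar>x\<bar>} x * \<bar>G x\<bar>) < 1 / (4 * hconst p (far d)) \<and>
     Lp_norm 2 (\<lambda>x. indicator {x. real n < \<bar>x\<bar>} x * \<bar>G x\<bar>) < 1 / (4 * hconst 2 (far d))"
    using eventually_conj[OF T2[OF p1 Ga(1)] T2[OF _ Ga(2)]] by (simp add: eventually_sequentially)
  then obtain m2 where m2: "\<And>n. n \<ge> m2 \<Longrightarrow> Lp_norm p (\<lambda>x. indicator {x. real n < \<bar>x\<bar>} x * \<bar>G x\<bar>) < 1 / (4 * hconst p (far d)) \<and>
     Lp_norm 2 (\<lambda>x. indicator {x. real n < \<bar>x\<bar>} x * \<bar>G x\<bar>) < 1 / (4 * hconst 2 (far d))" by blast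
  obtain m3 where m3: "\<bar>N0\<bar> + real m1 \<le> real m3" using real_arch_simple by blast
  define n' where "n' = max m2 m3"
  \<comment> \<open>Large enough for N - N0 to pass the tail index m1 of the weight and for N to
    pass the tail index m2 of G in both spaces.\<close>
  define N where "N = real n'"
  have N: "N0 \<le> N" "real m1 \<le> N - N0" using m3 by (auto simp: N_def n'_def)
  define \<kappa> where "\<kappa> y = near_kap d y + 2 * e * sq_kap d y + M * (indicator {x. N - N0 < \<bar>x\<bar>} y * sq_kap d y)" for y
  have iS: "integrable lborel (\<lambda>y. indicator {x. N - N0 < \<bar>x\<bar>} y * sq_kap d y)"
    by (rule Bochner_Integration.integrable_bound[OF sq_kap_integrable[OF d(1)]]) (auto simp: indicator_def)
  have k0: "0 \<le> \<kappa> y" for y unfolding \<kappa>_def using kap_ge0 M0 e by simp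
  have ki: "integrable lborel \<kappa>"
    unfolding \<kappa>_def[abs_def] using near_kap_integrable[OF d(2)] sq_kap_integrable[OF d(1)] iS by auto
  have kint: "(\<integral>y. \<kappa> y \<partial>lborel) \<le> 3 / 4"
  proof -
    have i1: "integrable lborel (\<lambda>y. indicator {x. real m1 < \<bar>x\<bar>} y * sq_kap d y)"
      by (rule Bochner_Integration.integrable_bound[OF sq_kap_integrable[OF d(1)]]) (auto simp: indicator_def)
    have "(\<integral>y. indicator {x. N - N0 < \<bar>x\<bar>} y * sq_kap d y \<partial>lborel) \<le> (\<integral>y. indicator {x. real m1 < \<bar>x\<bar>} y * sq_kap d y \<partial>lborel)"
      by (rule integral_mono[OF iS i1]) (use N kap_ge0 in \<open>auto simp: indicator_def\<close>)
    also have "\<dots> = Lp_norm 1 (\<lambda>x. indicator {x. real m1 < \<bar>x\<bar>} x * sq_kap d x)"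
      using kap_ge0 by (simp add: Lp_norm_def abs_mult integral_nonneg)
    also have "\<dots> \<le> 1 / (4 * (M + 1))" using m1 by simp
    finally have "M * (\<integral>y. indicator {x. N - N0 < \<bar>x\<bar>} y * sq_kap d y \<partial>lborel) \<le> M * (1 / (4 * (M + 1)))"
      by (rule mult_left_mono) (rule M0)
    also have "\<dots> \<le> 1 / 4" using M0 by (simp add: field_simps)
    finally show ?thesis
      unfolding \<kappa>_def using near_kap_integrable[OF d(2)] sq_kap_integrable[OF d(1)] iS d(3) e(2) by (simp add: A_def)
  qed
  have fin: "kernel_bounded q (kS d N) 1"
    if q: "1 < q" and G: "(\<lambda>x. \<bar>G x\<bar>) \<in> Lp q" and t: "Lp_norm q (\<lambda>x. indicator {x. N < \<bar>x\<bar>} x * \<bar>G x\<bar>) < 1 / (4 * hconst q (far d))" for q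
  proof -
    have m: "(\<lambda>x. indicator {x. N < \<bar>x\<bar>} x * \<bar>G x\<bar>) \<in> Lp q"
      by (rule Lp_mono(1)[OF _ G]) (use q in \<open>auto simp: indicator_def\<close>)
    have m0: "0 \<le> indicator {x. N < \<bar>x\<bar>} x * \<bar>G x\<bar>" for x by simp
    note kb = kop_bound[OF q kSR_measurable(1) kS_bound[OF d(1,2) order_less_imp_le[OF e(1)] N0 N(1), folded \<kappa>_def] m0 far_ge0 ki k0 m far_mem[OF q d(1)]]
    have "(\<integral>y. \<kappa> y \<partial>lborel) + hconst q (far d) * Lp_norm q (\<lambda>x. indicator {x. N < \<bar>x\<bar>} x * \<bar>G x\<bar>) \<le> 3/4 + 1/4"
      using kint t hconst_pos[of q "far d"] by (intro add_mono) (auto simp: field_simps)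
    then have le: "((\<integral>y. \<kappa> y \<partial>lborel) + hconst q (far d) * Lp_norm q (\<lambda>x. indicator {x. N < \<bar>x\<bar>} x * \<bar>G x\<bar>)) * Lp_norm q u \<le> 1 * Lp_norm q u" for u
      by (intro mult_right_mono) (auto simp: Lp_norm_ge0)
    show ?thesis unfolding kernel_bounded_def
      using kSR_measurable(1) kb(1,2) order_trans[OF kb(3) le] by auto
  qed
  have "kernel_bounded p (kS d N) 1" "kernel_bounded 2 (kS d N) 1"
    using fin[OF p(1) Ga(1)] fin[OF _ Ga(2)] m2[of n', folded N_def] by (auto simp: n'_def)
  then show ?thesis using d(1) that by blast
qed

text \<open>Only A, bounded on \<open>L_2\<close>, occurs in the estimate for test functions, since
  B was eliminated there; it therefore extends by density.\<close>

lemma rellich_estimate: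
  assumes u: "u \<in> Lp 2" and lam: "1 \<le> \<bar>lam\<bar>"
  shows "Lp_norm 2 u \<le> rellich_const * Lp_norm 2 (\<lambda>x. lam * u x - A_op F G u x)"
proof -
  interpret L2: fspace "Lp 2" "Lp_norm 2" by (rule fspace_Lp) simp
  obtain C where C: "kernel_bounded 2 (A_ker F G) C" using A_bounded[OF _ G_L2] by auto
  have A: "L2.lin_op (A_op F G) (\<bar>1 / pi\<bar> * C)"
    unfolding A_op_def[abs_def] by (rule L2.lin_op_scale[OF kop_lin_op[OF _ C]]) simp
  define D where "D = \<bar>1 / pi\<bar> * C"
  note A = A[folded D_def]
  have D0: "0 \<le> D" by (rule L2.lin_op_ge0[OF A])
  \<comment> \<open>The distance of u to \<phi> enters once directly and once through lam - A, whose
    norm is at most |lam| + D.\<close>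
  define K where "K = 1 + rellich_const * (\<bar>lam\<bar> + D)"
  have K: "0 < K" using rellich_const_ge0 D0 by (simp add: K_def add_pos_nonneg)
  show ?thesis
  proof (rule field_le_epsilon)
    fix e :: real assume e: "0 < e"
    obtain \<phi> where t: "test_fun \<phi>" and f: "Lp_norm 2 (\<lambda>x. u x - \<phi> x) < e / K"
      using test_fun_dense[OF _ u, of "e / K"] e K by auto
    have fm: "\<phi> \<in> Lp 2" by (rule test_fun_Lp[OF t]) simp
    note m = L2.diff_mem L2.scale_mem L2.lin_op_mem[OF A] u fm
    define r where "r = Lp_norm 2 (\<lambda>x. u x - \<phi> x)"
    have "Lp_norm 2 (\<lambda>x. lam * \<phi> x - A_op F G \<phi> x) \<le> Lp_norm 2 (\<lambda>x. lam * u x - A_op F G u x)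
        + Lp_norm 2 (\<lambda>x. lam * (\<phi> x - u x) - (A_op F G \<phi> x - A_op F G u x))"
    proof (rule L2.N_le)
      show "(\<lambda>x. lam * u x - A_op F G u x) \<in> Lp 2" "(\<lambda>x. lam * (\<phi> x - u x) - (A_op F G \<phi> x - A_op F G u x)) \<in> Lp 2"
        by (intro m)+
    qed (simp add: algebra_simps)
    also have "Lp_norm 2 (\<lambda>x. lam * (\<phi> x - u x) - (A_op F G \<phi> x - A_op F G u x)) \<le> Lp_norm 2 (\<lambda>x. lam * (\<phi> x - u x)) + Lp_norm 2 (\<lambda>x. A_op F G u x - A_op F G \<phi> x)"
    proof (rule L2.N_le)
      show "(\<lambda>x. lam * (\<phi> x - u x)) \<in> Lp 2" "(\<lambda>x. A_op F G u x - A_op F G \<phi> x) \<in> Lp 2"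
        by (intro m)+
    qed simp
    also have "Lp_norm 2 (\<lambda>x. lam * (\<phi> x - u x)) = \<bar>lam\<bar> * r"
      unfolding r_def using L2.N_scale[OF L2.diff_mem[OF fm u]] L2.N_swap[OF fm u] by simp
    also have "Lp_norm 2 (\<lambda>x. A_op F G u x - A_op F G \<phi> x) \<le> D * r"
      unfolding r_def by (rule L2.lin_op_diff[OF A u fm])
    finally have 1: "Lp_norm 2 (\<lambda>x. lam * \<phi> x - A_op F G \<phi> x) \<le> Lp_norm 2 (\<lambda>x. lam * u x - A_op F G u x) + (\<bar>lam\<bar> + D) * r"
      by (simp add: algebra_simps)
    have "Lp_norm 2 u \<le> r + Lp_norm 2 \<phi>" unfolding r_def
      by (rule L2.N_le[OF L2.diff_mem[OF u fm] fm]) simp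
    also have "Lp_norm 2 \<phi> \<le> rellich_const * Lp_norm 2 (\<lambda>x. lam * \<phi> x - A_op F G \<phi> x)"
      by (rule rellich_estimate_test[OF t lam])
    also have "\<dots> \<le> rellich_const * (Lp_norm 2 (\<lambda>x. lam * u x - A_op F G u x) + (\<bar>lam\<bar> + D) * r)"
      by (rule mult_left_mono[OF 1 rellich_const_ge0])
    finally have "Lp_norm 2 u \<le> rellich_const * Lp_norm 2 (\<lambda>x. lam * u x - A_op F G u x) + K * r"
      by (simp add: K_def algebra_simps)
    moreover have "K * r \<le> e" using f K by (simp add: r_def field_simps)
    ultimately show "Lp_norm 2 u \<le> rellich_const * Lp_norm 2 (\<lambda>x. lam * u x - A_op F G u x) + e" by linarith
  qed
qed

lemma L2_solve:
  assumes lam: "1 \<le> \<bar>lam\<bar>" and g: "g \<in> Lp 2"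
  obtains u where "u \<in> Lp 2" "AE x in lborel. lam * u x - A_op F G u x = g x" "Lp_norm 2 u \<le> rellich_const * Lp_norm 2 g"
proof -
  interpret L2: fspace "Lp 2" "Lp_norm 2" by (rule fspace_Lp) simp
  obtain C where C: "kernel_bounded 2 (A_ker F G) C" using A_bounded[OF _ G_L2] by auto
  have A: "L2.lin_op (A_op F G) (\<bar>1 / pi\<bar> * C)"
    unfolding A_op_def[abs_def] by (rule L2.lin_op_scale[OF kop_lin_op[OF _ C]]) simp
  obtain u where u: "u \<in> Lp 2" "Lp_norm 2 (\<lambda>x. lam * u x - A_op F G u x - g x) = 0"
    using L2.continuity_method_abs[OF A rellich_const_ge0 rellich_estimate lam g] by blast
  have m: "(\<lambda>x. lam * u x - A_op F G u x) \<in> Lp 2" by (intro L2.diff_mem L2.scale_mem L2.lin_op_mem[OF A] u(1))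
  have ae: "AE x in lborel. lam * u x - A_op F G u x = g x"
    using u(2) Lp_norm_diff_eq_0[OF _ m g] by simp
  have "Lp_norm 2 (\<lambda>x. lam * u x - A_op F G u x) = Lp_norm 2 g"
    by (rule Lp_norm_cong_AE[OF Lp_measurable[OF m] Lp_measurable[OF g]]) (use ae in \<open>simp add: ae_eq_def\<close>)
  then have "Lp_norm 2 u \<le> rellich_const * Lp_norm 2 g" using rellich_estimate[OF u(1) lam] by simp
  then show ?thesis by (rule that[OF u(1) ae])
qed

end

section \<open>Solvability for the small part of the kernel\<close>

lemma Lp_norm_add_eq_0_iff: "Lp_norm p u + Lp_norm q u = 0 \<longleftrightarrow> Lp_norm p u = 0 \<and> Lp_norm q u = 0"
  using Lp_norm_ge0[of p u] Lp_norm_ge0[of q u] by linarith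

definition sop :: "(real \<Rightarrow> real \<Rightarrow> real) \<Rightarrow> (real \<Rightarrow> real) \<Rightarrow> real \<Rightarrow> real" where
  "sop k u x = (1 / pi) * kop k u x"

lemma sop_lin_op:
  assumes q: "1 \<le> q" and k: "kernel_bounded q k C"
  shows "fspace.lin_op (Lp q) (Lp_norm q) (sop k) (C / pi)"
proof -
  interpret fspace "Lp q" "Lp_norm q" by (rule fspace_Lp[OF q])
  show ?thesis unfolding sop_def[abs_def] using lin_op_scale[OF kop_lin_op[OF q k], of "1 / pi"] by simp
qed

lemma inverse_pi_less: "1 / pi < 1 / 2"
  using pi_gt3 by (simp add: divide_less_eq)

text \<open>After division by \<pi> the operator has norm at most 1 / \<pi> < 1 / 2, so for |l|
  \<ge> 1 at least half of the norm of u remains.\<close>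

lemma sop_small_lower:
  assumes q: "1 \<le> q" and k: "kernel_bounded q k 1" and l: "1 \<le> \<bar>l\<bar>" and u: "u \<in> Lp q"
  shows "Lp_norm q u \<le> 2 * Lp_norm q (\<lambda>x. l * u x - sop k u x)"
proof -
  interpret fspace "Lp q" "Lp_norm q" by (rule fspace_Lp[OF q])
  note S = sop_lin_op[OF q k]
  have m: "sop k u \<in> Lp q" by (rule lin_op_mem[OF S u])
  have "Lp_norm q (\<lambda>x. l * u x) \<le> Lp_norm q (\<lambda>x. l * u x - sop k u x) + Lp_norm q (sop k u)"
    by (rule N_le) (intro diff_mem scale_mem u m, rule m, simp)
  moreover have "Lp_norm q (sop k u) \<le> (1 / pi) * Lp_norm q u" by (rule lin_op_le[OF S u])
  moreover have "(1 / pi) * Lp_norm q u \<le> (1 / 2) * Lp_norm q u"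
    using inverse_pi_less by (intro mult_right_mono) (auto simp: Lp_norm_ge0)
  moreover have "1 * Lp_norm q u \<le> \<bar>l\<bar> * Lp_norm q u" by (intro mult_right_mono l Lp_norm_ge0)
  ultimately show ?thesis unfolding N_scale[OF u] by linarith
qed

lemma sop_small_unique:
  assumes q: "1 \<le> q" and k: "kernel_bounded q k 1" and l: "1 \<le> \<bar>l\<bar>" and u: "u \<in> Lp q" and v: "v \<in> Lp q"
    and eq: "AE x in lborel. l * u x - sop k u x = l * v x - sop k v x"
  shows "AE x in lborel. u x = v x"
proof -
  interpret fspace "Lp q" "Lp_norm q" by (rule fspace_Lp[OF q])
  note S = sop_lin_op[OF q k]
  define d where "d x = 1 * u x + (-1) * v x" for x
  have d: "d \<in> Lp q" unfolding d_def[abs_def] by (intro comb_mem u v)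
  have "AE x in lborel. kop k d x = 1 * kop k u x + (-1) * kop k v x"
    unfolding d_def[abs_def] by (rule kop_comb_AE[OF k u v])
  then have "AE x in lborel. sop k d x = sop k u x - sop k v x"
    by eventually_elim (simp add: sop_def diff_divide_distrib)
  then have ae: "AE x in lborel. l * d x - sop k d x = 0"
    using eq by eventually_elim (simp add: d_def algebra_simps)
  have m: "(\<lambda>x. l * d x - sop k d x) \<in> Lp q" by (intro diff_mem scale_mem d lin_op_mem[OF S])
  have "Lp_norm q (\<lambda>x. l * d x - sop k d x) = 0"
    using Lp_norm_eq_0[OF _ m] q ae by (simp add: ae_eq_def)
  then have "Lp_norm q d = 0" using sop_small_lower[OF q k l d] Lp_norm_ge0[of q d] by simp
  then have "AE x in lborel. d x = 0" using Lp_norm_eq_0[OF _ d] q by (simp add: ae_eq_def)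
  then show ?thesis by eventually_elim (simp add: d_def)
qed

text \<open>Taking \<open>q = p\<close> gives solvability in a single space.\<close>
lemma sop_small_solve:
  assumes p: "1 \<le> p" and q: "1 \<le> q" and k: "kernel_bounded p k 1" "kernel_bounded q k 1" and l: "1 \<le> \<bar>l\<bar>"
    and g: "g \<in> Lp p" "g \<in> Lp q"
  obtains u where "u \<in> Lp p" "u \<in> Lp q" "AE x in lborel. l * u x - sop k u x = g x" "Lp_norm p u \<le> 2 * Lp_norm p g"
proof -
  interpret P: fspace "Lp p" "Lp_norm p" by (rule fspace_Lp[OF p])
  interpret Q: fspace "Lp q" "Lp_norm q" by (rule fspace_Lp[OF q])
  \<comment> \<open>Running the Neumann series in the intersection with the sum of the norms
    produces one function that solves the equation in both spaces at once.\<close>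
  interpret Z: fspace "Lp p \<inter> Lp q" "\<lambda>u. Lp_norm p u + Lp_norm q u" by (rule fspace_Lp_Int[OF p q])
  note SP = sop_lin_op[OF p k(1)] and SQ = sop_lin_op[OF q k(2)]
  have "Z.lin_op (sop k) (1 / pi)" unfolding Z.lin_op_def
  proof (intro conjI ballI allI)
    fix u assume u: "u \<in> Lp p \<inter> Lp q"
    show "sop k u \<in> Lp p \<inter> Lp q" using P.lin_op_mem[OF SP] Q.lin_op_mem[OF SQ] u by auto
    show "Lp_norm p (sop k u) + Lp_norm q (sop k u) \<le> 1 / pi * (Lp_norm p u + Lp_norm q u)"
      using P.lin_op_le[OF SP, of u] Q.lin_op_le[OF SQ, of u] u by (simp add: add_divide_distrib)
  next
    fix u v a b assume u: "u \<in> Lp p \<inter> Lp q" "v \<in> Lp p \<inter> Lp q"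
    show "Lp_norm p (\<lambda>x. sop k (\<lambda>x. a * u x + b * v x) x - (a * sop k u x + b * sop k v x)) +
       Lp_norm q (\<lambda>x. sop k (\<lambda>x. a * u x + b * v x) x - (a * sop k u x + b * sop k v x)) = 0"
      using P.lin_op_comb[OF SP, of u v] Q.lin_op_comb[OF SQ, of u v] u by simp
  qed simp
  moreover have "1 / pi < \<bar>l\<bar>" using l inverse_pi_less by linarith
  ultimately obtain u where u: "u \<in> Lp p" "u \<in> Lp q"
    and n: "Lp_norm p (\<lambda>x. l * u x - sop k u x - g x) + Lp_norm q (\<lambda>x. l * u x - sop k u x - g x) = 0"
    using Z.solve_large_abs[of "sop k" "1 / pi" l g] g by auto
  have m: "(\<lambda>x. l * u x - sop k u x) \<in> Lp p" by (intro P.diff_mem P.scale_mem P.lin_op_mem[OF SP] u)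
  have ae: "AE x in lborel. l * u x - sop k u x = g x"
    using n Lp_norm_diff_eq_0[OF p m g(1)] by (simp add: Lp_norm_add_eq_0_iff)
  have "Lp_norm p (\<lambda>x. l * u x - sop k u x) = Lp_norm p g"
    by (rule Lp_norm_cong_AE[OF Lp_measurable[OF m] Lp_measurable[OF g(1)]]) (use ae in \<open>simp add: ae_eq_def\<close>)
  then have "Lp_norm p u \<le> 2 * Lp_norm p g" using sop_small_lower[OF p k(1) l u(1)] by simp
  then show ?thesis by (rule that[OF u ae])
qed

section \<open>Transfer from \<open>L_2\<close> to \<open>L_p\<close>\<close>

context graph
begin

lemma A_op_split:
  assumes q: "1 < q" and d: "0 < d" and k: "kernel_bounded q (kS d N) C" and u: "u \<in> Lp q"
  shows "AE x in lborel. A_op F G u x = sop (kS d N) u x + sop (kR d N) u x"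
  using kernel_boundedD(3)[OF k u]
proof eventually_elim
  case (elim x)
  have "kop (A_ker F G) u x = (\<integral>y. kS d N x y * u (x - y) + kR d N x y * u (x - y) \<partial>lborel)"
    unfolding kop_def kSR[of _ _ d N] distrib_right ..
  also have "\<dots> = kop (kS d N) u x + kop (kR d N) u x"
    unfolding kop_def by (rule Bochner_Integration.integral_add[OF elim kR_op(1)[OF q _ d u, of 1]]) simp
  finally show ?case by (simp add: A_op_def sop_def distrib_left)
qed

lemma sop_kR:
  assumes q: "1 < q" and r: "1 \<le> r" and d: "0 < d" and u: "u \<in> Lp q"
  shows "sop (kR d N) u \<in> Lp r" "Lp_norm r (sop (kR d N) u) \<le> R_const d N q r * Lp_norm q u"
proof -
  have r0: "0 < r" using r by simp
  note R = kR_op[OF q r d u]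
  show "sop (kR d N) u \<in> Lp r" unfolding sop_def[abs_def] by (rule Lp_scale(1)[OF r0 R(2)])
  have "Lp_norm r (sop (kR d N) u) = \<bar>1 / pi\<bar> * Lp_norm r (kop (kR d N) u)"
    unfolding sop_def[abs_def] by (rule Lp_scale(2)[OF r0 R(2)])
  also have "\<dots> \<le> 1 * Lp_norm r (kop (kR d N) u)"
    using inverse_pi_less by (intro mult_right_mono) (auto simp: Lp_norm_ge0)
  finally show "Lp_norm r (sop (kR d N) u) \<le> R_const d N q r * Lp_norm q u" using R(3)[of N] by simp
qed

lemma sop_kR_cong_AE:
  assumes "u \<in> borel_measurable borel" "v \<in> borel_measurable borel" "AE x in lborel. u x = v x"
  shows "sop (kR d N) u x = sop (kR d N) v x"
  unfolding sop_def using kop_cong_AE[OF kSR_measurable(2) assms] by simp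

lemma A_op_cong_AE:
  assumes "u \<in> borel_measurable borel" "v \<in> borel_measurable borel" "AE x in lborel. u x = v x"
  shows "A_op F G u x = A_op F G v x"
  unfolding A_op_def using kop_cong_AE[OF A_ker_measurable assms] by simp

text \<open>The solution is v plus a correction for the error R v. The constant is carried along
  because it becomes the norm of the inverse in \<open>isom_resolvent\<close>.\<close>

lemma Lp_solve:
  assumes lam: "1 \<le> \<bar>lam\<bar>"
  obtains C where "0 \<le> C" "\<And>g. g \<in> Lp p \<Longrightarrow> \<exists>u\<in>Lp p. (AE x in lborel. lam * u x - A_op F G u x = g x) \<and> Lp_norm p u \<le> C * Lp_norm p g"
proof -
  have p1: "1 \<le> p" using p by simp
  interpret fspace "Lp p" "Lp_norm p" by (rule fspace_Lp[OF p1])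
  obtain d N where d: "0 < d" and kp: "kernel_bounded p (kS d N) 1" and k2: "kernel_bounded 2 (kS d N) 1"
    by (rule kS_small)
  obtain D where kA: "kernel_bounded p (A_ker F G) D" using A_bounded[OF p(1) G_Lp] by blast
  define R where "R = sop (kR d N)"
  define S where "S = sop (kS d N)"
  define cpp cp2 c2p where "cpp = R_const d N p p" and "cp2 = R_const d N p 2" and "c2p = R_const d N 2 p"
  have two: "(1::real) < 2" by simp
  have c0: "0 \<le> cpp" "0 \<le> cp2" "0 \<le> c2p" unfolding cpp_def cp2_def c2p_def by (rule R_const_ge0)+
  \<comment> \<open>The first 2 bounds v. The correction w' is at most twice the norms of R v and of
    R w, and the latter passes through the \<open>L_2\<close> estimate, with \<open>cp2\<close>
    leading into \<open>L_2\<close> and \<open>c2p\<close> leading back.\<close>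
  define C where "C = 2 + 2 * (cpp * 2 + c2p * (rellich_const * (cp2 * 2)))"
  have C0: "0 \<le> C" using c0 rellich_const_ge0 by (simp add: C_def)
  have "\<exists>u\<in>Lp p. (AE x in lborel. lam * u x - A_op F G u x = g x) \<and> Lp_norm p u \<le> C * Lp_norm p g" if g: "g \<in> Lp p" for g
  proof -
    obtain v where v: "v \<in> Lp p" and vS: "AE x in lborel. lam * v x - S v x = g x" and vn: "Lp_norm p v \<le> 2 * Lp_norm p g"
      using sop_small_solve[OF p1 p1 kp kp lam g g] unfolding S_def by blast
    define h where "h = R v"
    have hp: "h \<in> Lp p" and hpn: "Lp_norm p h \<le> cpp * Lp_norm p v" and h2: "h \<in> Lp 2" and h2n: "Lp_norm 2 h \<le> cp2 * Lp_norm p v"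
      unfolding h_def R_def cpp_def cp2_def using sop_kR[OF p(1) p1 d v] sop_kR[OF p(1) _ d v, of 2] by auto
    obtain w where w: "w \<in> Lp 2" and wA: "AE x in lborel. lam * w x - A_op F G w x = h x" and wn: "Lp_norm 2 w \<le> rellich_const * Lp_norm 2 h"
      using L2_solve[OF lam h2] by blast
    have Rwp: "R w \<in> Lp p" and Rwn: "Lp_norm p (R w) \<le> c2p * Lp_norm 2 w" and Rw2: "R w \<in> Lp 2"
      unfolding R_def c2p_def using sop_kR[OF _ p1 d w] sop_kR[OF _ _ d w, of 2] by auto
    obtain w' where w': "w' \<in> Lp p" "w' \<in> Lp 2" and w'S: "AE x in lborel. lam * w' x - S w' x = h x + R w x"
      and w'n: "Lp_norm p w' \<le> 2 * Lp_norm p (\<lambda>x. h x + R w x)"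
      using sop_small_solve[OF p1 _ kp k2 lam add_mem[OF hp Rwp] Lp_add(1)[OF _ h2 Rw2]] unfolding S_def by auto
    have "AE x in lborel. lam * w x - S w x = h x + R w x"
      using wA A_op_split[OF two d k2 w] unfolding S_def R_def by eventually_elim (auto simp: algebra_simps)
    with w'S have "AE x in lborel. lam * w x - S w x = lam * w' x - S w' x" by eventually_elim simp
    \<comment> \<open>w is known only in \<open>L_2\<close>, w' in both spaces. Uniqueness for the
      small operator in \<open>L_2\<close> identifies them and thereby puts w into
      \<open>L_p\<close>.\<close>
    then have ww': "AE x in lborel. w x = w' x"
      unfolding S_def using sop_small_unique[OF _ k2 lam w w'(2)] by simp
    have Rww': "R w x = R w' x" for x
      unfolding R_def by (rule sop_kR_cong_AE[OF Lp_measurable[OF w] Lp_measurable[OF w'(1)] ww'])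
    define u where "u x = 1 * v x + 1 * w' x" for x
    have u: "u \<in> Lp p" unfolding u_def[abs_def] by (intro comb_mem v w')
    have "AE x in lborel. A_op F G u x = A_op F G v x + A_op F G w' x"
      using kop_comb_AE[OF kA v w'(1), of 1 1] unfolding u_def[abs_def] A_op_def by eventually_elim (simp add: distrib_left)
    moreover have "AE x in lborel. A_op F G v x = S v x + R v x" "AE x in lborel. A_op F G w' x = S w' x + R w' x"
      unfolding S_def R_def by (rule A_op_split[OF p(1) d kp] v w')+
    ultimately have "AE x in lborel. lam * u x - A_op F G u x = g x"
      using vS w'S by eventually_elim (simp add: u_def h_def Rww' algebra_simps)
    moreover have "Lp_norm p u \<le> C * Lp_norm p g"
    proof -
      have "Lp_norm p u \<le> Lp_norm p v + Lp_norm p w'" by (rule N_le[OF v w'(1)]) (simp add: u_def)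
      also have "Lp_norm p w' \<le> 2 * (Lp_norm p h + Lp_norm p (R w))"
        by (rule order_trans[OF w'n mult_left_mono[OF N_add[OF hp Rwp]]]) simp
      also have "Lp_norm p (R w) \<le> c2p * (rellich_const * (cp2 * (2 * Lp_norm p g)))"
        using Rwn wn h2n vn c0 rellich_const_ge0
        by (meson mult_left_mono order_trans)
      also have "Lp_norm p h \<le> cpp * (2 * Lp_norm p g)"
        using hpn vn c0 by (meson mult_left_mono order_trans)
      finally show ?thesis using vn by (simp add: C_def algebra_simps)
    qed
    ultimately show ?thesis using u by blast
  qed
  with C0 show ?thesis by (rule that)
qed

text \<open>For a solution u of the homogeneous equation, (lam - S) u = R u has a right side in both
  spaces, so u coincides with a function in \<open>L_2\<close>, where the Rellich estimate forces it
  to vanish.\<close>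

lemma Lp_injective:
  assumes lam: "1 \<le> \<bar>lam\<bar>" and u: "u \<in> Lp p" and z: "AE x in lborel. lam * u x - A_op F G u x = 0"
  shows "AE x in lborel. u x = 0"
proof -
  have p1: "1 \<le> p" using p by simp
  obtain d N where d: "0 < d" and kp: "kernel_bounded p (kS d N) 1" and k2: "kernel_bounded 2 (kS d N) 1"
    by (rule kS_small)
  define R where "R = sop (kR d N)"
  define S where "S = sop (kS d N)"
  have Rp: "R u \<in> Lp p" "R u \<in> Lp 2" unfolding R_def using sop_kR(1)[OF p(1) p1 d u] sop_kR(1)[OF p(1) _ d u, of 2] by auto
  have uS: "AE x in lborel. lam * u x - S u x = R u x"
    using z A_op_split[OF p(1) d kp u] unfolding S_def R_def by eventually_elim simp
  obtain v where v: "v \<in> Lp p" "v \<in> Lp 2" and vS: "AE x in lborel. lam * v x - S v x = R u x"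
    using sop_small_solve[OF p1 _ kp k2 lam Rp] unfolding S_def by auto
  have "AE x in lborel. lam * u x - S u x = lam * v x - S v x" using uS vS by eventually_elim simp
  then have uv: "AE x in lborel. u x = v x" unfolding S_def by (rule sop_small_unique[OF p1 kp lam u v(1)])
  have Auv: "A_op F G u x = A_op F G v x" for x
    by (rule A_op_cong_AE[OF Lp_measurable[OF u] Lp_measurable[OF v(1)] uv])
  have ae: "AE x in lborel. lam * v x - A_op F G v x = 0" using z uv by eventually_elim (simp add: Auv)
  have "Lp_norm 2 (\<lambda>x. lam * v x - A_op F G v x) = Lp_norm 2 (\<lambda>_. 0)"
  proof -
    have "(\<integral>x. (lam * v x - A_op F G v x)\<^sup>2 \<partial>lborel) = (\<integral>x. 0 \<partial>(lborel :: real measure))"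
      by (rule integral_cong_AE)
        (use ae Lp_measurable[OF v(1)] kop_measurable[OF A_ker_measurable Lp_measurable[OF v(1)]] in \<open>auto simp: A_op_def\<close>)
    then show ?thesis by (simp add: Lp_norm_def)
  qed
  then have "Lp_norm 2 v = 0"
    using rellich_estimate[OF v(2) lam] Lp_norm_ge0[of 2 v] by (simp add: Lp_norm_def)
  then have "AE x in lborel. v x = 0" using Lp_norm_eq_0[OF _ v(2)] by (simp add: ae_eq_def)
  with uv show ?thesis by eventually_elim simp
qed

end

section \<open>Passage between the two notions of bounded operator\<close>

lemma bounded_op_Lp_lin_op:
  assumes p: "1 \<le> p" and T: "bounded_op_Lp p T"
  obtains C where "fspace.lin_op (Lp p) (Lp_norm p) T C"
proof -
  interpret fspace "Lp p" "Lp_norm p" by (rule fspace_Lp[OF p])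
  obtain C where C: "\<And>u. u \<in> Lp p \<Longrightarrow> Lp_norm p (T u) \<le> C * Lp_norm p u"
    using T unfolding bounded_op_Lp_def by blast
  have Tm: "T u \<in> Lp p" if "u \<in> Lp p" for u using T that unfolding bounded_op_Lp_def by blast
  \<comment> \<open>\<open>lin_op\<close> asks for a nonnegative bound, whereas the constant
    extracted from \<open>bounded_op_Lp\<close> carries no sign.\<close>
  have "lin_op T (max C 0)" unfolding lin_op_def
  proof (intro conjI ballI allI)
    fix u assume u: "u \<in> Lp p"
    have "C * Lp_norm p u \<le> max C 0 * Lp_norm p u" by (intro mult_right_mono) (auto simp: Lp_norm_ge0)
    then show "Lp_norm p (T u) \<le> max C 0 * Lp_norm p u" using C[OF u] by simp
    show "T u \<in> Lp p" by (rule Tm[OF u])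
  next
    fix u v a b assume u: "u \<in> Lp p" "v \<in> Lp p"
    then have "ae_eq (T (\<lambda>x. a * u x + b * v x)) (\<lambda>x. a * T u x + b * T v x)"
      using T unfolding bounded_op_Lp_def by blast
    then show "Lp_norm p (\<lambda>x. T (\<lambda>x. a * u x + b * v x) x - (a * T u x + b * T v x)) = 0"
      by (subst Lp_norm_diff_eq_0[OF p]) (auto intro!: Tm comb_mem u simp: ae_eq_def)
  qed simp
  then show ?thesis by (rule that)
qed

lemma lin_op_bounded_op_Lp:
  assumes p: "1 \<le> p" and T: "fspace.lin_op (Lp p) (Lp_norm p) T C"
  shows "bounded_op_Lp p T"
proof -
  interpret fspace "Lp p" "Lp_norm p" by (rule fspace_Lp[OF p])
  note m = lin_op_mem[OF T]
  show ?thesis unfolding bounded_op_Lp_def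
  proof (intro conjI ballI impI allI)
    fix u v assume u: "u \<in> Lp p" "v \<in> Lp p"
    show "ae_eq (T u) (T v)" if "ae_eq u v"
    proof -
      have "Lp_norm p (\<lambda>x. u x - v x) = 0" using Lp_norm_diff_eq_0[OF p u] that by (simp add: ae_eq_def)
      then have "Lp_norm p (\<lambda>x. T u x - T v x) = 0"
        using lin_op_diff[OF T u] Lp_norm_ge0[of p "\<lambda>x. T u x - T v x"] by simp
      then show ?thesis using Lp_norm_diff_eq_0[OF p m m] u by (simp add: ae_eq_def)
    qed
    show "ae_eq (T (\<lambda>x. a * u x + b * v x)) (\<lambda>x. a * T u x + b * T v x)" for a b
      using lin_op_comb[OF T u, of a b]
        Lp_norm_diff_eq_0[OF p m[OF comb_mem[OF u, of a b]] comb_mem[OF m[OF u(1)] m[OF u(2)], of a b]]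
      by (simp add: ae_eq_def)
  qed (use m lin_op_le[OF T] in auto)
qed

section \<open>The principal value, uniqueness of the bounded extension, and the resolvent\<close>

context graph
begin

text \<open>The integrand over y is absolutely integrable, so both truncations disappear by
  dominated convergence and no cancellation between y and -y is used.\<close>

lemma A_trunc_tendsto:
  assumes f: "f \<in> borel_measurable borel" "ae_eq f F" and x: "f x = F x" "wderiv f x = G x"
    and om: "\<omega> \<in> borel_measurable borel" and i: "integrable lborel (\<lambda>y. A_ker F G x y * \<omega> (x - y))"
  shows "(A_trunc f \<omega> x \<longlongrightarrow> A_op F G \<omega> x) (at_right 0)"
proof -
  note [measurable] = f(1) om
  define h where "h y = A_ker F G x y * \<omega> (x - y)" for y
  have [measurable]: "A_ker F G x \<in> borel_measurable borel"
    using measurable_compose[OF measurable_Pair1' A_ker_measurable, of x] by simp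
  have [measurable]: "h \<in> borel_measurable borel" unfolding h_def[abs_def] by measurable
  \<comment> \<open>At the fixed x the values f x and wderiv f x are the right ones; under the
    integral f (x - y) may be replaced by F (x - y) because the exceptional set is a reflected
    translate of a null set.\<close>
  have "AE y in lborel. f (x + (-1) * y) = F (x + (-1) * y)"
    by (rule AE_borel_affine) (use f(2) in \<open>auto simp: ae_eq_def\<close>)
  then have ae: "AE y in lborel. A_kernel f x y * \<omega> (x - y) = h y"
    by eventually_elim (simp add: A_kernel_def A_ker_def h_def x)
  have [measurable]: "A_kernel f x \<in> borel_measurable borel" unfolding A_kernel_def[abs_def] by measurable
  have tr: "A_trunc f \<omega> x e = (1 / pi) * (\<integral>y. indicator {y. e < \<bar>y\<bar> \<and> \<bar>y\<bar> < 1 / e} y * h y \<partial>lborel)" for e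
  proof -
    have "(\<integral>y. indicator {y. e < \<bar>y\<bar> \<and> \<bar>y\<bar> < 1 / e} y *\<^sub>R (A_kernel f x y * \<omega> (x - y)) \<partial>lborel) = (\<integral>y. indicator {y. e < \<bar>y\<bar> \<and> \<bar>y\<bar> < 1 / e} y * h y \<partial>lborel)"
      by (rule integral_cong_AE) (use ae in \<open>auto elim!: eventually_mono\<close>)
    then show ?thesis by (simp add: A_trunc_def set_lebesgue_integral_def)
  qed
  show ?thesis unfolding tendsto_at_iff_sequentially
  proof (intro allI impI)
    fix e :: "nat \<Rightarrow> real" assume e: "\<forall>i. e i \<in> {0<..} - {0}" and l: "e \<longlonglongrightarrow> 0"
    have "(\<lambda>n. \<integral>y. indicator {y. e n < \<bar>y\<bar> \<and> \<bar>y\<bar> < 1 / e n} y * h y \<partial>lborel) \<longlonglongrightarrow> (\<integral>y. h y \<partial>lborel)"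
    proof (rule integral_dominated_convergence)
      show "integrable lborel (\<lambda>y. \<bar>h y\<bar>)" using i by (simp add: h_def[abs_def])
      show "AE y in lborel. (\<lambda>n. indicator {y. e n < \<bar>y\<bar> \<and> \<bar>y\<bar> < 1 / e n} y * h y) \<longlonglongrightarrow> h y"
        using AE_lborel_singleton[of 0]
      proof eventually_elim
        case (elim y)
        have "eventually (\<lambda>n. e n < \<bar>y\<bar>) sequentially" "eventually (\<lambda>n. e n < 1 / \<bar>y\<bar>) sequentially"
          using order_tendstoD(2)[OF l] elim by auto
        then have "eventually (\<lambda>n. indicator {y. e n < \<bar>y\<bar> \<and> \<bar>y\<bar> < 1 / e n} y * h y = h y) sequentially"
        proof eventually_elim
          case n: (elim n)
          have "0 < e n" using e by auto
          then have "\<bar>y\<bar> < 1 / e n" using n(2) elim by (simp add: field_simps)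
          then show ?case using n(1) by simp
        qed
        then show ?case by (rule tendsto_eventually)
      qed
    qed (auto simp: indicator_def)
    then show "(A_trunc f \<omega> x \<circ> e) \<longlonglongrightarrow> A_op F G \<omega> x"
      unfolding o_def tr A_op_def kop_def h_def[symmetric] by (intro tendsto_intros)
  qed
qed

text \<open>Any T as in the definition agrees almost everywhere with \<open>A_op\<close> on test
  functions, by uniqueness of the pointwise limit, and then on \<open>L_p\<close> by density and
  boundedness of both. Statements about \<open>A_op\<close> thus carry over to every such T.\<close>

lemma A_op_is_A_op:
  assumes f: "f \<in> borel_measurable borel" "ae_eq f F" "ae_eq (wderiv f) G"
  shows "is_A_op p f (A_op F G)"
    and "is_A_op p f T \<Longrightarrow> u \<in> Lp p \<Longrightarrow> AE x in lborel. T u x = A_op F G u x"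
proof -
  have p1: "1 \<le> p" and p0: "0 < p" using p by auto
  interpret fspace "Lp p" "Lp_norm p" by (rule fspace_Lp[OF p1])
  obtain D where kA: "kernel_bounded p (A_ker F G) D" using A_bounded[OF p(1) G_Lp] by blast
  have A: "lin_op (A_op F G) (\<bar>1 / pi\<bar> * D)"
    unfolding A_op_def[abs_def] by (rule lin_op_scale[OF kop_lin_op[OF p1 kA]])
  have lim: "AE x in lborel. (A_trunc f \<omega> x \<longlongrightarrow> A_op F G \<omega> x) (at_right 0)" if t: "test_fun \<omega>" for \<omega>
    using kernel_boundedD(3)[OF kA test_fun_Lp[OF t p0]] f(2)[unfolded ae_eq_def] f(3)[unfolded ae_eq_def]
    by eventually_elim (rule A_trunc_tendsto[OF f(1,2) _ _ test_fun_measurable[OF t]])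
  show "is_A_op p f (A_op F G)"
    unfolding is_A_op_def using lin_op_bounded_op_Lp[OF p1 A] lim by blast
  assume T: "is_A_op p f T" and u: "u \<in> Lp p"
  obtain C where TC: "lin_op T C" using bounded_op_Lp_lin_op[OF p1] T unfolding is_A_op_def by blast
  have eq: "Lp_norm p (\<lambda>x. T \<phi> x - A_op F G \<phi> x) = 0" if t: "test_fun \<phi>" for \<phi>
  proof -
    have "AE x in lborel. (A_trunc f \<phi> x \<longlongrightarrow> T \<phi> x) (at_right 0)" using T t unfolding is_A_op_def by blast
    then have "AE x in lborel. T \<phi> x = A_op F G \<phi> x"
      using lim[OF t] by eventually_elim (rule tendsto_unique[OF trivial_limit_at_right_real])
    then show ?thesis
      using Lp_norm_diff_eq_0[OF p1 lin_op_mem[OF TC] lin_op_mem[OF A]] test_fun_Lp[OF t p0] by blast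
  qed
  define E where "E = C + \<bar>1 / pi\<bar> * D + 1"
  have E: "0 < E" using lin_op_ge0[OF TC] lin_op_ge0[OF A] by (simp add: E_def)
  have "Lp_norm p (\<lambda>x. T u x - A_op F G u x) \<le> 0 + e" if e: "0 < e" for e
  proof -
    obtain \<phi> where t: "test_fun \<phi>" and n: "Lp_norm p (\<lambda>x. u x - \<phi> x) < e / E"
      using test_fun_dense[OF p1 u, of "e / E"] e E by auto
    have fm: "\<phi> \<in> Lp p" by (rule test_fun_Lp[OF t p0])
    define r where "r = Lp_norm p (\<lambda>x. u x - \<phi> x)"
    have "Lp_norm p (\<lambda>x. T u x - A_op F G u x) \<le> Lp_norm p (\<lambda>x. T u x - T \<phi> x) + Lp_norm p (\<lambda>x. T \<phi> x - A_op F G u x)"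
      by (rule N_le) (intro diff_mem lin_op_mem[OF TC] lin_op_mem[OF A] u fm, intro diff_mem lin_op_mem[OF TC] lin_op_mem[OF A] u fm, simp)
    also have "Lp_norm p (\<lambda>x. T \<phi> x - A_op F G u x) \<le> Lp_norm p (\<lambda>x. T \<phi> x - A_op F G \<phi> x) + Lp_norm p (\<lambda>x. A_op F G \<phi> x - A_op F G u x)"
      by (rule N_le) (intro diff_mem lin_op_mem[OF TC] lin_op_mem[OF A] u fm, intro diff_mem lin_op_mem[OF TC] lin_op_mem[OF A] u fm, simp)
    also have "Lp_norm p (\<lambda>x. A_op F G \<phi> x - A_op F G u x) \<le> (\<bar>1 / pi\<bar> * D) * r"
      unfolding r_def N_swap[OF u fm] by (rule lin_op_diff[OF A fm u])
    also have "Lp_norm p (\<lambda>x. T u x - T \<phi> x) \<le> C * r" unfolding r_def by (rule lin_op_diff[OF TC u fm])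
    finally have "Lp_norm p (\<lambda>x. T u x - A_op F G u x) \<le> (C + \<bar>1 / pi\<bar> * D) * r"
      by (simp only: eq[OF t]) (simp add: algebra_simps)
    also have "\<dots> \<le> E * r" by (rule mult_right_mono) (auto simp: E_def r_def Lp_norm_ge0)
    also have "\<dots> \<le> e" using n E by (simp add: r_def field_simps)
    finally show ?thesis by simp
  qed
  then have "Lp_norm p (\<lambda>x. T u x - A_op F G u x) \<le> 0" by (rule field_le_epsilon)
  then have "Lp_norm p (\<lambda>x. T u x - A_op F G u x) = 0" using Lp_norm_ge0 by (intro order_antisym) auto
  then show "AE x in lborel. T u x = A_op F G u x"
    using Lp_norm_diff_eq_0[OF p1 lin_op_mem[OF TC u] lin_op_mem[OF A u]] by simp
qed

lemma isom_resolvent: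
  assumes T: "bounded_op_Lp p T" and TA: "\<And>u. u \<in> Lp p \<Longrightarrow> AE x in lborel. T u x = A_op F G u x"
    and lam: "1 \<le> \<bar>lam\<bar>"
  shows "isom_Lp p (\<lambda>u x. lam * u x - T u x)"
proof -
  have p1: "1 \<le> p" using p by auto
  interpret fspace "Lp p" "Lp_norm p" by (rule fspace_Lp[OF p1])
  obtain C where TC: "lin_op T C" using bounded_op_Lp_lin_op[OF p1 T] by blast
  note m = lin_op_mem[OF TC]
  have op: "lin_op (\<lambda>u x. lam * u x - T u x) (\<bar>lam\<bar> + C)" unfolding lin_op_def
  proof (intro conjI ballI allI)
    show "0 \<le> \<bar>lam\<bar> + C" using lin_op_ge0[OF TC] by simp
  next
    fix u assume u: "u \<in> Lp p"
    show "(\<lambda>x. lam * u x - T u x) \<in> Lp p" by (intro diff_mem scale_mem m u)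
    have "Lp_norm p (\<lambda>x. lam * u x - T u x) \<le> Lp_norm p (\<lambda>x. lam * u x) + Lp_norm p (\<lambda>x. (-1) * T u x)"
      by (rule N_le) (intro scale_mem m u, intro scale_mem m u, simp)
    then show "Lp_norm p (\<lambda>x. lam * u x - T u x) \<le> (\<bar>lam\<bar> + C) * Lp_norm p u"
      unfolding N_scale[OF u] N_scale[OF m[OF u]] using lin_op_le[OF TC u] by (simp add: distrib_right)
  next
    fix u v a b assume u: "u \<in> Lp p" "v \<in> Lp p"
    show "Lp_norm p (\<lambda>x. lam * (a * u x + b * v x) - T (\<lambda>x. a * u x + b * v x) x - (a * (lam * u x - T u x) + b * (lam * v x - T v x))) = 0"
      by (rule lin_op_resolvent_diff[OF TC u])
  qed
  have inj: "ae_eq u (\<lambda>x. 0)" if u: "u \<in> Lp p" and z: "AE x in lborel. lam * u x - T u x = 0" for u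
  proof -
    have "AE x in lborel. lam * u x - A_op F G u x = 0" using TA[OF u] z by eventually_elim simp
    from Lp_injective[OF lam u this] show ?thesis by (simp add: ae_eq_def)
  qed
  obtain K where K: "0 \<le> K" "\<And>g. g \<in> Lp p \<Longrightarrow> \<exists>u\<in>Lp p. (AE x in lborel. lam * u x - A_op F G u x = g x) \<and> Lp_norm p u \<le> K * Lp_norm p g"
    using Lp_solve[OF lam] by blast
  have sol: "\<exists>u\<in>Lp p. (AE x in lborel. lam * u x - T u x = g x) \<and> Lp_norm p u \<le> K * Lp_norm p g" if g: "g \<in> Lp p" for g
  proof -
    obtain u where u: "u \<in> Lp p" "AE x in lborel. lam * u x - A_op F G u x = g x" "Lp_norm p u \<le> K * Lp_norm p g"
      using K(2)[OF g] by blast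
    have "AE x in lborel. lam * u x - T u x = g x" using TA[OF u(1)] u(2) by eventually_elim simp
    with u show ?thesis by blast
  qed
  \<comment> \<open>\<open>Lp_solve\<close> bounds one particular solution for the right side (lam -
    T) u; injectivity shows that this solution is u.\<close>
  have low: "Lp_norm p u \<le> K * Lp_norm p (\<lambda>x. lam * u x - T u x)" if u: "u \<in> Lp p" for u
  proof -
    obtain v where v: "v \<in> Lp p" and ve: "AE x in lborel. lam * v x - T v x = lam * u x - T u x"
      and vn: "Lp_norm p v \<le> K * Lp_norm p (\<lambda>x. lam * u x - T u x)"
      using sol[OF lin_op_mem[OF op u]] by blast
    define w where "w x = 1 * u x + (-1) * v x" for x
    have w: "w \<in> Lp p" unfolding w_def[abs_def] by (intro comb_mem u v)
    have "AE x in lborel. T w x = 1 * T u x + (-1) * T v x"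
      using T u v unfolding bounded_op_Lp_def w_def[abs_def] ae_eq_def by blast
    then have "AE x in lborel. lam * w x - T w x = 0"
      using ve by eventually_elim (simp add: w_def algebra_simps)
    from inj[OF w this] have "AE x in lborel. u x = v x" unfolding ae_eq_def by eventually_elim (simp add: w_def)
    then have "Lp_norm p u = Lp_norm p v"
      by (intro Lp_norm_cong_AE Lp_measurable[OF u] Lp_measurable[OF v]) (simp add: ae_eq_def)
    with vn show ?thesis by simp
  qed
  show ?thesis unfolding isom_Lp_def
  proof (intro conjI ballI impI)
    show "bounded_op_Lp p (\<lambda>u x. lam * u x - T u x)" by (rule lin_op_bounded_op_Lp[OF p1 op])
    show "ae_eq u (\<lambda>x. 0)" if "u \<in> Lp p" "ae_eq (\<lambda>x. lam * u x - T u x) (\<lambda>x. 0)" for u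
      using inj[OF that(1)] that(2) by (simp add: ae_eq_def)
    show "\<exists>u\<in>Lp p. ae_eq (\<lambda>x. lam * u x - T u x) v" if "v \<in> Lp p" for v
      using sol[OF that] by (auto simp: ae_eq_def)
    show "\<exists>c. \<forall>u\<in>Lp p. Lp_norm p u \<le> c * Lp_norm p (\<lambda>x. lam * u x - T u x)" using low by blast
  qed
qed

end

text \<open>A(f) is known only through its defining property as a bounded extension. The claim is
  therefore made for every T with this property, and existence is asserted as well so that the
  quantification is not vacuous.\<close>

theorem theorem3p4:
  fixes p s :: real and f :: "real \<Rightarrow> real"
  assumes "1 < p" and "p \<le> 2"
    and "1 + 1 / p < s" and "s < 2"
    and "f \<in> sobolev_slobodeckij s p"
  shows "(\<exists>T. is_A_op p f T) \<and>
         (\<forall>T. is_A_op p f T \<longrightarrow>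
            (\<forall>lam::real. 1 \<le> \<bar>lam\<bar> \<longrightarrow> isom_Lp p (\<lambda>\<omega> x. lam * \<omega> x - T \<omega> x)))"
proof -
  obtain L M H \<alpha> F G where g: "graph p L M H \<alpha> F G" and F: "ae_eq f F" and G: "ae_eq (wderiv f) G"
    using sobolev_regular[OF assms(1,2,3,5)] by blast
  interpret graph p L M H \<alpha> F G by (rule g)
  have f: "f \<in> borel_measurable borel" using assms(5) by (auto simp: sobolev_slobodeckij_def intro: Lp_measurable)
  note A = A_op_is_A_op[OF f F G]
  show ?thesis
  proof (intro conjI allI impI)
    show "\<exists>T. is_A_op p f T" using A(1) by blast
    fix T and lam :: real assume T: "is_A_op p f T" and l: "1 \<le> \<bar>lam\<bar>"
    show "isom_Lp p (\<lambda>\<omega> x. lam * \<omega> x - T \<omega> x)"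
      by (rule isom_resolvent[OF _ A(2)[OF T] l]) (use T in \<open>simp_all add: is_A_op_def\<close>)
  qed
qed

end
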